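(* If a stratification of a closed set $S\subset\mathbb{R}^n$, definable in some o-minimal structure (not necessarily polynomially bounded), satisfies both $(a)$ and $(r_{\int})$ (for all pairs of adjacent strata), then it satisfies conditions $(npf)$ and $(n)$ along each stratum.
   Context: Strata are $C^2$ submanifolds, definable in the o-minimal structure (which expands the real field), and the stratification has the frontier property. A pair of adjacent strata is written $(Y,X)$ with $X\subset \mathrm{cl}(Y)\setminus Y$. For linear subspaces $E,F$ set $\delta(E,F)=\sup_{u\in E,|u|=1}d(u,F)$. For a stratum $X$, $\pi$ denotes the local canonical (nearest point) retraction onto $X$. Condition $(a)$ for $(Y,X)$ at $x_0\in X$: $\delta(T_{\pi(y)}X,T_yY)\to 0$ as $y\to x_0$, $y\in Y$. Condition $(r_{\int})$ for $(Y,X)$ at $x_0\in X$: working in a local coordinate system at $x_0$ in which $x_0$ is the origin and $X$ is a neighbourhood of the origin in a linear subspace of dimension $\dim X$, with $\pi$ the orthogonal projection onto that subspace, set for small $t>0$ $$r(t)=\sup_{|\pi(y)|=t}\frac{\delta(X,T_yY)}{|y-\pi(y)|},$$ the supremum being over $y\in Y$ in a small neighbourhood of the origin. Then $(r_{\int})$ holds at $x_0$ if $\int_{[0,\varepsilon]}r(t)\,dt<\infty$ for some $\varepsilon>0$. A pair satisfies $(a)$ (resp. $(r_{\int})$) if it does so at every point of the smaller stratum. Normal cone: with $\mu(v)=v/|v|$, the normal cone $C_XS$ of $S$ along $X$ is the restriction to $X$ (i.e. the part lying over points of $X$) of the closure in $\mathbb{R}^n\times S^{n-1}$ of $\{(y,\mu(\pi(y)-y))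 : y\in S\setminus X\}$ ($y$ near $X$). Let $p:C_XS\to X$ be the projection and $(C_XS)_x$ its fibre at $x$. Condition $(n)$ along $X$: for every $x\in X$, $(C_XS)_x$ equals the tangent cone $C_x(S_x)$ at $x$ of the fibre $S_x=S\cap\pi^{-1}(x)$, i.e. the set of all limits of $\mu(x-y)$ as $y\to x$, $y\in S_x\setminus\{x\}$ (same sign convention). Condition $(npf)$ (normal pseudo-flatness) along $X$: the projection $p:C_XS\to X$ is an open map. *)

theory Defs
  imports "HOL-Analysis.Analysis"
begin

(* A structure is a family D, where D m consists of subsets of R^m and R^m is modelled by the
   real lists of length m.  The singletons in D 1 amount to allowing real parameters;
   finite unions of points and open intervals are the same as finite unions of intervals. *)
locale o_minimal_expansion_of_reals =
  fixes D :: "nat \<Rightarrow> real list set set"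
  assumes ambient: "A \<in> D m \<Longrightarrow> A \<subseteq> {xs. length xs = m}"
    and empty: "{} \<in> D m"
    and complement: "A \<in> D m \<Longrightarrow> {xs. length xs = m} - A \<in> D m"
    and union: "A \<in> D m \<Longrightarrow> B \<in> D m \<Longrightarrow> A \<union> B \<in> D m"
    and cylinder_left: "A \<in> D m \<Longrightarrow> {x # xs | x xs. xs \<in> A} \<in> D (Suc m)"
    and cylinder_right: "A \<in> D m \<Longrightarrow> {xs @ [x] | xs x. xs \<in> A} \<in> D (Suc m)"
    and diagonal: "i < m \<Longrightarrow> j < m \<Longrightarrow> {xs. length xs = m \<and> xs ! i = xs ! j} \<in> D m"
    and projection: "A \<in> D (Suc m) \<Longrightarrow> butlast ` A \<in> D m"
    and singleton: "{[a]} \<in> D 1"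
    and less: "{[x, y] | x y. x < y} \<in> D 2"
    and plus: "{[x, y, x + y] | x y. True} \<in> D 3"
    and times: "{[x, y, x * y] | x y. True} \<in> D 3"
    and o_minimal: "A \<in> D 1 \<Longrightarrow> \<exists>F. finite F \<and> (\<forall>I\<in>F. is_interval I) \<and> {x. [x] \<in> A} = \<Union>F"

(* D is invariant under permutations of the coordinates, so the enumeration bs is immaterial. *)
definition definable :: "(nat \<Rightarrow> real list set set) \<Rightarrow> 'a::euclidean_space set \<Rightarrow> bool" where
  "definable D A \<longleftrightarrow> (\<exists>bs. distinct bs \<and> set bs = (Basis :: 'a set) \<and>
     (\<lambda>x. map (\<lambda>b. x \<bullet> b) bs) ` A \<in> D DIM('a))"

definition C2_on :: "'a::euclidean_space set \<Rightarrow> ('a \<Rightarrow> 'b::euclidean_space) \<Rightarrow> bool" where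
  "C2_on U f \<longleftrightarrow> (\<exists>(f' :: 'a \<Rightarrow> 'a \<Rightarrow>\<^sub>L 'b) (f'' :: 'a \<Rightarrow> 'a \<Rightarrow>\<^sub>L ('a \<Rightarrow>\<^sub>L 'b)).
     (\<forall>x\<in>U. (f has_derivative blinfun_apply (f' x)) (at x)) \<and>
     (\<forall>x\<in>U. (f' has_derivative blinfun_apply (f'' x)) (at x)) \<and>
     continuous_on U f'')"

definition C2_diffeomorphism :: "'a::euclidean_space set \<Rightarrow> 'a set \<Rightarrow> ('a \<Rightarrow> 'a) \<Rightarrow> bool" where
  "C2_diffeomorphism U V h \<longleftrightarrow> open U \<and> open V \<and>
     (\<exists>g. homeomorphism U V h g \<and> C2_on U h \<and> C2_on V g)"

(* A coordinate system h on U at x in which x is the origin and M is an open piece of the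
   linear subspace L. *)
definition flattening_chart ::
    "'a::euclidean_space set \<Rightarrow> 'a \<Rightarrow> 'a set \<Rightarrow> 'a set \<Rightarrow> ('a \<Rightarrow> 'a) \<Rightarrow> bool" where
  "flattening_chart M x L U h \<longleftrightarrow> x \<in> U \<and> h x = 0 \<and> subspace L \<and>
     C2_diffeomorphism U (h ` U) h \<and> h ` (U \<inter> M) = h ` U \<inter> L"

definition C2_submanifold :: "'a::euclidean_space set \<Rightarrow> bool" where
  "C2_submanifold M \<longleftrightarrow> (\<exists>k. \<forall>x\<in>M. \<exists>L U h. flattening_chart M x L U h \<and> dim L = k)"

(* The velocities at y of curves in M; on a submanifold it makes no difference whether the curves
   are required to be differentiable at the single parameter value 0 or C^1. *)
definition tangent_space :: "'a::euclidean_space set \<Rightarrow> 'a \<Rightarrow> 'a set" where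
  "tangent_space M y = {v. \<exists>\<gamma> :: real \<Rightarrow> 'a. \<gamma> 0 = y \<and> (\<forall>\<^sub>F s in at 0. \<gamma> s \<in> M) \<and>
     (\<gamma> has_vector_derivative v) (at 0)}"

(* The supremum over the unit vectors u of E of the distance from u to F; the element 0 is inserted
   only to give the value 0 for E = {0}, as Sup {} is unspecified on the reals. *)
definition delta :: "'a::euclidean_space set \<Rightarrow> 'a set \<Rightarrow> real" where
  "delta E F = Sup (insert 0 {infdist u F | u. u \<in> E \<and> norm u = 1})"

definition definable_stratification ::
    "(nat \<Rightarrow> real list set set) \<Rightarrow> 'a::euclidean_space set \<Rightarrow> 'a set set \<Rightarrow> bool" where
  "definable_stratification D S \<X> \<longleftrightarrow>
     partition_on S \<X> \<and> locally_finite_in euclidean \<X> \<and>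
     (\<forall>X\<in>\<X>. definable D X \<and> C2_submanifold X) \<and>
     (\<forall>X\<in>\<X>. \<forall>Y\<in>\<X>. X \<inter> closure Y \<noteq> {} \<longrightarrow> X \<subseteq> closure Y)"

definition adjacent :: "'a::euclidean_space set \<Rightarrow> 'a set \<Rightarrow> bool" where
  "adjacent Y X \<longleftrightarrow> X \<subseteq> closure Y - Y"

(* closest_point X is the canonical retraction onto X near each point of X, where nearest points
   exist and are unique.  Its arbitrary values elsewhere never matter: all the conditions below
   only look at points converging to a point of X. *)
definition condition_a_at :: "'a::euclidean_space set \<Rightarrow> 'a set \<Rightarrow> 'a \<Rightarrow> bool" where
  "condition_a_at Y X x0 \<longleftrightarrow>
     ((\<lambda>y. delta (tangent_space X (closest_point X y)) (tangent_space Y y)) \<longlongrightarrow> 0) (at x0 within Y)"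

definition condition_a :: "'a::euclidean_space set \<Rightarrow> 'a set \<Rightarrow> bool" where
  "condition_a Y X \<longleftrightarrow> (\<forall>x0\<in>X. condition_a_at Y X x0)"

(* The function r(t) for Y and the linear subspace L, on the ball of radius \<eta> about 0.
   Here closest_point L is the orthogonal projection onto L. *)
definition r_function :: "'a::euclidean_space set \<Rightarrow> 'a set \<Rightarrow> real \<Rightarrow> real \<Rightarrow> ennreal" where
  "r_function Y L \<eta> t = (SUP y\<in>{y \<in> Y \<inter> ball 0 \<eta>. norm (closest_point L y) = t}.
     ennreal (delta L (tangent_space Y y) / norm (y - closest_point L y)))"

definition condition_r_int_at :: "'a::euclidean_space set \<Rightarrow> 'a set \<Rightarrow> 'a \<Rightarrow> bool" where
  "condition_r_int_at Y X x0 \<longleftrightarrow>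
     (\<exists>L U h. flattening_chart X x0 L U h \<and>
       (\<exists>\<eta>>0. \<exists>\<epsilon>>0. (\<integral>\<^sup>+t\<in>{0..\<epsilon>}. r_function (h ` (U \<inter> Y)) L \<eta> t \<partial>lborel) < \<infinity>))"

definition condition_r_int :: "'a::euclidean_space set \<Rightarrow> 'a set \<Rightarrow> bool" where
  "condition_r_int Y X \<longleftrightarrow> (\<forall>x0\<in>X. condition_r_int_at Y X x0)"

definition normal_cone :: "'a::euclidean_space set \<Rightarrow> 'a set \<Rightarrow> ('a \<times> 'a) set" where
  "normal_cone X S = closure {(y, sgn (closest_point X y - y)) | y. y \<in> S - X} \<inter> X \<times> sphere 0 1"

definition tangent_cone :: "'a::euclidean_space set \<Rightarrow> 'a \<Rightarrow> 'a set" where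
  "tangent_cone A x = {u. \<exists>y :: nat \<Rightarrow> 'a. (\<forall>i. y i \<in> A - {x}) \<and> y \<longlonglongrightarrow> x \<and>
     (\<lambda>i. sgn (x - y i)) \<longlonglongrightarrow> u}"

definition condition_n :: "'a::euclidean_space set \<Rightarrow> 'a set \<Rightarrow> bool" where
  "condition_n S X \<longleftrightarrow>
     (\<forall>x\<in>X. {u. (x, u) \<in> normal_cone X S} = tangent_cone {y \<in> S. closest_point X y = x} x)"

definition condition_npf :: "'a::euclidean_space set \<Rightarrow> 'a set \<Rightarrow> bool" where
  "condition_npf S X \<longleftrightarrow> open_map (top_of_set (normal_cone X S)) (top_of_set X) fst"

end

(* For a stratum X, a point x0 of X and nearby points x of X, every point y of S - X near x0 can be
   moved inside S to a point y' whose closest point on X is x, such that the normal vector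
   y - closest_point X y changes only by a small fraction of its length.  Moving to x0 itself gives
   condition (n); moving a sequence that realizes a normal direction at x0 to a nearby x gives
   the openness (npf).

   The motion exists because the tangent spaces of a stratum Y almost contain that of X: in the chart
   of condition (r_int), a motion in a direction of L can be lifted to Y with the normal component n
   changing at a rate at most r(t) * norm n, where t is the distance of the projection from 0.  If t
   is monotone, the total change of log (norm n) is bounded by the integral of r near 0.  As S is
   closed, a limit of such motions stays in S, possibly in a smaller stratum.  The function r is
   Borel measurable since strata are locally closed. *)
theory Submission
  imports Defs
begin

text \<open>The obstacle is that r is merely integrable: it may be unbounded near 0 or infinite on a
  null set, so its values do not bound increments over short intervals. It is replaced by a
  continuous monotone \<open>R\<close> whose increments near t are at least r(t) + 1 times those of
  the radius; the extra 1 pays for the error of a single step. Differential equations are replaced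
  by small steps that hit their target exactly (a Brouwer fixed point), and the continuation of
  integral curves by a maximality argument on pairs of a parameter and a point. Condition (a) enters
  through the uniform smallness of \<open>delta\<close>, which makes the steps solvable; the
  precision of the normal vector comes from (r_int). As r is a supremum over all base points at
  distance t, a motion with oscillating radius could use up the same part of the integral again and
  again. This explains the detour through radius 0. A further complication is that the closest point
  retraction, read in a chart, is not the orthogonal projection onto L. The outward motion must
  prescribe the former while the rate depends on the latter; a cone condition links the two.\<close>

section \<open>An integrable rate and its primitive\<close>

text \<open>Discrete layer-cake bound: for \<open>y = f t\<close> the left side counts the level
  sets {f > k} that contain t, so the measures of the level sets sum to at most the integral of f +
  1.\<close>

lemma suminf_indicator_le:
  fixes y :: ennreal
  shows "(\<Sum>k. if of_nat k < y then 1 else 0 :: ennreal) \<le> y + 1"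
proof (cases "y = \<infinity>")
  case False
  then obtain x where x: "y = ennreal x" "0 \<le> x"
    by (cases y) auto
  have eq: "of_nat k < y \<longleftrightarrow> k < nat \<lceil>x\<rceil>" for k
  proof -
    have "of_nat k < y \<longleftrightarrow> real k < x"
      using x by (metis ennreal_less_iff ennreal_of_nat_eq_real_of_nat of_nat_0_le_iff)
    also have "\<dots> \<longleftrightarrow> k < nat \<lceil>x\<rceil>"
      by linarith
    finally show ?thesis .
  qed
  have "(\<Sum>k. if of_nat k < y then 1 else 0 :: ennreal) = (\<Sum>k\<in>{..<nat \<lceil>x\<rceil>}. 1)"
    unfolding eq by (subst suminf_finite[of "{..<nat \<lceil>x\<rceil>}"]) auto
  also have "\<dots> = ennreal (real (nat \<lceil>x\<rceil>))"
    by (simp add: ennreal_of_nat_eq_real_of_nat)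
  also have "\<dots> \<le> ennreal (x + 1)"
    by (intro ennreal_leI) (use x in linarith)
  also have "\<dots> = y + 1"
    using x by (simp add: ennreal_plus)
  finally show ?thesis .
qed auto

text \<open>The function \<open>f\<close> may be wild and even infinite on a null set, but enclosing the level sets
  \<open>{f > k}\<close> in open sets of almost the same measure replaces it by a lower semicontinuous
  integrable majorant (Vitali--Caratheodory), whose primitive grows at rate at least \<open>f t + 1\<close>
  on a neighbourhood of \<open>t\<close>.\<close>

lemma integrable_rate_primitive:
  fixes f :: "real \<Rightarrow> ennreal"
  assumes f [measurable]: "f \<in> borel_measurable borel"
    and fin: "(\<integral>\<^sup>+t\<in>{0..\<epsilon>}. f t \<partial>lborel) < \<infinity>"
  obtains R :: "real \<Rightarrow> real" where "continuous_on UNIV R" "mono R"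
    "\<And>t a. \<lbrakk>t \<in> {0..\<epsilon>}; 0 \<le> a; ennreal a \<le> f t\<rbrakk>
       \<Longrightarrow> \<exists>d>0. \<forall>s. \<bar>s - t\<bar> < d \<longrightarrow> (a + 1) * \<bar>s - t\<bar> \<le> \<bar>R s - R t\<bar>"
proof -
  define B where "B k = {t\<in>{0..\<epsilon>}. of_nat k < f t}" for k :: nat
  have Bm [measurable]: "B k \<in> sets borel" for k
    unfolding B_def by measurable
  have "(\<Sum>k. emeasure lborel (B k)) = (\<integral>\<^sup>+t. (\<Sum>k. indicator (B k) t) \<partial>lborel)"
    by (subst nn_integral_suminf) auto
  also have "\<dots> \<le> (\<integral>\<^sup>+t. f t * indicator {0..\<epsilon>} t + indicator {0..\<epsilon>} t \<partial>lborel)"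
  proof (rule nn_integral_mono)
    fix t :: real
    show "(\<Sum>k. indicator (B k) t) \<le> f t * indicator {0..\<epsilon>} t + indicator {0..\<epsilon>} t"
    proof (cases "t \<in> {0..\<epsilon>}")
      case True
      then have "(\<Sum>k. indicator (B k) t :: ennreal) = (\<Sum>k. if of_nat k < f t then 1 else 0)"
        by (intro suminf_cong) (auto simp: B_def indicator_def)
      then show ?thesis
        using suminf_indicator_le[of "f t"] True by simp
    next
      case False
      then have "indicator (B k) t = (0 :: ennreal)" for k
        by (auto simp: B_def)
      then show ?thesis by simp
    qed
  qed
  also have "\<dots> = (\<integral>\<^sup>+t\<in>{0..\<epsilon>}. f t \<partial>lborel) + emeasure lborel {0..\<epsilon>}"
    by (subst nn_integral_add) auto
  also have "\<dots> < \<infinity>"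
    using fin by (auto simp: emeasure_lborel_Icc_eq)
  finally have Bfin: "(\<Sum>k. emeasure lborel (B k)) < \<infinity>" .
  \<comment> \<open>The excess (1/2)^k is summable, so the enlarged level sets still have finite
    total measure.\<close>
  have "\<exists>U. open U \<and> B k \<subseteq> U \<and> emeasure lborel U \<le> emeasure lborel (B k) + ennreal ((1/2)^k)" for k
  proof -
    obtain U where U: "open U" "B k \<subseteq> U" "emeasure lborel (U - B k) < ennreal ((1/2)^k)"
      using outer_regular_lborel[of "B k" "(1/2)^k"] by (auto simp: zero_less_power)
    have "emeasure lborel U = emeasure lborel (B k \<union> (U - B k))"
      using U by (simp add: Un_absorb1)
    also have "\<dots> \<le> emeasure lborel (B k) + emeasure lborel (U - B k)"
      using U by (intro emeasure_subadditive) auto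
    finally show ?thesis
      using U by (meson add_left_mono dual_order.trans less_imp_le)
  qed
  then obtain U where U: "\<And>k. open (U k)" "\<And>k. B k \<subseteq> U k"
      "\<And>k. emeasure lborel (U k) \<le> emeasure lborel (B k) + ennreal ((1/2)^k)"
    by metis
  have Um [measurable]: "U k \<in> sets borel" for k
    using U by auto
  have "(\<Sum>k. emeasure lborel (U k)) \<le> (\<Sum>k. emeasure lborel (B k) + ennreal ((1/2)^k))"
    using U by (intro suminf_le) auto
  also have "\<dots> = (\<Sum>k. emeasure lborel (B k)) + (\<Sum>k. ennreal ((1/2)^k))"
    by (rule suminf_add[symmetric]) auto
  also have "(\<Sum>k. ennreal ((1/2)^k)) = ennreal (\<Sum>k. (1/2)^k)"
    by (rule suminf_ennreal2) (auto intro: summable_geometric)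
  finally have Ufin: "(\<Sum>k. emeasure lborel (U k)) < \<infinity>"
    using Bfin by (auto simp: le_less_trans)
  have Uk: "emeasure lborel (U k) < \<infinity>" for k
    using Ufin ennreal_suminf_lessD by (metis infinity_ennreal_def)
  define m where "m k = measure lborel (U k)" for k
  have em: "emeasure lborel (U k) = ennreal (m k)" for k
    unfolding m_def using Uk[of k] by (intro emeasure_eq_ennreal_measure) auto
  have r00: "0 \<le> m k" for k by (simp add: m_def)
  have summ: "summable m"
    by (rule summable_suminf_not_top) (use Ufin em r00 in \<open>auto simp: less_top[symmetric]\<close>)
  \<comment> \<open>A primitive of the indicator function of \<open>U k\<close>: it is 1-Lipschitz
    and has slope exactly 1 inside the open set \<open>U k\<close>.\<close>
  define r where "r k t = measure lborel (U k \<inter> {..t})" for k t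
  have fm: "U k \<inter> A \<in> fmeasurable lborel" if "A \<in> sets borel" for k A
  proof (rule fmeasurableI2[of "U k"])
    show "U k \<in> fmeasurable lborel"
      using Uk[of k] by (intro fmeasurableI) simp_all
    show "U k \<inter> A \<in> sets lborel"
      using that by simp
  qed simp
  have r_diff: "r k t - r k s = measure lborel (U k \<inter> {s<..t})" if "s \<le> t" for k s t
  proof -
    have "U k \<inter> {..t} = (U k \<inter> {..s}) \<union> (U k \<inter> {s<..t})" using that by auto
    moreover have "measure lborel ((U k \<inter> {..s}) \<union> (U k \<inter> {s<..t}))
        = measure lborel (U k \<inter> {..s}) + measure lborel (U k \<inter> {s<..t})"
      by (rule measure_Union) (use fm[of "{..s}" k] fm[of "{s<..t}" k] in \<open>auto simp: fmeasurable_def\<close>)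
    ultimately have "r k t = r k s + measure lborel (U k \<inter> {s<..t})"
      unfolding r_def by simp
    then show ?thesis by simp
  qed
  have r_mono: "r k s \<le> r k t" if "s \<le> t" for k s t
    using r_diff[OF that, of k] measure_nonneg[of lborel "U k \<inter> {s<..t}"] by linarith
  have r_lip: "\<bar>r k t - r k s\<bar> \<le> \<bar>t - s\<bar>" for k s t
  proof -
    have *: "r k t - r k s \<le> t - s" if "s \<le> t" for s t
    proof -
      have "measure lborel (U k \<inter> {s<..t}) \<le> measure lborel {s<..t}"
        by (rule measure_mono_fmeasurable) (use \<open>s \<le> t\<close> in \<open>auto simp: fmeasurable_def\<close>)
      then show ?thesis using r_diff[OF that, of k] that by simp
    qed
    show ?thesis
      using *[of s t] *[of t s] r_mono[of s t k] r_mono[of t s k] by linarith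
  qed
  have r0: "0 \<le> r k t" "r k t \<le> m k" for k t
    unfolding r_def m_def using Uk[of k]
    by (auto intro!: measure_mono_fmeasurable simp: fmeasurable_def)
  \<comment> \<open>The summand t supplies the + 1 in the slope \<open>a + 1\<close>. The series
    converges uniformly because \<open>r k\<close> is bounded by the summable
    \<open>m k\<close>.\<close>
  define R where "R t = t + (\<Sum>k. r k t)" for t
  have sr: "summable (\<lambda>k. r k t)" for t
    by (rule summable_comparison_test'[OF summ, of 0]) (simp add: r0)
  have cr: "continuous_on UNIV (r k)" for k
    by (rule lipschitz_on_continuous_on[of 1], rule lipschitz_onI) (simp_all add: dist_real_def r_lip)
  have "uniform_limit UNIV (\<lambda>n t. \<Sum>k<n. r k t) (\<lambda>t. \<Sum>k. r k t) sequentially"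
    by (rule Weierstrass_m_test[OF _ summ]) (simp add: r0)
  then have "continuous_on UNIV (\<lambda>t. \<Sum>k. r k t)"
    by (rule uniform_limit_theorem[rotated]) (simp_all add: always_eventually continuous_on_sum cr)
  then have contR: "continuous_on UNIV R"
    unfolding R_def by (intro continuous_intros)
  have RR: "R t - R s = (t - s) + (\<Sum>k. r k t - r k s)" for s t
    unfolding R_def by (simp add: suminf_diff sr)
  have monoR: "mono R"
  proof (rule monoI)
    fix s t :: real assume "s \<le> t"
    then have "0 \<le> (\<Sum>k. r k t - r k s)"
      by (intro suminf_nonneg summable_diff sr) (use r_mono in auto)
    then show "R s \<le> R t" using RR[of t s] \<open>s \<le> t\<close> by linarith
  qed
  have key: "\<exists>d>0. \<forall>s. \<bar>s - t\<bar> < d \<longrightarrow> (a + 1) * \<bar>s - t\<bar> \<le> \<bar>R s - R t\<bar>"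
    if t: "t \<in> {0..\<epsilon>}" and a: "0 \<le> a" "ennreal a \<le> f t" for t a
  proof -
    \<comment> \<open>Each k < N satisfies k < a <= f t, so t lies in \<open>U k\<close>; near t
      these N >= a summands all have slope 1.\<close>
    define N where "N = nat \<lceil>a\<rceil>"
    have "t \<in> U k" if "k < N" for k
    proof -
      have "real k < a" using that unfolding N_def by linarith
      then have "of_nat k < ennreal a"
        by (simp add: ennreal_of_nat_eq_real_of_nat ennreal_less_iff)
      then show ?thesis using U(2)[of k] t a by (auto simp: B_def)
    qed
    then have "t \<in> (\<Inter>k<N. U k)" by auto
    moreover have "open (\<Inter>k<N. U k)" using U by (intro open_INT) auto
    ultimately obtain d where d: "d > 0" "ball t d \<subseteq> (\<Inter>k<N. U k)"
      using openE by blast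
    have *: "(a + 1) * (v - u) \<le> R v - R u" if "u \<le> v" "\<bar>u - t\<bar> < d" "\<bar>v - t\<bar> < d" for u v
    proof -
      have "r k v - r k u = v - u" if "k < N" for k
      proof -
        have "{u<..v} \<subseteq> U k"
          using d(2) that \<open>\<bar>u - t\<bar> < d\<close> \<open>\<bar>v - t\<bar> < d\<close>
          by (force simp: dist_real_def subset_iff)
        then have "U k \<inter> {u<..v} = {u<..v}" by auto
        then show ?thesis using r_diff[OF \<open>u \<le> v\<close>, of k] \<open>u \<le> v\<close> by simp
      qed
      then have "(\<Sum>k<N. r k v - r k u) = real N * (v - u)" by simp
      moreover have "(\<Sum>k<N. r k v - r k u) \<le> (\<Sum>k. r k v - r k u)"
        by (intro sum_le_suminf summable_diff sr) (use r_mono \<open>u \<le> v\<close> in auto)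
      moreover have "a * (v - u) \<le> real N * (v - u)"
        using \<open>u \<le> v\<close> unfolding N_def by (intro mult_right_mono) linarith+
      ultimately show ?thesis using RR[of v u] by (simp add: algebra_simps)
    qed
    have "(a + 1) * \<bar>s - t\<bar> \<le> \<bar>R s - R t\<bar>" if "\<bar>s - t\<bar> < d" for s
      using *[of s t] *[of t s] that d(1) by (cases "s \<le> t") (auto simp: abs_if algebra_simps)
    then show ?thesis using d(1) by blast
  qed
  show ?thesis using that[OF contR monoR] key by blast
qed

text \<open>The Brezis--Browder ordering principle: choose successors that realize at least half of the
  progress still possible; an upper bound of this chain is maximal.\<close>

lemma preorder_maximal_progress:
  fixes le :: "'a \<Rightarrow> 'a \<Rightarrow> bool" and f :: "'a \<Rightarrow> real"
  assumes refl: "\<And>x. le x x"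
    and trans: "\<And>x y z. le x y \<Longrightarrow> le y z \<Longrightarrow> le x z"
    and mono: "\<And>x y. le x y \<Longrightarrow> f x \<le> f y"
    and bdd: "\<And>y. le x0 y \<Longrightarrow> f y \<le> T"
    and chain: "\<And>s :: nat \<Rightarrow> 'a. s 0 = x0 \<Longrightarrow> (\<And>n. le (s n) (s (Suc n))) \<Longrightarrow> \<exists>u. \<forall>n. le (s n) u"
  obtains m where "le x0 m" "\<And>y. le m y \<Longrightarrow> f y = f m"
proof -
  define \<beta> where "\<beta> x = Sup (f ` {y. le x y})" for x
  have bdd': "bdd_above (f ` {y. le x y})" if "le x0 x" for x
    using bdd trans[OF that] by (auto intro!: bdd_aboveI[of _ T])
  have "\<exists>y. le x y \<and> (le x0 x \<longrightarrow> \<beta> x \<le> 2 * f y - f x)" for x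
  proof (cases "le x0 x \<and> f x < \<beta> x")
    case True
    then have "(f x + \<beta> x) / 2 < Sup (f ` {y. le x y})"
      unfolding \<beta>_def by auto
    then obtain y where "le x y" "(f x + \<beta> x) / 2 < f y"
      using less_cSup_iff[OF _ bdd'[of x]] True refl[of x] by blast
    then show ?thesis by (intro exI[of _ y]) auto
  qed (use refl in force)
  then obtain g where g: "\<And>x. le x (g x)" "\<And>x. le x0 x \<Longrightarrow> \<beta> x \<le> 2 * f (g x) - f x"
    by metis
  define s where "s n = (g ^^ n) x0" for n
  have s: "s 0 = x0" "\<And>n. s (Suc n) = g (s n)" by (auto simp: s_def)
  then obtain m where m: "\<And>n. le (s n) m" using chain[of s] g(1) by metis
  have x0s: "le x0 (s n)" for n
    by (induction n) (use s refl g(1) trans in metis)+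
  have x0m: "le x0 m" using m[of 0] s by simp
  have "f y = f m" if "le m y" for y
  proof -
    \<comment> \<open>Along the chain both \<open>f (s n)\<close> and \<open>f (s (Suc n))\<close>
      tend to l, so this bound tends to 2 * l - l and forces f y <= l <= f m.\<close>
    have up: "f y \<le> 2 * f (s (Suc n)) - f (s n)" for n
    proof -
      have "f y \<le> \<beta> (s n)"
        unfolding \<beta>_def by (intro cSup_upper bdd' x0s) (use trans[OF m that] in auto)
      then show ?thesis using g(2)[OF x0s[of n]] s by simp
    qed
    have inc: "incseq (\<lambda>n. f (s n))"
      using s g(1) mono by (intro incseq_SucI) simp
    obtain l where l: "(\<lambda>n. f (s n)) \<longlonglongrightarrow> l"
      using incseq_convergent[OF inc, of "f m"] mono[OF m] by blast
    have "(\<lambda>n. 2 * f (s (Suc n)) - f (s n)) \<longlonglongrightarrow> 2 * l - l"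
      by (intro tendsto_intros LIMSEQ_Suc l)
    then have "f y \<le> l" using up by (intro LIMSEQ_le_const[of _ "2 * l - l", simplified]) auto
    moreover have "l \<le> f m" using l mono[OF m] by (intro LIMSEQ_le_const2[OF l]) auto
    ultimately show ?thesis using mono[OF that] by linarith
  qed
  then show ?thesis using that x0m by blast
qed

section \<open>Strict differentiability and flattening charts\<close>

text \<open>Strict differentiability at a single point: both arguments of the increment vary. It
  gives Lipschitz and linearization estimates on a neighbourhood from the derivative at one point,
  so the closest point map has to be differentiated only at the centre of a chart.\<close>

definition strict_derivative :: "('a::real_normed_vector \<Rightarrow> 'b::real_normed_vector) \<Rightarrow> ('a \<Rightarrow> 'b) \<Rightarrow> 'a \<Rightarrow> bool" where
  "strict_derivative f f' x \<longleftrightarrow> bounded_linear f' \<and>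
     (\<forall>\<kappa>>0. \<exists>d>0. \<forall>y\<in>ball x d. \<forall>z\<in>ball x d. norm (f y - f z - f' (y - z)) \<le> \<kappa> * norm (y - z))"

lemma strict_derivativeD:
  assumes "strict_derivative f f' x" "\<kappa> > 0"
  obtains d where "d > 0"
    "\<And>y z. y \<in> ball x d \<Longrightarrow> z \<in> ball x d \<Longrightarrow> norm (f y - f z - f' (y - z)) \<le> \<kappa> * norm (y - z)"
  using assms unfolding strict_derivative_def by meson

lemma strict_derivative_linear: "strict_derivative f f' x \<Longrightarrow> bounded_linear f'"
  by (simp add: strict_derivative_def)

lemma strict_derivative_lipschitz:
  assumes "strict_derivative f f' x"
  obtains C d where "C > 0" "d > 0"
    "\<And>y z. y \<in> ball x d \<Longrightarrow> z \<in> ball x d \<Longrightarrow> norm (f y - f z) \<le> C * norm (y - z)"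
proof -
  obtain d where d: "d > 0" "\<And>y z. y \<in> ball x d \<Longrightarrow> z \<in> ball x d \<Longrightarrow>
      norm (f y - f z - f' (y - z)) \<le> 1 * norm (y - z)"
    by (rule strict_derivativeD[OF assms zero_less_one]) blast
  obtain K where K: "K > 0" "\<And>v. norm (f' v) \<le> norm v * K"
    using bounded_linear.pos_bounded[OF strict_derivative_linear[OF assms]] by blast
  show ?thesis
  proof (rule that[of "K + 1" d])
    fix y z assume yz: "y \<in> ball x d" "z \<in> ball x d"
    have "norm (f y - f z) \<le> norm (f y - f z - f' (y - z)) + norm (f' (y - z))"
      by (rule norm_triangle_sub[of "f y - f z" "f' (y - z)", THEN order_trans]) simp
    then show "norm (f y - f z) \<le> (K + 1) * norm (y - z)"
      using d(2)[OF yz] K(2)[of "y - z"] by (simp add: algebra_simps)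
  qed (use K d in auto)
qed

lemma strict_derivative_continuous:
  assumes "strict_derivative f f' x"
  obtains d where "d > 0" "continuous_on (ball x d) f"
proof -
  obtain C d where C: "C > 0" "d > 0"
    "\<And>y z. y \<in> ball x d \<Longrightarrow> z \<in> ball x d \<Longrightarrow> norm (f y - f z) \<le> C * norm (y - z)"
    using strict_derivative_lipschitz[OF assms] by blast
  have "C-lipschitz_on (ball x d) f"
    by (rule lipschitz_onI) (use C in \<open>auto simp: dist_norm\<close>)
  then show ?thesis using that[OF C(2)] lipschitz_on_continuous_on by blast
qed

lemma strict_derivative_isCont:
  assumes "strict_derivative f f' x"
  shows "isCont f x"
  using strict_derivative_continuous[OF assms]
  by (metis centre_in_ball continuous_on_eq_continuous_at open_ball)

lemma continuous_on_approx_linear: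
  assumes "\<And>u v. u \<in> A \<Longrightarrow> v \<in> A \<Longrightarrow> norm (f u - f v - f' (u - v)) \<le> c * norm (u - v)"
    and "\<And>v. norm (f' v) \<le> K * norm v" and "0 \<le> c + K"
  shows "continuous_on A f"
proof (rule lipschitz_on_continuous_on, rule lipschitz_onI)
  show "dist (f u) (f v) \<le> (c + K) * dist u v" if "u \<in> A" "v \<in> A" for u v
    using norm_triangle_ineq[of "f u - f v - f' (u - v)" "f' (u - v)"] assms(1)[OF that] assms(2)[of "u - v"]
    by (simp add: dist_norm distrib_right)
qed (rule assms(3))

lemma strict_derivative_compose:
  assumes f: "strict_derivative f f' x" and g: "strict_derivative g g' (f x)"
  shows "strict_derivative (\<lambda>y. g (f y)) (\<lambda>v. g' (f' v)) x"
  unfolding strict_derivative_def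
proof (intro conjI allI impI)
  show "bounded_linear (\<lambda>v. g' (f' v))"
    by (rule bounded_linear_compose[OF strict_derivative_linear[OF g] strict_derivative_linear[OF f]])
  fix \<kappa> :: real assume \<kappa>: "\<kappa> > 0"
  obtain K where K: "K > 0" "\<And>v. norm (g' v) \<le> norm v * K"
    using bounded_linear.pos_bounded[OF strict_derivative_linear[OF g]] by blast
  obtain C d0 where C: "C > 0" "d0 > 0"
    "\<And>y z. y \<in> ball x d0 \<Longrightarrow> z \<in> ball x d0 \<Longrightarrow> norm (f y - f z) \<le> C * norm (y - z)"
    using strict_derivative_lipschitz[OF f] by blast
  obtain d1 where d1: "d1 > 0" "\<And>y z. y \<in> ball (f x) d1 \<Longrightarrow> z \<in> ball (f x) d1 \<Longrightarrow>
      norm (g y - g z - g' (y - z)) \<le> \<kappa> / (2 * C) * norm (y - z)"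
    by (rule strict_derivativeD[OF g, of "\<kappa> / (2 * C)"]) (use \<kappa> C(1) in auto)
  obtain d2 where d2: "d2 > 0" "\<And>y z. y \<in> ball x d2 \<Longrightarrow> z \<in> ball x d2 \<Longrightarrow>
      norm (f y - f z - f' (y - z)) \<le> \<kappa> / (2 * K) * norm (y - z)"
    by (rule strict_derivativeD[OF f, of "\<kappa> / (2 * K)"]) (use \<kappa> K(1) in auto)
  define d where "d = min d2 (min d0 (d1 / C))"
  have dpos: "d > 0" using d1 d2 C by (simp add: d_def)
  have fin: "f y \<in> ball (f x) d1" if "y \<in> ball x d" for y
  proof -
    have "norm (f x - f y) \<le> C * norm (x - y)"
      by (rule C(3)) (use that C(2) in \<open>auto simp: d_def\<close>)
    also have "\<dots> < C * (d1 / C)"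
      using that C(1) by (intro mult_strict_left_mono) (auto simp: d_def dist_norm)
    finally show ?thesis using C(1) by (simp add: dist_norm)
  qed
  have "norm (g (f y) - g (f z) - g' (f' (y - z))) \<le> \<kappa> * norm (y - z)"
    if y: "y \<in> ball x d" and z: "z \<in> ball x d" for y z
  proof -
    have lin: "g' (f y - f z) - g' (f' (y - z)) = g' (f y - f z - f' (y - z))"
      using linear_diff[OF bounded_linear.linear[OF strict_derivative_linear[OF g]]] by metis
    have "norm (g (f y) - g (f z) - g' (f' (y - z)))
       \<le> norm (g (f y) - g (f z) - g' (f y - f z)) + norm (g' (f y - f z - f' (y - z)))"
      unfolding lin[symmetric]
      using norm_triangle_ineq[of "g (f y) - g (f z) - g' (f y - f z)" "g' (f y - f z) - g' (f' (y - z))"]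
      by simp
    also have "norm (g (f y) - g (f z) - g' (f y - f z)) \<le> \<kappa> / (2 * C) * norm (f y - f z)"
      by (rule d1(2)) (use fin y z in auto)
    also have "\<dots> \<le> \<kappa> / (2 * C) * (C * norm (y - z))"
      by (intro mult_left_mono C(3)) (use y z \<kappa> C in \<open>auto simp: d_def\<close>)
    also have "norm (g' (f y - f z - f' (y - z))) \<le> norm (f y - f z - f' (y - z)) * K"
      by (rule K)
    also have "\<dots> \<le> (\<kappa> / (2 * K) * norm (y - z)) * K"
      by (intro mult_right_mono d2(2)) (use y z K in \<open>auto simp: d_def\<close>)
    finally show ?thesis using K C by (simp add: field_simps)
  qed
  then show "\<exists>d>0. \<forall>y\<in>ball x d. \<forall>z\<in>ball x d.
      norm (g (f y) - g (f z) - g' (f' (y - z))) \<le> \<kappa> * norm (y - z)"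
    using dpos by blast
qed

lemma strict_derivative_diff:
  assumes f: "strict_derivative f f' x" and g: "strict_derivative g g' x"
  shows "strict_derivative (\<lambda>y. f y - g y) (\<lambda>v. f' v - g' v) x"
  unfolding strict_derivative_def
proof (intro conjI allI impI)
  show "bounded_linear (\<lambda>v. f' v - g' v)"
    by (rule bounded_linear_sub[OF strict_derivative_linear[OF f] strict_derivative_linear[OF g]])
  fix \<kappa> :: real assume \<kappa>: "\<kappa> > 0"
  obtain d1 where d1: "d1 > 0" "\<And>y z. y \<in> ball x d1 \<Longrightarrow> z \<in> ball x d1 \<Longrightarrow>
      norm (f y - f z - f' (y - z)) \<le> \<kappa> / 2 * norm (y - z)"
    by (rule strict_derivativeD[OF f, of "\<kappa> / 2"]) (use \<kappa> in auto)
  obtain d2 where d2: "d2 > 0" "\<And>y z. y \<in> ball x d2 \<Longrightarrow> z \<in> ball x d2 \<Longrightarrow>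
      norm (g y - g z - g' (y - z)) \<le> \<kappa> / 2 * norm (y - z)"
    by (rule strict_derivativeD[OF g, of "\<kappa> / 2"]) (use \<kappa> in auto)
  have "norm (f y - g y - (f z - g z) - (f' (y - z) - g' (y - z))) \<le> \<kappa> * norm (y - z)"
    if y: "y \<in> ball x (min d1 d2)" and z: "z \<in> ball x (min d1 d2)" for y z
  proof -
    have eq: "f y - g y - (f z - g z) - (f' (y - z) - g' (y - z))
        = (f y - f z - f' (y - z)) - (g y - g z - g' (y - z))" by simp
    show ?thesis
      unfolding eq using d1(2)[of y z] d2(2)[of y z] y z
        norm_triangle_ineq4[of "f y - f z - f' (y - z)" "g y - g z - g' (y - z)"]
      by (simp add: field_simps)
  qed
  then show "\<exists>d>0. \<forall>y\<in>ball x d. \<forall>z\<in>ball x d.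
      norm (f y - g y - (f z - g z) - (f' (y - z) - g' (y - z))) \<le> \<kappa> * norm (y - z)"
    using d1(1) d2(1) by (intro exI[of _ "min d1 d2"]) auto
qed

text \<open>The mean value inequality on a ball on which \<open>f'\<close> stays within \<kappa> of
  \<open>f' x\<close>.\<close>

lemma strict_derivative_C1:
  fixes f' :: "'a::real_normed_vector \<Rightarrow> 'a \<Rightarrow>\<^sub>L 'b::real_normed_vector"
  assumes "open U" "x \<in> U" "\<And>y. y \<in> U \<Longrightarrow> (f has_derivative f' y) (at y)"
    and "continuous_on U f'"
  shows "strict_derivative f (f' x) x"
  unfolding strict_derivative_def
proof (intro conjI allI impI)
  show "bounded_linear (f' x)" by (rule blinfun.bounded_linear_right)
  fix \<kappa> :: real assume \<kappa>: "\<kappa> > 0"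
  have "isCont f' x" using assms continuous_on_eq_continuous_at by blast
  then obtain d1 where d1: "d1 > 0" "\<And>y. dist y x < d1 \<Longrightarrow> dist (f' y) (f' x) < \<kappa>"
    using \<kappa> unfolding continuous_at_eps_delta by metis
  obtain d2 where d2: "d2 > 0" "ball x d2 \<subseteq> U" using assms openE by blast
  define d where "d = min d1 d2"
  have "norm (f y - f z - f' x (y - z)) \<le> \<kappa> * norm (y - z)" if "y \<in> ball x d" "z \<in> ball x d" for y z
  proof -
    have "norm (f y - f z - f' x (y - z)) \<le> norm (y - z) * \<kappa>"
    proof (rule differentiable_bound_linearization[where S = "ball x d" and f' = f'])
      show "z + t *\<^sub>R (y - z) \<in> ball x d" if "t \<in> {0..1}" for t :: real
      proof -
        have "z + t *\<^sub>R (y - z) = (1 - t) *\<^sub>R z + t *\<^sub>R y" by (simp add: algebra_simps)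
        then show ?thesis
          using convexD_alt[OF convex_ball, of z x d y t] \<open>y \<in> _\<close> \<open>z \<in> _\<close> that by auto
      qed
      show "(f has_derivative f' u) (at u within ball x d)" if "u \<in> ball x d" for u
      proof (rule has_derivative_at_withinI, rule assms(3))
        show "u \<in> U" using d2(2) that by (auto simp: d_def)
      qed
      show "onorm (blinfun_apply (f' u) - blinfun_apply (f' x)) \<le> \<kappa>" if "u \<in> ball x d" for u
      proof -
        have "blinfun_apply (f' u) - blinfun_apply (f' x) = blinfun_apply (f' u - f' x)"
          by (auto simp: fun_eq_iff blinfun.bilinear_simps)
        then show ?thesis
          using d1(2)[of u] that by (simp add: d_def dist_commute dist_norm flip: norm_blinfun.rep_eq)
      qed
      show "x \<in> ball x d" using d1 d2 by (simp add: d_def)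
    qed
    then show ?thesis by (simp add: mult.commute)
  qed
  moreover have "d > 0" using d1 d2 by (simp add: d_def)
  ultimately show "\<exists>d>0. \<forall>y\<in>ball x d. \<forall>z\<in>ball x d. norm (f y - f z - f' x (y - z)) \<le> \<kappa> * norm (y - z)"
    by blast
qed

lemma continuous_derivative_locally_lipschitz:
  fixes f' :: "'a::real_normed_vector \<Rightarrow> 'a \<Rightarrow>\<^sub>L 'b::real_normed_vector"
  assumes "open U" "x \<in> U" "\<And>y. y \<in> U \<Longrightarrow> (f has_derivative f' y) (at y)"
    and "continuous_on U f'"
  obtains C d where "C > 0" "d > 0"
    "\<And>y z. y \<in> ball x d \<Longrightarrow> z \<in> ball x d \<Longrightarrow> norm (f y - f z) \<le> C * norm (y - z)"
  using strict_derivative_lipschitz[OF strict_derivative_C1[OF assms]] by blast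

text \<open>What is kept of the second derivatives of a C2 chart is the local Lipschitz bound on
  \<open>g'\<close>; it serves to differentiate the closest point map.\<close>

locale diffeo =
  fixes U V :: "'a::euclidean_space set" and h g :: "'a \<Rightarrow> 'a" and h' g' :: "'a \<Rightarrow> 'a \<Rightarrow>\<^sub>L 'a"
  assumes open_U: "open U" and open_V: "open V" and homeo: "homeomorphism U V h g"
    and deriv_h: "\<And>y. y \<in> U \<Longrightarrow> (h has_derivative h' y) (at y)"
    and deriv_g: "\<And>z. z \<in> V \<Longrightarrow> (g has_derivative g' z) (at z)"
    and cont_h': "continuous_on U h'" and cont_g': "continuous_on V g'"
    and lipschitz_g': "\<And>z. z \<in> V \<Longrightarrow> \<exists>C>0. \<exists>d>0. \<forall>u\<in>ball z d. \<forall>v\<in>ball z d.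
      norm (g' u - g' v) \<le> C * norm (u - v)"
begin

lemma gh: "y \<in> U \<Longrightarrow> g (h y) = y" and hg: "z \<in> V \<Longrightarrow> h (g z) = z"
  and h_mem: "y \<in> U \<Longrightarrow> h y \<in> V" and g_mem: "z \<in> V \<Longrightarrow> g z \<in> U"
  and cont_h: "continuous_on U h" and cont_g: "continuous_on V g"
  using homeo by (auto simp: homeomorphism_def)

lemma isCont_h: "y \<in> U \<Longrightarrow> isCont h y" and isCont_h': "y \<in> U \<Longrightarrow> isCont h' y"
  and isCont_g: "z \<in> V \<Longrightarrow> isCont g z" and isCont_g': "z \<in> V \<Longrightarrow> isCont g' z"
  using cont_h cont_h' cont_g cont_g' continuous_on_eq_continuous_at open_U open_V by blast+

lemma g'_h': "y \<in> U \<Longrightarrow> g' (h y) (h' y v) = v"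
proof -
  assume y: "y \<in> U"
  have "((\<lambda>y. g (h y)) has_derivative (\<lambda>v. g' (h y) (h' y v))) (at y)"
    using has_derivative_compose[OF deriv_h[OF y] deriv_g[OF h_mem[OF y]]] .
  then have "((\<lambda>y. y) has_derivative (\<lambda>v. g' (h y) (h' y v))) (at y)"
    by (rule has_derivative_transform_within_open[OF _ open_U y]) (simp add: gh)
  then have "(\<lambda>v. g' (h y) (h' y v)) = (\<lambda>v. v)"
    using has_derivative_ident has_derivative_unique by blast
  then show ?thesis by metis
qed

lemma h'_g': "y \<in> U \<Longrightarrow> h' y (g' (h y) v) = v"
proof -
  assume y: "y \<in> U"
  have "((\<lambda>z. h (g z)) has_derivative (\<lambda>v. h' y (g' (h y) v))) (at (h y))"
    using has_derivative_compose[OF deriv_g[OF h_mem[OF y]], of h "h' y"] deriv_h[OF y] gh[OF y] by simp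
  then have "((\<lambda>y. y) has_derivative (\<lambda>v. h' y (g' (h y) v))) (at (h y))"
    by (rule has_derivative_transform_within_open[OF _ open_V h_mem[OF y]]) (simp add: hg)
  then have "(\<lambda>v. h' y (g' (h y) v)) = (\<lambda>v. v)"
    using has_derivative_ident has_derivative_unique by blast
  then show ?thesis by metis
qed

lemma strict_h: "y \<in> U \<Longrightarrow> strict_derivative h (h' y) y"
  by (rule strict_derivative_C1[OF open_U _ deriv_h cont_h'])

lemma strict_g: "z \<in> V \<Longrightarrow> strict_derivative g (g' z) z"
  by (rule strict_derivative_C1[OF open_V _ deriv_g cont_g'])

lemma tangent_space_image:
  assumes y: "y \<in> U"
  shows "tangent_space (h ` (U \<inter> Y)) (h y) = h' y ` tangent_space Y y"
proof (intro set_eqI iffI)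
  fix v assume "v \<in> tangent_space (h ` (U \<inter> Y)) (h y)"
  then obtain \<gamma> where \<gamma>: "\<gamma> 0 = h y" "\<forall>\<^sub>F s in at 0. \<gamma> s \<in> h ` (U \<inter> Y)"
      "(\<gamma> has_vector_derivative v) (at 0)"
    by (auto simp: tangent_space_def)
  have "((\<lambda>s. g (\<gamma> s)) has_derivative (\<lambda>s. g' (h y) (s *\<^sub>R v))) (at 0)"
    using has_derivative_compose[OF \<gamma>(3)[unfolded has_vector_derivative_def], of g "g' (h y)"]
      deriv_g[OF h_mem[OF y]] \<gamma>(1) by simp
  then have "((\<lambda>s. g (\<gamma> s)) has_vector_derivative g' (h y) v) (at 0)"
    by (simp add: has_vector_derivative_def blinfun.scaleR_right)
  moreover have "\<forall>\<^sub>F s in at 0. g (\<gamma> s) \<in> Y"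
    using \<gamma>(2) by (rule eventually_mono) (auto simp: gh)
  ultimately have "g' (h y) v \<in> tangent_space Y y"
    unfolding tangent_space_def using \<gamma>(1) gh[OF y] by (intro CollectI exI[of _ "\<lambda>s. g (\<gamma> s)"]) auto
  then show "v \<in> h' y ` tangent_space Y y"
    using h'_g'[OF y, of v] by (metis image_eqI)
next
  fix v assume "v \<in> h' y ` tangent_space Y y"
  then obtain w \<gamma> where \<gamma>: "v = h' y w" "\<gamma> 0 = y" "\<forall>\<^sub>F s in at 0. \<gamma> s \<in> Y"
      "(\<gamma> has_vector_derivative w) (at 0)"
    by (auto simp: tangent_space_def)
  have "((\<lambda>s. h (\<gamma> s)) has_derivative (\<lambda>s. h' y (s *\<^sub>R w))) (at 0)"
    using has_derivative_compose[OF \<gamma>(4)[unfolded has_vector_derivative_def], of h "h' y"]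
      deriv_h[OF y] \<gamma>(2) by simp
  then have "((\<lambda>s. h (\<gamma> s)) has_vector_derivative v) (at 0)"
    by (simp add: has_vector_derivative_def blinfun.scaleR_right \<gamma>(1))
  moreover have "\<forall>\<^sub>F s in at 0. \<gamma> s \<in> U"
  proof -
    have "isCont \<gamma> 0" using \<gamma>(4) by (rule has_vector_derivative_continuous)
    then show ?thesis using topological_tendstoD[OF _ open_U] y \<gamma>(2) by (auto simp: isCont_def)
  qed
  then have "\<forall>\<^sub>F s in at 0. h (\<gamma> s) \<in> h ` (U \<inter> Y)"
    using \<gamma>(3) by eventually_elim auto
  ultimately show "v \<in> tangent_space (h ` (U \<inter> Y)) (h y)"
    unfolding tangent_space_def using \<gamma>(2) by (intro CollectI exI[of _ "\<lambda>s. h (\<gamma> s)"]) auto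
qed

end

locale flat_chart = diffeo U V h g h' g'
  for U V :: "'a::euclidean_space set" and h g h' g' +
  fixes M L :: "'a set"
  assumes subspace_L: "subspace L" and flat: "h ` (U \<inter> M) = V \<inter> L"
begin

lemma flat_iff: "y \<in> U \<Longrightarrow> y \<in> M \<longleftrightarrow> h y \<in> L"
proof
  assume y: "y \<in> U"
  show "h y \<in> L" if "y \<in> M" using flat that y by blast
  show "y \<in> M" if "h y \<in> L"
  proof -
    have "h y \<in> h ` (U \<inter> M)" unfolding flat using that h_mem[OF y] by simp
    then obtain w where w: "w \<in> U \<inter> M" "h y = h w" by blast
    have "y = g (h w)" unfolding w(2)[symmetric] gh[OF y] ..
    also have "\<dots> = w" using w by (intro gh) simp
    finally show ?thesis using w by simp
  qed
qed

lemma flat_g_iff: "z \<in> V \<Longrightarrow> g z \<in> M \<longleftrightarrow> z \<in> L"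
  using flat_iff[OF g_mem] hg by auto

text \<open>In the chart the difference quotients of a curve in M lie in the closed set L, and so
  does their limit. Conversely a straight line in L through \<open>h y\<close> stays in the flat
  piece for small parameters.\<close>

lemma tangent_space_eq:
  assumes y: "y \<in> U \<inter> M"
  shows "tangent_space M y = {v. h' y v \<in> L}"
proof (intro set_eqI iffI)
  fix v assume "v \<in> tangent_space M y"
  then have "h' y v \<in> tangent_space (h ` (U \<inter> M)) (h y)"
    unfolding tangent_space_image[OF IntD1[OF y]] by (rule imageI)
  then obtain \<gamma> where \<gamma>: "\<gamma> 0 = h y" "\<forall>\<^sub>F s in at 0. \<gamma> s \<in> h ` (U \<inter> M)"
      "(\<gamma> has_vector_derivative (h' y v)) (at 0)"
    by (auto simp: tangent_space_def)
  have lim: "((\<lambda>s. (\<gamma> s - \<gamma> 0) /\<^sub>R s) \<longlongrightarrow> h' y v) (at 0)"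
  proof (rule LIM_zero_cancel, rule tendsto_norm_zero_cancel, rule Lim_transform_eventually)
    show "((\<lambda>s. norm (\<gamma> s - \<gamma> 0 - s *\<^sub>R h' y v) / norm s) \<longlongrightarrow> 0) (at 0)"
      using \<gamma>(3) unfolding has_vector_derivative_def has_derivative_at by simp
    show "\<forall>\<^sub>F s in at 0. norm (\<gamma> s - \<gamma> 0 - s *\<^sub>R h' y v) / norm s
        = norm ((\<gamma> s - \<gamma> 0) /\<^sub>R s - h' y v)"
      unfolding eventually_at_filter
    proof (intro always_eventually allI impI)
      fix s :: real assume "s \<noteq> 0"
      then have "(\<gamma> s - \<gamma> 0) /\<^sub>R s - h' y v = (\<gamma> s - \<gamma> 0 - s *\<^sub>R h' y v) /\<^sub>R s"
        by (simp add: scaleR_diff_right)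
      then show "norm (\<gamma> s - \<gamma> 0 - s *\<^sub>R h' y v) / norm s = norm ((\<gamma> s - \<gamma> 0) /\<^sub>R s - h' y v)"
        by (simp add: divide_inverse_commute)
    qed
  qed
  have ev: "\<forall>\<^sub>F s in at 0. (\<gamma> s - \<gamma> 0) /\<^sub>R s \<in> L"
    using \<gamma>(2)
  proof (rule eventually_mono)
    fix s assume "\<gamma> s \<in> h ` (U \<inter> M)"
    moreover have "\<gamma> 0 \<in> L" using flat_iff[of y] y \<gamma>(1) by simp
    ultimately show "(\<gamma> s - \<gamma> 0) /\<^sub>R s \<in> L"
      unfolding flat by (intro subspace_scale subspace_diff subspace_L) simp_all
  qed
  have "h' y v \<in> L"
    by (rule Lim_in_closed_set[OF closed_subspace[OF subspace_L] ev _ lim]) simp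
  then show "v \<in> {v. h' y v \<in> L}" by simp
next
  fix v assume "v \<in> {v. h' y v \<in> L}"
  then have vL: "h' y v \<in> L" by simp
  define \<gamma> where "\<gamma> s = h y + s *\<^sub>R h' y v" for s :: real
  have yL: "h y \<in> L" using flat_iff[of y] y by simp
  have \<gamma>': "(\<gamma> has_vector_derivative h' y v) (at 0)"
    unfolding \<gamma>_def by (auto intro!: derivative_eq_intros)
  then have "isCont \<gamma> 0" by (rule has_vector_derivative_continuous)
  then have "(\<gamma> \<longlongrightarrow> h y) (at 0)" by (simp add: isCont_def \<gamma>_def)
  then have "\<forall>\<^sub>F s in at 0. \<gamma> s \<in> V"
    by (rule topological_tendstoD) (use open_V y h_mem in simp_all)
  then have "\<forall>\<^sub>F s in at 0. \<gamma> s \<in> h ` (U \<inter> M)"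
    by (rule eventually_mono)
      (simp add: flat \<gamma>_def subspace_add subspace_scale subspace_L vL yL)
  then have "h' y v \<in> tangent_space (h ` (U \<inter> M)) (h y)"
    unfolding tangent_space_def using \<gamma>' by (intro CollectI exI[of _ \<gamma>]) (auto simp: \<gamma>_def)
  then obtain w where w: "w \<in> tangent_space M y" "h' y v = h' y w"
    unfolding tangent_space_image[OF IntD1[OF y]] by blast
  have "v = g' (h y) (h' y w)" unfolding w(2)[symmetric] g'_h'[OF IntD1[OF y]] ..
  also have "\<dots> = w" by (rule g'_h'[OF IntD1[OF y]])
  finally show "v \<in> tangent_space M y" using w(1) by simp
qed

end

lemma flattening_chart_diffeo:
  assumes "flattening_chart M x L U h"
  obtains g h' g' where "flat_chart U (h ` U) h g h' g' M L" "x \<in> U" "h x = 0"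
proof -
  from assms obtain g where *: "x \<in> U" "h x = 0" "subspace L" "open U" "open (h ` U)"
    "homeomorphism U (h ` U) h g" "C2_on U h" "C2_on (h ` U) g" "h ` (U \<inter> M) = h ` U \<inter> L"
    unfolding flattening_chart_def C2_diffeomorphism_def by blast
  obtain h' h'' where h: "\<And>x. x\<in>U \<Longrightarrow> (h has_derivative blinfun_apply (h' x)) (at x)"
     "\<And>x. x\<in>U \<Longrightarrow> (h' has_derivative blinfun_apply (h'' x)) (at x)" "continuous_on U h''"
    using \<open>C2_on U h\<close> unfolding C2_on_def by blast
  obtain g' g'' where g: "\<And>x. x\<in>h ` U \<Longrightarrow> (g has_derivative blinfun_apply (g' x)) (at x)"
     "\<And>x. x\<in>h ` U \<Longrightarrow> (g' has_derivative blinfun_apply (g'' x)) (at x)" "continuous_on (h ` U) g''"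
    using \<open>C2_on (h ` U) g\<close> unfolding C2_on_def by blast
  have "flat_chart U (h ` U) h g h' g' M L"
  proof
    show "continuous_on U h'" "continuous_on (h ` U) g'"
      by (rule has_derivative_continuous_on, rule has_derivative_at_withinI, erule h(2))
        (rule has_derivative_continuous_on, rule has_derivative_at_withinI, erule g(2))
    show "\<exists>C>0. \<exists>d>0. \<forall>u\<in>ball z d. \<forall>v\<in>ball z d. norm (g' u - g' v) \<le> C * norm (u - v)"
      if "z \<in> h ` U" for z
      by (rule continuous_derivative_locally_lipschitz[OF *(5) that g(2,3)]) blast+
  qed (fact * h g)+
  then show ?thesis using that * by blast
qed

section \<open>Differentiability of the closest point retraction\<close>

context
  fixes T :: "'a::euclidean_space set"
  assumes T: "subspace T"
begin

lemma proj_mem: "closest_point T v \<in> T"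
  using closest_point_in_set[OF closed_subspace[OF T]] subspace_0[OF T] by blast

lemma proj_orth:
  assumes w: "w \<in> T" shows "(v - closest_point T v) \<bullet> w = 0"
proof -
  have "(v - closest_point T v) \<bullet> ((closest_point T v + u) - closest_point T v) \<le> 0" if "u \<in> T" for u
    by (rule closest_point_dot[OF subspace_imp_convex[OF T] closed_subspace[OF T]])
      (simp add: subspace_add[OF T] proj_mem that)
  from this[OF w] this[OF subspace_neg[OF T w]] show ?thesis by simp
qed

lemma proj_unique:
  assumes "p \<in> T" "\<And>w. w \<in> T \<Longrightarrow> (v - p) \<bullet> w = 0"
  shows "closest_point T v = p"
proof -
  let ?d = "closest_point T v - p"
  have d: "?d \<in> T" by (intro subspace_diff T proj_mem assms)
  have "?d \<bullet> ?d = (v - p) \<bullet> ?d - (v - closest_point T v) \<bullet> ?d"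
    by (simp add: inner_diff_left)
  also have "\<dots> = 0" using assms(2)[OF d] proj_orth[OF d] by simp
  finally show ?thesis by simp
qed

lemma proj_id: "v \<in> T \<Longrightarrow> closest_point T v = v"
  by (rule closest_point_self)

lemma proj_linear: "linear (closest_point T)"
proof (rule linearI)
  show "closest_point T (u + v) = closest_point T u + closest_point T v" for u v
    by (rule proj_unique)
      (use proj_orth[of _ u] proj_orth[of _ v] in \<open>auto simp: subspace_add[OF T] proj_mem inner_diff_left inner_add_left\<close>)
  show "closest_point T (c *\<^sub>R v) = c *\<^sub>R closest_point T v" for c v
    by (rule proj_unique)
      (use proj_orth[of _ v] in \<open>auto simp: subspace_scale[OF T] proj_mem inner_diff_left\<close>)
qed

lemma proj_bounded_linear: "bounded_linear (closest_point T)"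
  using proj_linear linear_conv_bounded_linear by blast

lemma proj_inner: "v \<bullet> closest_point T v = (norm (closest_point T v))\<^sup>2"
  using proj_orth[OF proj_mem, of v v] by (simp add: inner_diff_left power2_norm_eq_inner)

lemma proj_norm: "norm (closest_point T v) \<le> norm v"
proof -
  have "(norm (closest_point T v))\<^sup>2 \<le> norm v * norm (closest_point T v)"
    unfolding proj_inner[symmetric] by (rule norm_cauchy_schwarz)
  then show ?thesis
    by (cases "closest_point T v = 0") (auto simp: power2_eq_square)
qed

lemma proj_dist: "w \<in> T \<Longrightarrow> norm (v - closest_point T v) \<le> norm (v - w)"
  using closest_point_le[OF closed_subspace[OF T], of w v] by (simp add: dist_norm)

lemma proj_compl_norm: "norm (v - closest_point T v) \<le> norm v"
  using proj_dist[OF subspace_0[OF T], of v] by simp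

lemma infdist_proj: "infdist v T = norm (v - closest_point T v)"
proof (rule antisym)
  show "infdist v T \<le> norm (v - closest_point T v)"
    using infdist_le[OF proj_mem, of v v] by (simp add: dist_norm)
  show "norm (v - closest_point T v) \<le> infdist v T"
    using proj_mem by (intro order.trans[OF _ eq_refl[OF infdist_notempty[symmetric]]] cINF_greatest)
      (auto simp: dist_norm intro: proj_dist)
qed

end

section \<open>The closest point map near the centre of a chart\<close>

locale centered_chart = flat_chart +
  assumes zero_V: "0 \<in> V"
begin

abbreviation x0 :: 'a where "x0 \<equiv> g 0"

lemma h_x0 [simp]: "h x0 = 0" by (rule hg[OF zero_V])
lemma x0_U: "x0 \<in> U" by (rule g_mem[OF zero_V])
lemma x0_M: "x0 \<in> M" using flat_g_iff[OF zero_V] subspace_0[OF subspace_L] by simp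

text \<open>M need not be closed, but its part in a small closed ball about x0 is, being a preimage
  of L. For y within half the radius the minimum over this part is global, since points of M outside
  the ball are farther from y than x0 is.\<close>

lemma closest_point_near:
  obtains d where "d > 0" "\<And>y. y \<in> ball x0 d \<Longrightarrow> closest_point M y \<in> M"
    "\<And>y x. y \<in> ball x0 d \<Longrightarrow> x \<in> M \<Longrightarrow> dist y (closest_point M y) \<le> dist y x"
proof -
  obtain e where e: "e > 0" "cball x0 e \<subseteq> U" using open_U x0_U open_contains_cball by blast
  have eq: "M \<inter> cball x0 e = cball x0 e \<inter> h -` L" using flat_iff e(2) by auto
  have "closed (cball x0 e \<inter> h -` L)"
    by (rule continuous_closed_preimage[OF continuous_on_subset[OF cont_h e(2)] closed_cball closed_subspace[OF subspace_L]])
  then have cl: "closed (M \<inter> cball x0 e)" unfolding eq .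
  have ne: "M \<inter> cball x0 e \<noteq> {}" using x0_M e(1) by auto
  have "closest_point M y \<in> M \<and> (\<forall>x\<in>M. dist y (closest_point M y) \<le> dist y x)" if y: "y \<in> ball x0 (e/2)" for y
  proof -
    obtain m where m: "m \<in> M \<inter> cball x0 e" "\<And>x. x \<in> M \<inter> cball x0 e \<Longrightarrow> dist y m \<le> dist y x"
      using distance_attains_inf[OF cl ne, of y] by blast
    have "dist y m \<le> dist y x" if "x \<in> M" for x
    proof (cases "x \<in> cball x0 e")
      case False
      have "dist y m \<le> dist y x0" using m(2)[of x0] x0_M e(1) by simp
      moreover have "dist x0 x \<le> dist x0 y + dist y x" by (rule dist_triangle)
      ultimately show ?thesis using y False by (simp add: dist_commute)
    qed (use m that in auto)
    then have "m \<in> M \<and> (\<forall>x\<in>M. dist y m \<le> dist y x)" using m(1) by blast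
    then show ?thesis unfolding closest_point_def by (rule someI)
  qed
  then show ?thesis using that[of "e/2"] e(1) by auto
qed

text \<open>First variation: the squared distance from y along a curve of M through m has a local
  minimum at parameter 0.\<close>

lemma closest_point_orthogonal:
  assumes m: "m \<in> M" and min: "\<And>x. x \<in> M \<Longrightarrow> dist y m \<le> dist y x" and w: "w \<in> tangent_space M m"
  shows "(y - m) \<bullet> w = 0"
proof -
  obtain \<gamma> where \<gamma>: "\<gamma> 0 = m" "\<forall>\<^sub>F s in at 0. \<gamma> s \<in> M" "(\<gamma> has_vector_derivative w) (at 0)"
    using w by (auto simp: tangent_space_def)
  define \<phi> where "\<phi> s = (y - \<gamma> s) \<bullet> (y - \<gamma> s)" for s
  have "(\<phi> has_derivative (\<lambda>s. (y - \<gamma> 0) \<bullet> (- (s *\<^sub>R w)) + (- (s *\<^sub>R w)) \<bullet> (y - \<gamma> 0))) (at 0)"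
    unfolding \<phi>_def using \<gamma>(3)[unfolded has_vector_derivative_def]
    by (auto intro!: derivative_eq_intros)
  moreover have "(\<lambda>s. (y - \<gamma> 0) \<bullet> (- (s *\<^sub>R w)) + (- (s *\<^sub>R w)) \<bullet> (y - \<gamma> 0)) = (*) (- 2 * ((y - m) \<bullet> w))"
    by (auto simp: fun_eq_iff \<gamma>(1) inner_commute)
  ultimately have D: "DERIV \<phi> 0 :> - 2 * ((y - m) \<bullet> w)"
    by (simp add: has_field_derivative_def)
  obtain d where d: "d > 0" "\<And>s. s \<noteq> 0 \<Longrightarrow> dist s 0 < d \<Longrightarrow> \<gamma> s \<in> M"
    using \<gamma>(2) unfolding eventually_at by auto
  have "\<phi> 0 \<le> \<phi> s" if "\<bar>0 - s\<bar> < d" for s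
  proof (cases "s = 0")
    case False
    then have "\<gamma> s \<in> M" using d(2) that by simp
    then have "norm (y - m) \<le> norm (y - \<gamma> s)" using min by (simp add: dist_norm)
    then show ?thesis by (simp add: \<phi>_def \<gamma>(1) norm_le)
  qed simp
  then have "- 2 * ((y - m) \<bullet> w) = 0" using DERIV_local_min[OF D d(1)] by blast
  then show ?thesis by simp
qed

lemma tangent_space_x0: "tangent_space M x0 = g' 0 ` L"
proof -
  have eq: "tangent_space M x0 = {v. h' x0 v \<in> L}" using tangent_space_eq[of x0] x0_U x0_M by blast
  show ?thesis unfolding eq
  proof (intro set_eqI iffI)
    fix v assume "v \<in> {v. h' x0 v \<in> L}"
    then show "v \<in> g' 0 ` L" using g'_h'[OF x0_U, of v] unfolding h_x0 by (intro image_eqI[of _ _ "h' x0 v"]) simp_all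
  next
    fix v assume "v \<in> g' 0 ` L"
    then show "v \<in> {v. h' x0 v \<in> L}" using h'_g'[OF x0_U] by auto
  qed
qed

lemma subspace_tangent_x0: "subspace (tangent_space M x0)"
  unfolding tangent_space_x0 by (rule linear_subspace_image[OF _ subspace_L]) (simp add: bounded_linear.linear blinfun.bounded_linear_right)

text \<open>For closest points \<open>x, x'\<close> of \<open>y, z\<close> the normal vectors \<open>m = y - x\<close> and \<open>m' = z - x'\<close> are orthogonal to
  the tangent vectors \<open>lift x\<close> and \<open>lift x'\<close>, which depend on the base point in a Lipschitz way as the
  chart is of class C2.  Hence \<open>m - m'\<close> has a small component along the tangent space at \<open>x0\<close>.\<close>

lemma strict_derivative_closest_point:
  "strict_derivative (closest_point M) (closest_point (tangent_space M x0)) x0"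
proof -
  let ?T = "tangent_space M x0"
  let ?P = "closest_point ?T"
  let ?p = "closest_point M"
  note T = subspace_tangent_x0
  obtain dc where dc: "dc > 0" "\<And>y. y \<in> ball x0 dc \<Longrightarrow> ?p y \<in> M"
    "\<And>y x. y \<in> ball x0 dc \<Longrightarrow> x \<in> M \<Longrightarrow> dist y (?p y) \<le> dist y x"
    using closest_point_near by blast
  obtain eU where eU: "eU > 0" "ball x0 eU \<subseteq> U" using open_U x0_U openE by blast
  obtain Ch dh where Ch: "Ch > 0" "dh > 0"
    "\<And>y z. y \<in> ball x0 dh \<Longrightarrow> z \<in> ball x0 dh \<Longrightarrow> norm (h y - h z) \<le> Ch * norm (y - z)"
    using strict_derivative_lipschitz[OF strict_h[OF x0_U]] by blast
  obtain Cg dg where Cg: "Cg > 0" "dg > 0"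
    "\<And>u v. u \<in> ball 0 dg \<Longrightarrow> v \<in> ball 0 dg \<Longrightarrow> norm (g' u - g' v) \<le> Cg * norm (u - v)"
    using lipschitz_g'[OF zero_V] by blast
  obtain H where H: "H > 0" "\<And>v. norm (h' x0 v) \<le> norm v * H"
    using bounded_linear.pos_bounded[OF blinfun.bounded_linear_right[of "h' x0"]] by blast
  \<comment> \<open>The Lipschitz constant, relative to norm w, of the vector field
    \<open>lift\<close> below.\<close>
  define C where "C = Cg * Ch * H"
  have C: "C > 0" using Cg Ch H by (simp add: C_def)
  have "\<exists>d>0. \<forall>y\<in>ball x0 d. \<forall>z\<in>ball x0 d. norm (?p y - ?p z - ?P (y - z)) \<le> \<kappa> * norm (y - z)"
    if \<kappa>: "\<kappa> > 0" for \<kappa> :: real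
  proof -
    define \<alpha> where "\<alpha> = min (1/3) (\<kappa>/3)"
    have \<alpha>: "\<alpha> > 0" "\<alpha> \<le> 1/3" "3 * \<alpha> \<le> \<kappa>" using \<kappa> by (auto simp: \<alpha>_def)
    obtain d1 where d1: "d1 > 0" "\<And>u v. u \<in> ball 0 d1 \<Longrightarrow> v \<in> ball 0 d1 \<Longrightarrow>
        norm (g u - g v - g' 0 (u - v)) \<le> \<alpha> / (2 * Ch) * norm (u - v)"
      by (rule strict_derivativeD[OF strict_g[OF zero_V], of "\<alpha> / (2 * Ch)"]) (use \<alpha> Ch in auto)
    define \<eta> where "\<eta> = \<alpha> / 4"
    define D where "D = min (min dg d1 / Ch) (min dh eU)"
    define d where "d = min (min dc (D / 2)) (\<eta> / (2 * C))"
    have D: "D > 0" using Cg Ch d1 eU by (simp add: D_def)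
    have dpos: "d > 0" using D dc C \<alpha> by (simp add: d_def \<eta>_def)
    have near: "?p y \<in> M" "norm (y - ?p y) \<le> d" "norm (?p y - x0) \<le> 2 * d" "?p y \<in> ball x0 D"
      "?p y \<in> U" "h (?p y) \<in> L" "h (?p y) \<in> ball 0 dg" "h (?p y) \<in> ball 0 d1"
      "\<And>w. w \<in> tangent_space M (?p y) \<Longrightarrow> (y - ?p y) \<bullet> w = 0"
      if y: "y \<in> ball x0 d" for y
    proof -
      have ydc: "y \<in> ball x0 dc" using y by (auto simp: d_def)
      show 1: "?p y \<in> M" by (rule dc(2)[OF ydc])
      have 2: "norm (y - ?p y) \<le> norm (y - x0)" "norm (y - x0) < d"
        using dc(3)[OF ydc x0_M] y by (simp_all add: dist_norm norm_minus_commute)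
      then show "norm (y - ?p y) \<le> d" by simp
      have 3: "norm (?p y - x0) < 2 * d"
        using 2 norm_triangle_ineq[of "?p y - y" "y - x0"] by (simp add: norm_minus_commute)
      then show "norm (?p y - x0) \<le> 2 * d" by simp
      have 4: "norm (?p y - x0) < D" using 3 by (simp add: d_def)
      then show "?p y \<in> ball x0 D" by (simp add: dist_norm norm_minus_commute)
      then show 5: "?p y \<in> U" using eU by (auto simp: D_def)
      then show "h (?p y) \<in> L" using flat_iff 1 by blast
      have "norm (h (?p y) - h x0) \<le> Ch * norm (?p y - x0)"
        by (rule Ch(3)) (use 4 Ch in \<open>auto simp: D_def dist_norm norm_minus_commute\<close>)
      also have "\<dots> < Ch * D" using 4 Ch by simp
      also have "\<dots> \<le> min dg d1"
      proof -
        have "D \<le> min dg d1 / Ch" unfolding D_def by (rule min.cobounded1)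
        then show ?thesis using Ch(1) by (simp only: pos_le_divide_eq mult.commute)
      qed
      finally show "h (?p y) \<in> ball 0 dg" "h (?p y) \<in> ball 0 d1" by auto
      show "(y - ?p y) \<bullet> w = 0" if "w \<in> tangent_space M (?p y)" for w
        using closest_point_orthogonal[OF 1 _ that] dc(3)[OF ydc] by blast
    qed
    have "norm (?p y - ?p z - ?P (y - z)) \<le> \<kappa> * norm (y - z)"
      if y: "y \<in> ball x0 d" and z: "z \<in> ball x0 d" for y z
    proof -
      let ?x = "?p y" and ?x' = "?p z"
      define m where "m = y - ?x"
      define m' where "m' = z - ?x'"
      define w where "w = ?P (m - m')"
      define lift where "lift x = g' (h x) (h' x0 w)" for x
      have wT: "w \<in> ?T" unfolding w_def by (rule proj_mem[OF T])
      have wL: "h' x0 w \<in> L" using wT tangent_space_eq[of x0] x0_U x0_M by blast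
      have lift_tan: "lift x \<in> tangent_space M x" if "x \<in> U" "x \<in> M" for x
      proof -
        have "h' x (lift x) \<in> L" unfolding lift_def h'_g'[OF that(1)] by (rule wL)
        then show ?thesis using tangent_space_eq[of x] that by blast
      qed
      have lift_lip: "norm (lift x - lift x') \<le> C * norm (x - x') * norm w"
        if "x \<in> ball x0 dh" "x' \<in> ball x0 dh" "h x \<in> ball 0 dg" "h x' \<in> ball 0 dg" for x x'
      proof -
        have "norm (lift x - lift x') = norm ((g' (h x) - g' (h x')) (h' x0 w))"
          by (simp add: lift_def blinfun.diff_left)
        also have "\<dots> \<le> norm (g' (h x) - g' (h x')) * norm (h' x0 w)" by (rule norm_blinfun)
        also have "\<dots> \<le> (Cg * norm (h x - h x')) * (norm w * H)"
          by (intro mult_mono Cg(3) H(2) that) (use Cg(1) in auto)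
        also have "\<dots> \<le> (Cg * (Ch * norm (x - x'))) * (norm w * H)"
          by (intro mult_right_mono mult_left_mono Ch(3) that) (use Cg(1) H(1) in auto)
        finally show ?thesis by (simp add: C_def mult_ac)
      qed
      have lift_x0: "lift x0 = w" unfolding lift_def by (rule g'_h'[OF x0_U])
      have xdh: "?x \<in> ball x0 dh" "?x' \<in> ball x0 dh"
        using near(4)[OF y] near(4)[OF z] by (auto simp: D_def)
      have e1: "norm (lift ?x - w) \<le> \<eta> * norm w"
      proof -
        have "norm (lift ?x - lift x0) \<le> C * norm (?x - x0) * norm w"
          by (rule lift_lip) (use xdh near(7)[OF y] Ch(2) Cg(2) in auto)
        also have "\<dots> \<le> C * (2 * d) * norm w"
          by (intro mult_right_mono mult_left_mono near(3) y) (use C in auto)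
        also have "\<dots> \<le> \<eta> * norm w"
        proof (rule mult_right_mono)
          have "d \<le> \<eta> / (2 * C)" by (simp add: d_def)
          then show "C * (2 * d) \<le> \<eta>" using C by (simp add: field_simps)
        qed simp
        finally show ?thesis unfolding lift_x0 .
      qed
      have e2: "norm (lift ?x - lift ?x') \<le> C * norm (?x - ?x') * norm w"
        by (rule lift_lip) (use xdh near(7)[OF y] near(7)[OF z] in auto)
      \<comment> \<open>Here w is the orthogonal projection of m - m'. The products of m with
        \<open>lift ?x\<close> and of m' with \<open>lift ?x'\<close> vanish, so they can be
        inserted to leave only differences of lifts, which are small.\<close>
      have "(norm w)\<^sup>2 = (m - m') \<bullet> w" unfolding w_def proj_inner[OF T] ..
      also have "\<dots> = - ((m - m') \<bullet> (lift ?x - w)) - m' \<bullet> (lift ?x - lift ?x')"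
        using near(9)[OF y lift_tan[OF near(5)[OF y] near(1)[OF y]]]
          near(9)[OF z lift_tan[OF near(5)[OF z] near(1)[OF z]]]
        by (simp add: m_def[symmetric] m'_def[symmetric] inner_diff_left inner_diff_right)
      also have "\<dots> \<le> norm (m - m') * norm (lift ?x - w) + norm m' * norm (lift ?x - lift ?x')"
        using Cauchy_Schwarz_ineq2[of "m - m'" "lift ?x - w"] Cauchy_Schwarz_ineq2[of m' "lift ?x - lift ?x'"]
        by linarith
      also have "\<dots> \<le> norm (m - m') * (\<eta> * norm w) + d * (C * norm (?x - ?x') * norm w)"
        by (intro add_mono mult_mono e1 e2) (use near(2)[OF z] dpos in \<open>auto simp: m'_def\<close>)
      also have "\<dots> = (\<eta> * norm (m - m') + d * C * norm (?x - ?x')) * norm w"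
        by (simp add: algebra_simps)
      finally have "norm w * norm w \<le> (\<eta> * norm (m - m') + d * C * norm (?x - ?x')) * norm w"
        by (simp add: power2_eq_square)
      then have w1: "norm w \<le> \<eta> * norm (m - m') + d * C * norm (?x - ?x')"
        using \<alpha> dpos C by (cases "w = 0") (auto simp: \<eta>_def)
      have "d * C \<le> \<eta>"
      proof -
        have "d \<le> \<eta> / (2 * C)" by (simp add: d_def)
        then have "2 * (d * C) \<le> \<eta>" using C by (simp add: field_simps)
        then show ?thesis using dpos C by (smt (verit) mult_pos_pos)
      qed
      then have "d * C * norm (?x - ?x') \<le> \<eta> * norm (?x - ?x')" by (rule mult_right_mono) simp
      moreover have "norm (m - m') \<le> norm (y - z) + norm (?x - ?x')"
        using norm_triangle_ineq4[of "y - z" "?x - ?x'"] by (simp add: m_def m'_def algebra_simps)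
      then have "\<eta> * norm (m - m') \<le> \<eta> * (norm (y - z) + norm (?x - ?x'))"
        using \<alpha> by (intro mult_left_mono) (auto simp: \<eta>_def)
      ultimately have w2: "norm w \<le> \<eta> * norm (y - z) + 2 * \<eta> * norm (?x - ?x')"
        using w1 by (simp add: algebra_simps)
      have "norm (g (h ?x) - g (h ?x') - g' 0 (h ?x - h ?x')) \<le> \<alpha> / (2 * Ch) * norm (h ?x - h ?x')"
        by (rule d1(2)) (use near(8)[OF y] near(8)[OF z] in auto)
      also have "\<dots> \<le> \<alpha> / (2 * Ch) * (Ch * norm (?x - ?x'))"
        by (intro mult_left_mono Ch(3) xdh) (use \<alpha> Ch in auto)
      also have "\<dots> = \<alpha> / 2 * norm (?x - ?x')" using Ch by simp
      finally have x1: "norm (?x - ?x' - g' 0 (h ?x - h ?x')) \<le> \<alpha> / 2 * norm (?x - ?x')"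
        by (simp only: gh[OF near(5)[OF y]] gh[OF near(5)[OF z]])
      have "g' 0 (h ?x - h ?x') \<in> ?T"
        unfolding tangent_space_x0 by (intro imageI subspace_diff subspace_L near(6) y z)
      then have x2: "norm (?x - ?x' - ?P (?x - ?x')) \<le> \<alpha> / 2 * norm (?x - ?x')"
        using proj_dist[OF T, of "g' 0 (h ?x - h ?x')" "?x - ?x'"] x1 by linarith
      have split: "?P (y - z) = ?P (?x - ?x') + w"
      proof -
        have "y - z = (?x - ?x') + (m - m')" by (simp add: m_def m'_def)
        then show ?thesis unfolding w_def using linear_add[OF proj_linear[OF T]] by metis
      qed
      have tri: "norm (?x - ?x' - ?P (y - z)) \<le> norm (?x - ?x' - ?P (?x - ?x')) + norm w"
        unfolding split using norm_triangle_ineq4[of "?x - ?x' - ?P (?x - ?x')" w] by (simp add: algebra_simps)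
      have fin: "norm (?x - ?x' - ?P (y - z)) \<le> \<alpha> * (norm (y - z) + norm (?x - ?x'))"
      proof -
        have "norm w \<le> 1/4 * (\<alpha> * norm (y - z)) + 1/2 * (\<alpha> * norm (?x - ?x'))"
          using w2 by (simp add: \<eta>_def)
        moreover have "norm (?x - ?x' - ?P (?x - ?x')) \<le> 1/2 * (\<alpha> * norm (?x - ?x'))"
          using x2 by simp
        moreover have "0 \<le> \<alpha> * norm (y - z)" using \<alpha> by simp
        ultimately show ?thesis
          using tri
          unfolding distrib_left by linarith
      qed
      \<comment> \<open>The estimate \<open>fin\<close> contains norm (?x - ?x') on its right side
        with the factor \<alpha> <= 1/3; absorbing it shows that the retraction at most doubles
        distances, whence the final bound 3 * \<alpha> <= \<kappa>.\<close>
      have "norm (?x - ?x') \<le> norm (?x - ?x' - ?P (y - z)) + norm (?P (y - z))"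
        using norm_triangle_ineq[of "?x - ?x' - ?P (y - z)" "?P (y - z)"] by simp
      then have "norm (?x - ?x') \<le> \<alpha> * (norm (y - z) + norm (?x - ?x')) + norm (y - z)"
        using fin proj_norm[OF T, of "y - z"] by linarith
      moreover have "\<alpha> * (norm (y - z) + norm (?x - ?x')) \<le> 1/3 * (norm (y - z) + norm (?x - ?x'))"
        by (intro mult_right_mono \<alpha>) simp
      ultimately have "norm (?x - ?x') \<le> 2 * norm (y - z)"
        unfolding distrib_left by linarith
      then have "\<alpha> * (norm (y - z) + norm (?x - ?x')) \<le> \<alpha> * (3 * norm (y - z))"
        using \<alpha> by (intro mult_left_mono) auto
      also have "\<dots> \<le> \<kappa> * norm (y - z)"
        using mult_right_mono[OF \<alpha>(3), of "norm (y - z)"] by simp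
      finally show ?thesis using fin by linarith
    qed
    then show ?thesis using dpos by blast
  qed
  then show ?thesis
    unfolding strict_derivative_def using proj_bounded_linear[OF T] by blast
qed

end

section \<open>Measurability of the function r\<close>

lemma infdist_subspace_le_norm: "subspace F \<Longrightarrow> infdist u F \<le> norm u" for F :: "'a::euclidean_space set"
  by (simp add: infdist_proj proj_compl_norm)

lemma delta_bdd:
  fixes F :: "'a::euclidean_space set"
  assumes "subspace F"
  shows "bdd_above (insert 0 {infdist u F | u. u \<in> E \<and> norm u = 1})"
proof (rule bdd_aboveI[of _ 1])
  fix x assume "x \<in> insert 0 {infdist u F | u. u \<in> E \<and> norm u = 1}"
  then consider "x = 0" | u where "x = infdist u F" "norm u = 1" by blast
  then show "x \<le> 1"
  proof cases
    case 2
    then show ?thesis using infdist_subspace_le_norm[OF assms, of u] by simp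
  qed simp
qed

lemma delta_nonneg: "subspace F \<Longrightarrow> 0 \<le> delta E F" for F :: "'a::euclidean_space set"
  unfolding delta_def by (rule cSup_upper[OF insertI1 delta_bdd])

lemma infdist_le_delta:
  fixes F :: "'a::euclidean_space set"
  assumes "subspace E" "subspace F" "u \<in> E"
  shows "infdist u F \<le> delta E F * norm u"
proof (cases "u = 0")
  case True
  then show ?thesis using subspace_0[OF assms(2)] by simp
next
  case False
  define w where "w = u /\<^sub>R norm u"
  have w: "w \<in> E" "norm w = 1" using False assms by (auto simp: w_def subspace_scale)
  have "infdist w F \<le> delta E F"
    unfolding delta_def by (rule cSup_upper[OF insertI2 delta_bdd[OF assms(2)]]) (use w in blast)
  moreover have "infdist u F = norm u * infdist w F"
  proof -
    have "u - closest_point F u = norm u *\<^sub>R (w - closest_point F w)"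
      using False by (simp add: w_def linear_scale[OF proj_linear[OF assms(2)]] scaleR_diff_right)
    then show ?thesis by (simp add: infdist_proj[OF assms(2)])
  qed
  ultimately show ?thesis by (simp add: mult.commute[of _ "norm u"] mult_left_mono)
qed

lemma delta_greater:
  fixes F :: "'a::euclidean_space set"
  assumes "subspace F" "0 \<le> k" "k < delta E F"
  obtains u where "u \<in> E" "norm u = 1" "k < infdist u F"
proof -
  obtain x where x: "x \<in> insert 0 {infdist u F | u. u \<in> E \<and> norm u = 1}" "k < x"
    using assms(3) less_cSup_iff[OF insert_not_empty delta_bdd[OF assms(1)]] unfolding delta_def by blast
  then obtain u where "u \<in> E" "norm u = 1" "x = infdist u F" using assms(2) by auto
  then show ?thesis using that x(2) by blast
qed

lemma delta_le:
  fixes F :: "'a::euclidean_space set"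
  assumes "0 \<le> c" "\<And>u. u \<in> E \<Longrightarrow> norm u = 1 \<Longrightarrow> infdist u F \<le> c"
  shows "delta E F \<le> c"
  unfolding delta_def by (rule cSup_least) (use assms in auto)

section \<open>Tangent spaces of a C2 submanifold\<close>

lemma C2_submanifold_chart:
  assumes "C2_submanifold Y" "y \<in> Y"
  obtains U V k f k' f' L where "flat_chart U V k f k' f' Y L" "y \<in> U" "k y = 0"
proof -
  obtain L U k where "flattening_chart Y y L U k"
    using assms unfolding C2_submanifold_def by blast
  then show ?thesis using that by (metis flattening_chart_diffeo)
qed

text \<open>The inverse of the chart precomposed with the derivative \<open>k' y\<close> of the
  chart: its derivative at 0 is the identity, and it maps small tangent vectors into Y because
  \<open>k' y\<close> maps them into L.\<close>

lemma tangent_parametrization: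
  assumes "C2_submanifold Y" "y \<in> Y"
  obtains \<psi> d where "subspace (tangent_space Y y)" "d > 0"
    "continuous_on (tangent_space Y y \<inter> ball 0 d) \<psi>" "\<psi> 0 = y"
    "\<And>w. w \<in> tangent_space Y y \<Longrightarrow> norm w < d \<Longrightarrow> \<psi> w \<in> Y"
    "(\<psi> has_derivative (\<lambda>w. w)) (at 0)"
proof -
  obtain U V k f k' f' L where c: "flat_chart U V k f k' f' Y L" and y: "y \<in> U" "k y = 0"
    using C2_submanifold_chart[OF assms] .
  interpret flat_chart U V k f k' f' Y L by (rule c)
  have T: "tangent_space Y y = {v. k' y v \<in> L}" using tangent_space_eq[of y] y assms by blast
  define \<psi> where "\<psi> w = f (k' y w)" for w
  have lin: "linear (k' y)" by (simp add: bounded_linear.linear blinfun.bounded_linear_right)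
  have sub: "subspace (tangent_space Y y)"
    unfolding T using linear_subspace_vimage[OF lin subspace_L] by (simp add: vimage_def)
  have V0: "0 \<in> V" using h_mem[OF y(1)] y(2) by simp
  have "open (k' y -` V)" by (rule open_vimage[OF open_V]) (simp add: blinfun.continuous_on continuous_on_const)
  moreover have "0 \<in> k' y -` V" using V0 by (simp add: blinfun.zero_right)
  ultimately obtain d where d: "d > 0" "ball 0 d \<subseteq> k' y -` V" using openE by blast
  have "(\<psi> has_derivative (\<lambda>w. f' (k y) (k' y w))) (at 0)"
    unfolding \<psi>_def
    by (rule has_derivative_compose[OF blinfun.bounded_linear_right[THEN bounded_linear.has_derivative[OF _ has_derivative_ident]]])
      (use deriv_g[OF V0] y in \<open>simp add: blinfun.zero_right\<close>)
  then have "(\<psi> has_derivative (\<lambda>w. w)) (at 0)" by (simp add: g'_h'[OF y(1)])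
  moreover have "continuous_on (tangent_space Y y \<inter> ball 0 d) \<psi>"
    unfolding \<psi>_def by (rule continuous_on_compose2[OF cont_g]) (use d in \<open>auto simp: blinfun.continuous_on continuous_on_const\<close>)
  moreover have "\<psi> w \<in> Y" if "w \<in> tangent_space Y y" "norm w < d" for w
  proof -
    have "k' y w \<in> V" using d(2) that(2) by auto
    then show ?thesis unfolding \<psi>_def using flat_g_iff that(1) T by blast
  qed
  moreover have "\<psi> 0 = y" using gh[OF y(1)] by (simp add: \<psi>_def y blinfun.zero_right)
  ultimately show ?thesis using that[of d \<psi>] sub d(1) by blast
qed

lemma subspace_tangent_space: "C2_submanifold Y \<Longrightarrow> y \<in> Y \<Longrightarrow> subspace (tangent_space Y y)"
  using tangent_parametrization by blast

text \<open>The tangent bundle is closed over Y: in a chart its fibres are the preimages of one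
  fixed closed L under a derivative that depends continuously on the point.\<close>

lemma tangent_space_limit:
  assumes Y: "C2_submanifold Y" "y \<in> Y" and s: "\<And>i::nat. s i \<in> Y" "s \<longlonglongrightarrow> y"
    and v: "\<And>i. v i \<in> tangent_space Y (s i)" "v \<longlonglongrightarrow> u"
  shows "u \<in> tangent_space Y y"
proof -
  obtain U V k f k' f' L where c: "flat_chart U V k f k' f' Y L" and y: "y \<in> U" "k y = 0"
    using C2_submanifold_chart[OF Y] .
  interpret flat_chart U V k f k' f' Y L by (rule c)
  have ev: "\<forall>\<^sub>F i in sequentially. s i \<in> U" by (rule topological_tendstoD[OF s(2) open_U y(1)])
  have "(\<lambda>i. k' (s i)) \<longlonglongrightarrow> k' y" by (rule isCont_tendsto_compose[OF isCont_h'[OF y(1)] s(2)])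
  then have lim: "(\<lambda>i. k' (s i) (v i)) \<longlonglongrightarrow> k' y u" using v(2) by (rule blinfun.tendsto)
  have "\<forall>\<^sub>F i in sequentially. k' (s i) (v i) \<in> L"
    using ev by (rule eventually_mono) (use tangent_space_eq s(1) v(1) in blast)
  then have "k' y u \<in> L"
    by (rule Lim_in_closed_set[OF closed_subspace[OF subspace_L] _ _ lim]) simp
  then show ?thesis using tangent_space_eq[of y] y Y by blast
qed

text \<open>Inside a chart domain Y is the preimage of the closed L, hence relatively closed there;
  the union of the chart domains serves as G.\<close>

lemma C2_submanifold_locally_closed:
  assumes "C2_submanifold Y"
  obtains G where "open G" "Y = G \<inter> closure Y"
proof -
  have "\<exists>U. open U \<and> y \<in> U \<and> U \<inter> closure Y \<subseteq> Y" if y: "y \<in> Y" for y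
  proof -
    obtain U V k f k' f' L where c: "flat_chart U V k f k' f' Y L" and yU: "y \<in> U" "k y = 0"
      using C2_submanifold_chart[OF assms y] .
    interpret flat_chart U V k f k' f' Y L by (rule c)
    have "x \<in> Y" if x: "x \<in> U" "x \<in> closure Y" for x
    proof -
      obtain s where s: "\<And>i::nat. s i \<in> Y" "s \<longlonglongrightarrow> x" using x(2) closure_sequential by blast
      have ev: "\<forall>\<^sub>F i in sequentially. s i \<in> U" by (rule topological_tendstoD[OF s(2) open_U x(1)])
      have lim: "(\<lambda>i. k (s i)) \<longlonglongrightarrow> k x" by (rule isCont_tendsto_compose[OF isCont_h[OF x(1)] s(2)])
      have "\<forall>\<^sub>F i in sequentially. k (s i) \<in> L"
        using ev by (rule eventually_mono) (use flat_iff s(1) in blast)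
      then have "k x \<in> L"
        by (rule Lim_in_closed_set[OF closed_subspace[OF subspace_L] _ _ lim]) simp
      then show ?thesis using flat_iff x(1) by blast
    qed
    then show ?thesis using open_U yU by blast
  qed
  then obtain U where U: "\<And>y. y \<in> Y \<Longrightarrow> open (U y) \<and> y \<in> U y \<and> U y \<inter> closure Y \<subseteq> Y" by metis
  show ?thesis
  proof (rule that)
    show "open (\<Union>y\<in>Y. U y)" using U by blast
    show "Y = (\<Union>y\<in>Y. U y) \<inter> closure Y" using U closure_subset by blast
  qed
qed

section \<open>Strata read in the chart of another stratum\<close>

context diffeo begin

context
  fixes Y :: "'a set"
  assumes Y: "C2_submanifold Y"
begin

lemma image_subspace_tangent: "z \<in> h ` (U \<inter> Y) \<Longrightarrow> subspace (tangent_space (h ` (U \<inter> Y)) z)"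
  using tangent_space_image[of _ Y] subspace_tangent_space[OF Y]
  by (auto intro!: linear_subspace_image bounded_linear.linear blinfun.bounded_linear_right)

lemma image_tangent_iff:
  assumes "y \<in> U"
  shows "v \<in> tangent_space (h ` (U \<inter> Y)) (h y) \<longleftrightarrow> g' (h y) v \<in> tangent_space Y y"
  unfolding tangent_space_image[OF assms]
proof
  assume "v \<in> h' y ` tangent_space Y y"
  then show "g' (h y) v \<in> tangent_space Y y" using g'_h'[OF assms] by auto
next
  assume "g' (h y) v \<in> tangent_space Y y"
  then have "h' y (g' (h y) v) \<in> h' y ` tangent_space Y y" by (rule imageI)
  then show "v \<in> h' y ` tangent_space Y y" unfolding h'_g'[OF assms] .
qed

text \<open>The parametrization of Y is composed with h on the left and with \<open>g' z\<close> on
  the right, so that its derivative at 0 is again the identity.\<close>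

lemma image_tangent_parametrization:
  assumes z: "z \<in> h ` (U \<inter> Y)"
  obtains \<psi> d where "d > 0"
    "continuous_on (tangent_space (h ` (U \<inter> Y)) z \<inter> ball 0 d) \<psi>" "\<psi> 0 = z"
    "\<And>w. w \<in> tangent_space (h ` (U \<inter> Y)) z \<Longrightarrow> norm w < d \<Longrightarrow> \<psi> w \<in> h ` (U \<inter> Y)"
    "(\<psi> has_derivative (\<lambda>w. w)) (at 0)"
proof -
  obtain y where y: "y \<in> U" "y \<in> Y" "z = h y" using z by blast
  let ?T = "tangent_space Y y" and ?T' = "tangent_space (h ` (U \<inter> Y)) z"
  obtain \<phi> d where \<phi>: "d > 0" "continuous_on (?T \<inter> ball 0 d) \<phi>" "\<phi> 0 = y"
    "\<And>w. w \<in> ?T \<Longrightarrow> norm w < d \<Longrightarrow> \<phi> w \<in> Y" "(\<phi> has_derivative (\<lambda>w. w)) (at 0)"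
    by (rule tangent_parametrization[OF Y y(2)], rule that)
  let ?\<psi> = "\<lambda>w. h (\<phi> (g' z w))"
  have T': "w \<in> ?T' \<longleftrightarrow> g' z w \<in> ?T" for w unfolding y(3) by (rule image_tangent_iff[OF y(1)])
  have "isCont \<phi> 0" using \<phi>(5) by (rule has_derivative_continuous)
  then have "(\<phi> \<longlongrightarrow> y) (at 0)" by (simp add: isCont_def \<phi>(3))
  then have "\<forall>\<^sub>F w in at 0. \<phi> w \<in> U" by (rule topological_tendstoD[OF _ open_U y(1)])
  then obtain d1 where d1: "d1 > 0" "\<And>w. w \<noteq> 0 \<Longrightarrow> dist w 0 < d1 \<Longrightarrow> \<phi> w \<in> U"
    unfolding eventually_at by blast
  have d1': "\<phi> w \<in> U" if "norm w < d1" for w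
    by (cases "w = 0") (use d1(2)[of w] that y(1) \<phi>(3) in simp_all)
  obtain K where K: "K > 0" "\<And>v. norm (g' z v) \<le> norm v * K"
    using bounded_linear.pos_bounded[OF blinfun.bounded_linear_right[of "g' z"]] by blast
  define e where "e = min d d1 / K"
  have e: "e > 0" using \<phi>(1) d1(1) K(1) by (simp add: e_def)
  have small: "norm (g' z w) < d" "norm (g' z w) < d1" if "norm w < e" for w
  proof -
    have "norm w * K < min d d1" using that K(1) by (simp add: e_def pos_less_divide_eq)
    then show "norm (g' z w) < d" "norm (g' z w) < d1" using K(2)[of w] by auto
  qed
  show ?thesis
  proof (rule that[of e ?\<psi>])
    show "continuous_on (?T' \<inter> ball 0 e) ?\<psi>"
    proof (rule continuous_on_compose2[OF cont_h], rule continuous_on_compose2[OF \<phi>(2)])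
      show "continuous_on (?T' \<inter> ball 0 e) (g' z)" by (simp add: blinfun.continuous_on continuous_on_const)
      show "g' z ` (?T' \<inter> ball 0 e) \<subseteq> ?T \<inter> ball 0 d" using T' small by auto
      show "(\<lambda>w. \<phi> (g' z w)) ` (?T' \<inter> ball 0 e) \<subseteq> U" using d1' small by auto
    qed
    show "?\<psi> 0 = z" by (simp add: blinfun.zero_right \<phi>(3) y(3))
    show "?\<psi> w \<in> h ` (U \<inter> Y)" if "w \<in> ?T'" "norm w < e" for w
      using \<phi>(4)[OF T'[THEN iffD1, OF that(1)] small(1)[OF that(2)]] d1'[OF small(2)[OF that(2)]] by blast
    have "((\<lambda>w. \<phi> (g' z w)) has_derivative (\<lambda>w. g' z w)) (at 0)"
      by (rule has_derivative_compose[OF blinfun.bounded_linear_right[THEN bounded_linear.has_derivative[OF _ has_derivative_ident]]])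
        (use \<phi>(5) in \<open>simp add: blinfun.zero_right\<close>)
    then have "(?\<psi> has_derivative (\<lambda>w. h' y (g' z w))) (at 0)"
      by (rule has_derivative_compose) (use deriv_h[OF y(1)] in \<open>simp add: blinfun.zero_right \<phi>(3)\<close>)
    then show "(?\<psi> has_derivative (\<lambda>w. w)) (at 0)" unfolding y(3) h'_g'[OF y(1)] .
  qed (rule e)
qed

lemma image_tangent_limit:
  assumes z: "z \<in> h ` (U \<inter> Y)" and s: "\<And>i::nat. s i \<in> h ` (U \<inter> Y)" "s \<longlonglongrightarrow> z"
    and v: "\<And>i. v i \<in> tangent_space (h ` (U \<inter> Y)) (s i)" "v \<longlonglongrightarrow> u"
  shows "u \<in> tangent_space (h ` (U \<inter> Y)) z"
proof -
  obtain y where y: "y \<in> U" "y \<in> Y" "z = h y" using z by blast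
  have gs: "g (s i) \<in> U" "g (s i) \<in> Y" "h (g (s i)) = s i" for i
    using s(1)[of i] gh by auto
  have zV: "z \<in> V" using h_mem y by simp
  have l1: "(\<lambda>i. g (s i)) \<longlonglongrightarrow> g z" by (rule isCont_tendsto_compose[OF isCont_g[OF zV] s(2)])
  have "(\<lambda>i. g' (s i)) \<longlonglongrightarrow> g' z" by (rule isCont_tendsto_compose[OF isCont_g'[OF zV] s(2)])
  then have l2: "(\<lambda>i. g' (s i) (v i)) \<longlonglongrightarrow> g' z u" using v(2) by (rule blinfun.tendsto)
  have gz: "g z = y" using gh y by simp
  have "g' (s i) (v i) \<in> tangent_space Y (g (s i))" for i
    using image_tangent_iff[OF gs(1)[of i], of "v i"] v(1)[of i] unfolding gs(3) by blast
  then have "g' z u \<in> tangent_space Y (g z)"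
    using tangent_space_limit[OF Y y(2) gs(2) l1[unfolded gz] _ l2] gz by simp
  then show ?thesis unfolding y(3) gz[unfolded y(3)] by (simp add: image_tangent_iff[OF y(1)])
qed

text \<open>Lower semicontinuity of the quotient along the stratum. If it were at most k at points s
  i tending to z, the projections of a fixed unit vector u of L onto the tangent spaces at s i would
  cluster at a vector tangent at z, too close to u for the quotient at z to exceed k.\<close>

lemma image_delta_quotient_openin:
  assumes L: "subspace L" and k: "0 \<le> k"
  shows "openin (top_of_set (h ` (U \<inter> Y))) {z \<in> h ` (U \<inter> Y) \<inter> ball 0 \<eta>.
      k < delta L (tangent_space (h ` (U \<inter> Y)) z) / norm (z - closest_point L z)}" (is "openin _ ?W")
proof -
  let ?Y = "h ` (U \<inter> Y)" and ?n = "\<lambda>z. z - closest_point L z"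
  define W where "W = ?W"
  have "\<exists>e>0. ball z e \<inter> ?Y \<subseteq> W" if zW: "z \<in> W" for z
  proof (rule ccontr)
    assume no: "\<not> ?thesis"
    have "\<forall>i. \<exists>s. s \<in> ball z (inverse (real (Suc i))) \<inter> ?Y \<and> s \<notin> W"
    proof
      fix i
      have "\<not> ball z (inverse (real (Suc i))) \<inter> ?Y \<subseteq> W" using no by (simp del: of_nat_Suc)
      then show "\<exists>s. s \<in> ball z (inverse (real (Suc i))) \<inter> ?Y \<and> s \<notin> W" by blast
    qed
    from choice[OF this] obtain s where s: "\<And>i. s i \<in> ball z (inverse (real (Suc i))) \<inter> ?Y" "\<And>i. s i \<notin> W"
      by blast
    have z: "z \<in> ?W" using zW unfolding W_def .
    have lim: "s \<longlonglongrightarrow> z"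
      by (rule metric_tendsto_imp_tendsto[OF LIMSEQ_inverse_real_of_nat])
        (use s(1) in \<open>auto intro!: always_eventually less_imp_le simp: dist_commute\<close>)
    have zY: "z \<in> ?Y" "z \<in> ball 0 \<eta>" and q: "k < delta L (tangent_space ?Y z) / norm (?n z)" using z by auto
    \<comment> \<open>Division by zero yields 0, which does not exceed k.\<close>
    have nz: "?n z \<noteq> 0" using q k by auto
    then have "k * norm (?n z) < delta L (tangent_space ?Y z)"
      using q by (simp add: pos_less_divide_eq)
    then obtain u where u: "u \<in> L" "norm u = 1" "k * norm (?n z) < infdist u (tangent_space ?Y z)"
      using delta_greater[OF image_subspace_tangent[OF zY(1)]] k by (metis mult_nonneg_nonneg norm_ge_zero)
    have "isCont (\<lambda>z. ?n z) z"
      using linear_continuous_at[OF proj_bounded_linear[OF L]] by (intro continuous_intros) auto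
    then have limn: "(\<lambda>i. ?n (s i)) \<longlonglongrightarrow> ?n z" using lim by (rule isCont_tendsto_compose)
    have ev: "\<forall>\<^sub>F i in sequentially. infdist u (tangent_space ?Y (s i)) \<le> k * norm (?n (s i))"
      using topological_tendstoD[OF lim open_ball zY(2)] tendsto_imp_eventually_ne[OF limn nz]
    proof eventually_elim
      case (elim i)
      have "\<not> k < delta L (tangent_space ?Y (s i)) / norm (?n (s i))" using s[of i] elim(1) unfolding W_def by blast
      then have "delta L (tangent_space ?Y (s i)) \<le> k * norm (?n (s i))"
        using elim(2) by (simp add: not_less pos_divide_le_eq)
      moreover have "subspace (tangent_space ?Y (s i))" using image_subspace_tangent s(1)[of i] by blast
      ultimately show ?case using infdist_le_delta[OF L _ u(1), of "tangent_space ?Y (s i)"] u(2) by simp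
    qed
    define v where "v i = closest_point (tangent_space ?Y (s i)) u" for i
    have sub: "subspace (tangent_space ?Y (s i))" for i using image_subspace_tangent s(1)[of i] by blast
    have "v i \<in> cball 0 1" for i using proj_norm[OF sub[of i], of u] u(2) by (simp add: v_def)
    then obtain w r where w: "w \<in> cball 0 1" "strict_mono r" "(v \<circ> r) \<longlonglongrightarrow> w"
      using compact_cball[of "0::'a" 1] unfolding compact_def by metis
    have limr: "(s \<circ> r) \<longlonglongrightarrow> z" by (rule LIMSEQ_subseq_LIMSEQ[OF lim w(2)])
    have wT: "w \<in> tangent_space ?Y z"
      by (rule image_tangent_limit[OF zY(1) _ limr _ w(3)]) (use s(1) sub in \<open>auto simp: v_def intro: proj_mem\<close>)
    have l1: "(\<lambda>i. norm (u - (v \<circ> r) i)) \<longlonglongrightarrow> norm (u - w)" by (intro tendsto_intros w(3))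
    have l2: "(\<lambda>i. k * norm (?n ((s \<circ> r) i))) \<longlonglongrightarrow> k * norm (?n z)"
      using tendsto_mult[OF tendsto_const tendsto_norm[OF LIMSEQ_subseq_LIMSEQ[OF limn w(2)]]]
      by (simp add: o_def)
    have l3: "\<forall>\<^sub>F i in sequentially. norm (u - (v \<circ> r) i) \<le> k * norm (?n ((s \<circ> r) i))"
      using eventually_subseq[OF w(2) ev] by (simp add: v_def infdist_proj[OF sub])
    have "norm (u - w) \<le> k * norm (?n z)"
      by (rule tendsto_le[OF sequentially_bot l2 l1 l3])
    moreover have "infdist u (tangent_space ?Y z) \<le> norm (u - w)" using infdist_le[OF wT, of u] by (simp add: dist_norm)
    ultimately show False using u(3) by linarith
  qed
  moreover have "W \<subseteq> ?Y" unfolding W_def by blast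
  ultimately show ?thesis unfolding openin_contains_ball W_def[symmetric] by blast
qed

text \<open>A continuous image of a Borel set need not be Borel, so more structure is used. By lower
  semicontinuity {r > a} is the image, under the radius, of a relatively open piece of the stratum.
  As the stratum is locally closed, this piece is a countable union of compact sets, and so is its
  image.\<close>

lemma r_function_measurable:
  assumes L: "subspace L"
  shows "r_function (h ` (U \<inter> Y)) L \<eta> \<in> borel_measurable borel"
proof (rule borel_measurableI_greater)
  fix a :: ennreal
  let ?Y = "h ` (U \<inter> Y)"
  let ?q = "\<lambda>z. delta L (tangent_space ?Y z) / norm (z - closest_point L z)"
  show "{t \<in> space borel. a < r_function ?Y L \<eta> t} \<in> sets borel"
  proof (cases a)
    case top
    then show ?thesis by simp
  next
    case (real k)
    define W where "W = {z \<in> ?Y \<inter> ball 0 \<eta>. k < ?q z}"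
    have "openin (top_of_set ?Y) W" unfolding W_def by (rule image_delta_quotient_openin[OF L]) (use real in simp)
    then obtain O' where O': "open O'" "W = ?Y \<inter> O'" unfolding openin_open by blast
    obtain G where G: "open G" "Y = G \<inter> closure Y" using C2_submanifold_locally_closed[OF Y] .
    have "open (U \<inter> h -` O')" by (rule continuous_open_preimage[OF cont_h open_U O'(1)])
    then have "open (U \<inter> h -` O' \<inter> G)" using G(1) by blast
    then obtain \<D> where D: "countable \<D>" "\<D> \<subseteq> Pow (U \<inter> h -` O' \<inter> G)" "\<And>X. X \<in> \<D> \<Longrightarrow> \<exists>a b. X = cbox a b"
        "\<Union>\<D> = U \<inter> h -` O' \<inter> G"
      using open_countable_Union_open_cbox[of "U \<inter> h -` O' \<inter> G"] by metis
    have W: "W = h ` (\<Union>X\<in>\<D>. X \<inter> closure Y)"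
    proof -
      have "(\<Union>X\<in>\<D>. X \<inter> closure Y) = U \<inter> h -` O' \<inter> G \<inter> closure Y" using D(4) by blast
      also have "\<dots> = U \<inter> h -` O' \<inter> Y" using G(2) by blast
      finally show ?thesis using O'(2) by auto
    qed
    define q where "q y = norm (closest_point L (h y))" for y
    have "{t. a < r_function ?Y L \<eta> t} = (\<lambda>z. norm (closest_point L z)) ` W"
      unfolding r_function_def less_SUP_iff real W_def using real by (auto simp: ennreal_less_iff)
    also have "\<dots> = (\<Union>X\<in>\<D>. q ` (X \<inter> closure Y))" unfolding W q_def by auto
    finally have eq: "{t. a < r_function ?Y L \<eta> t} = (\<Union>X\<in>\<D>. q ` (X \<inter> closure Y))" .
    have "q ` (X \<inter> closure Y) \<in> sets borel" if X: "X \<in> \<D>" for X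
    proof -
      have sub: "X \<inter> closure Y \<subseteq> U" using D(2) X by blast
      have "compact (X \<inter> closure Y)" using D(3)[OF X] by (metis closed_closure compact_Int_closed compact_cbox)
      moreover have "continuous_on (X \<inter> closure Y) q"
        unfolding q_def
        by (intro continuous_on_norm continuous_on_compose2[OF linear_continuous_on[OF proj_bounded_linear[OF L], of UNIV]]
            continuous_on_subset[OF cont_h sub]) auto
      ultimately show ?thesis using compact_continuous_image compact_imp_closed borel_closed by blast
    qed
    then have "(\<Union>X\<in>\<D>. q ` (X \<inter> closure Y)) \<in> sets borel"
      by (intro sets.countable_UN'[OF D(1)]) blast
    then show ?thesis by (simp add: eq)
  qed
qed

end
end

section \<open>Lifting straight motions of the base to a stratum\<close>

text \<open>The map \<open>\<sigma>\<close> has strict derivative \<open>S0\<close>, which is the identity on \<open>L\<close>, and \<open>T\<close> is the tangent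
  space of \<open>N\<close> at \<open>z\<close>, almost containing \<open>L\<close>.  Brouwer's theorem on \<open>L \<inter> cball (s *\<^sub>R e) (s / 4)\<close> yields
  a nearby point of \<open>N\<close> whose image under \<open>\<sigma>\<close> has moved by exactly \<open>s *\<^sub>R e\<close>.\<close>

lemma stratum_step:
  fixes L T N :: "'a::euclidean_space set" and \<sigma> S0 \<psi> :: "'a \<Rightarrow> 'a"
  assumes L: "subspace L" and T: "subspace T"
    and S0: "bounded_linear S0" "\<And>v. v \<in> L \<Longrightarrow> S0 v = v" "\<And>v. norm (S0 v) \<le> K * norm v" "1 \<le> K"
    and \<sigma>: "\<And>u v. u \<in> ball 0 \<eta> \<Longrightarrow> v \<in> ball 0 \<eta> \<Longrightarrow> norm (\<sigma> u - \<sigma> v - S0 (u - v)) \<le> 1/32 * norm (u - v)"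
    and \<sigma>L: "\<And>u. u \<in> ball 0 \<eta> \<Longrightarrow> \<sigma> u \<in> L"
    and z: "z \<in> ball 0 \<eta>" and \<delta>: "K * delta L T \<le> 1/32" and e: "e \<in> L" "norm e = 1"
    and d: "d > 0" and \<psi>: "continuous_on (T \<inter> ball 0 d) \<psi>" "\<psi> 0 = z"
      "\<And>w. w \<in> T \<Longrightarrow> norm w < d \<Longrightarrow> \<psi> w \<in> N" "(\<psi> has_derivative (\<lambda>w. w)) (at 0)"
    and \<rho>: "\<rho> > 0"
  shows "\<exists>s0>0. \<forall>s. 0 < s \<and> s < s0 \<longrightarrow> (\<exists>z'\<in>N \<inter> ball 0 \<eta>. \<sigma> z' = \<sigma> z + s *\<^sub>R e \<and>
     norm (closest_point L z' - closest_point L z - s *\<^sub>R e) \<le> s / 3 \<and>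
     norm ((z' - closest_point L z') - (z - closest_point L z)) \<le> (5/4 * delta L T + \<rho>) * s)"
    (is "\<exists>s0>0. \<forall>s. _ \<longrightarrow> ?claim s")
proof -
  let ?P = "closest_point L" and ?V = "closest_point T" and ?\<delta> = "delta L T"
  have \<delta>0: "0 \<le> ?\<delta>" by (rule delta_nonneg[OF T])
  have \<delta>1: "?\<delta> \<le> 1/32"
  proof -
    have "1 * ?\<delta> \<le> K * ?\<delta>" by (rule mult_right_mono[OF S0(4) \<delta>0])
    then show ?thesis using \<delta> by linarith
  qed
  \<comment> \<open>The relative error allowed to \<psi>: the first bound gives 5/4 * r <= \<rho> at
    the end, the second makes K * (delta L T + r) at most 1/16.\<close>
  define r where "r = min (\<rho> / 2) (1 / (32 * K))"
  have r: "r > 0" "r \<le> \<rho> / 2" "K * r \<le> 1/32" "r \<le> 1/32"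
  proof -
    show "r > 0" using \<rho> S0(4) by (simp add: r_def)
    show "r \<le> \<rho> / 2" by (simp add: r_def)
    have "r \<le> 1 / (32 * K)" by (simp add: r_def)
    then show Kr: "K * r \<le> 1/32" using S0(4) by (simp add: field_simps)
    have "1 * r \<le> K * r" using S0(4) \<open>r > 0\<close> by (intro mult_right_mono) auto
    then show "r \<le> 1/32" using Kr by linarith
  qed
  obtain d' where d': "d' > 0" "\<And>w. norm w < d' \<Longrightarrow> norm (\<psi> w - z - w) \<le> r * norm w"
    using \<psi>(4)[unfolded has_derivative_at_alt, THEN conjunct2, rule_format, OF r(1)] \<psi>(2) by auto
  define s0 where "s0 = min (min d d') (\<eta> - norm z) / 4"
  have s0: "s0 > 0" using d d' z by (simp add: s0_def)
  have "?claim s" if s: "0 < s" "s < s0" for s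
  proof -
    define Q where "Q = L \<inter> cball (s *\<^sub>R e) (s / 4)"
    \<comment> \<open>The point \<open>u \<zeta>\<close> of N approximates z + \<zeta>. Projecting
      \<zeta> onto T costs at most delta L T * norm \<zeta>, and following \<psi> costs at most r *
      norm \<zeta>.\<close>
    define u where "u \<zeta> = \<psi> (?V \<zeta>)" for \<zeta>
    have QL: "\<zeta> \<in> L" and Qn: "norm \<zeta> \<le> 5/4 * s" if "\<zeta> \<in> Q" for \<zeta>
    proof -
      show "\<zeta> \<in> L" using that by (simp add: Q_def)
      have "norm (s *\<^sub>R e - \<zeta>) \<le> s / 4" using that by (simp add: Q_def dist_norm)
      then show "norm \<zeta> \<le> 5/4 * s"
        using norm_triangle_ineq4[of "s *\<^sub>R e" "s *\<^sub>R e - \<zeta>"] e(2) s(1) by simp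
    qed
    have small: "5/4 * s < d" "5/4 * s < d'" "5/2 * s < \<eta> - norm z" using s by (auto simp: s0_def)
    have Vn: "norm (?V \<zeta>) \<le> norm \<zeta>" for \<zeta> by (rule proj_norm[OF T])
    have uN: "u \<zeta> \<in> N" if "\<zeta> \<in> Q" for \<zeta>
      unfolding u_def by (rule \<psi>(3)[OF proj_mem[OF T]]) (use Vn[of \<zeta>] Qn[OF that] small in linarith)
    have u1: "norm (u \<zeta> - z - \<zeta>) \<le> (?\<delta> + r) * norm \<zeta>" if "\<zeta> \<in> Q" for \<zeta>
    proof -
      have "norm (\<psi> (?V \<zeta>) - z - ?V \<zeta>) \<le> r * norm (?V \<zeta>)"
        by (rule d'(2)) (use Vn[of \<zeta>] Qn[OF that] small in linarith)
      also have "\<dots> \<le> r * norm \<zeta>" using Vn r(1) by (intro mult_left_mono) auto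
      finally have 1: "norm (\<psi> (?V \<zeta>) - z - ?V \<zeta>) \<le> r * norm \<zeta>" .
      have 2: "norm (\<zeta> - ?V \<zeta>) \<le> ?\<delta> * norm \<zeta>"
        using infdist_le_delta[OF L T QL[OF that]] unfolding infdist_proj[OF T] .
      have "u \<zeta> - z - \<zeta> = (\<psi> (?V \<zeta>) - z - ?V \<zeta>) - (\<zeta> - ?V \<zeta>)" by (simp add: u_def)
      then have "norm (u \<zeta> - z - \<zeta>) \<le> norm (\<psi> (?V \<zeta>) - z - ?V \<zeta>) + norm (\<zeta> - ?V \<zeta>)"
        using norm_triangle_ineq4 by metis
      then show ?thesis using 1 2 unfolding distrib_right by linarith
    qed
    have u1': "norm (u \<zeta> - z - \<zeta>) \<le> 1/16 * norm \<zeta>" if "\<zeta> \<in> Q" for \<zeta>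
      by (rule order_trans[OF u1[OF that] mult_right_mono]) (use \<delta>1 r in auto)
    have u2: "norm (u \<zeta> - z) \<le> 2 * norm \<zeta>" if "\<zeta> \<in> Q" for \<zeta>
    proof -
      have "norm (u \<zeta> - z) \<le> norm (u \<zeta> - z - \<zeta>) + norm \<zeta>"
        using norm_triangle_ineq[of "u \<zeta> - z - \<zeta>" \<zeta>] by simp
      then show ?thesis using u1'[OF that] norm_ge_zero[of \<zeta>] by linarith
    qed
    have ub: "u \<zeta> \<in> ball 0 \<eta>" if "\<zeta> \<in> Q" for \<zeta>
      using norm_triangle_ineq[of "u \<zeta> - z" z] u2[OF that] Qn[OF that] small(3) by simp
    have u3: "norm (\<sigma> (u \<zeta>) - \<sigma> z - \<zeta>) \<le> s / 4" if "\<zeta> \<in> Q" for \<zeta>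
    proof -
      have "\<sigma> (u \<zeta>) - \<sigma> z - \<zeta> = (\<sigma> (u \<zeta>) - \<sigma> z - S0 (u \<zeta> - z)) + S0 (u \<zeta> - z - \<zeta>)"
        by (simp add: linear_diff[OF bounded_linear.linear[OF S0(1)]] S0(2)[OF QL[OF that]])
      then have "norm (\<sigma> (u \<zeta>) - \<sigma> z - \<zeta>) \<le> norm (\<sigma> (u \<zeta>) - \<sigma> z - S0 (u \<zeta> - z)) + norm (S0 (u \<zeta> - z - \<zeta>))"
        using norm_triangle_ineq by metis
      also have "\<dots> \<le> 1/32 * norm (u \<zeta> - z) + K * norm (u \<zeta> - z - \<zeta>)"
        by (intro add_mono \<sigma> S0(3) ub that z)
      also have "\<dots> \<le> 1/32 * (2 * norm \<zeta>) + K * ((?\<delta> + r) * norm \<zeta>)"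
        using u1[OF that] u2[OF that] S0(4) by (intro add_mono mult_left_mono) auto
      also have "\<dots> = (1/16 + (K * ?\<delta> + K * r)) * norm \<zeta>" by (simp add: algebra_simps)
      also have "\<dots> \<le> 1/8 * norm \<zeta>" by (intro mult_right_mono) (use \<delta> r(3) in auto)
      also have "\<dots> \<le> s / 4" using Qn[OF that] s(1) by simp
      finally show ?thesis .
    qed
    have c\<sigma>: "continuous_on (ball 0 \<eta>) \<sigma>"
      by (rule continuous_on_approx_linear[OF \<sigma> S0(3)]) (use S0(4) in auto)
    have cu: "continuous_on Q u" unfolding u_def
    proof (rule continuous_on_compose2[OF \<psi>(1)])
      show "continuous_on Q ?V" by (rule linear_continuous_on[OF proj_bounded_linear[OF T]])
      show "?V ` Q \<subseteq> T \<inter> ball 0 d"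
      proof
        fix w assume "w \<in> ?V ` Q"
        then obtain \<zeta> where \<zeta>: "\<zeta> \<in> Q" "w = ?V \<zeta>" by blast
        then show "w \<in> T \<inter> ball 0 d" using proj_mem[OF T] Vn[of \<zeta>] Qn[OF \<zeta>(1)] small by simp
      qed
    qed
    have cF: "continuous_on Q (\<lambda>\<zeta>. \<zeta> - (\<sigma> (u \<zeta>) - \<sigma> z) + s *\<^sub>R e)"
      by (intro continuous_intros continuous_on_compose2[OF c\<sigma> cu]) (use ub in blast)
    have compQ: "compact Q" unfolding Q_def
      by (rule closed_Int_compact[OF closed_subspace[OF L] compact_cball])
    have convQ: "convex Q" unfolding Q_def by (intro convex_Int subspace_imp_convex L convex_cball)
    have seL: "s *\<^sub>R e \<in> L" by (rule subspace_scale[OF L e(1)])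
    have neQ: "Q \<noteq> {}" using seL s(1) by (auto simp: Q_def intro!: exI[of _ "s *\<^sub>R e"])
    have maps: "(\<lambda>\<zeta>. \<zeta> - (\<sigma> (u \<zeta>) - \<sigma> z) + s *\<^sub>R e) \<in> Q \<rightarrow> Q"
    proof
      fix \<zeta> assume \<zeta>: "\<zeta> \<in> Q"
      have "\<zeta> - (\<sigma> (u \<zeta>) - \<sigma> z) + s *\<^sub>R e \<in> L"
        by (intro subspace_add[OF L] subspace_diff[OF L] \<sigma>L ub z QL \<zeta> seL)
      moreover have "dist (s *\<^sub>R e) (\<zeta> - (\<sigma> (u \<zeta>) - \<sigma> z) + s *\<^sub>R e) \<le> s / 4"
        using u3[OF \<zeta>] by (simp add: dist_norm algebra_simps)
      ultimately show "\<zeta> - (\<sigma> (u \<zeta>) - \<sigma> z) + s *\<^sub>R e \<in> Q" by (simp add: Q_def)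
    qed
    obtain \<zeta> where \<zeta>: "\<zeta> \<in> Q" "\<zeta> - (\<sigma> (u \<zeta>) - \<sigma> z) + s *\<^sub>R e = \<zeta>"
      by (rule brouwer[OF compQ convQ neQ cF maps])
    have eqfix: "\<sigma> (u \<zeta>) = \<sigma> z + s *\<^sub>R e"
    proof -
      have "\<sigma> z + s *\<^sub>R e = \<sigma> (u \<zeta>) + ((\<zeta> - (\<sigma> (u \<zeta>) - \<sigma> z) + s *\<^sub>R e) - \<zeta>)" by simp
      then show ?thesis unfolding \<zeta>(2) by simp
    qed
    note lP = proj_linear[OF L]
    have P\<zeta>: "?P \<zeta> = \<zeta>" by (rule proj_id[OF L QL[OF \<zeta>(1)]])
    have eqP: "?P (u \<zeta>) - ?P z - s *\<^sub>R e = ?P (u \<zeta> - z - \<zeta>) + (\<zeta> - s *\<^sub>R e)"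
      by (simp add: linear_diff[OF lP] P\<zeta>)
    have "norm (?P (u \<zeta>) - ?P z - s *\<^sub>R e) \<le> norm (u \<zeta> - z - \<zeta>) + norm (\<zeta> - s *\<^sub>R e)"
      unfolding eqP by (rule order_trans[OF norm_triangle_ineq]) (simp add: proj_norm[OF L])
    moreover have "norm (\<zeta> - s *\<^sub>R e) \<le> s / 4" using \<zeta>(1) by (simp add: Q_def dist_norm norm_minus_commute)
    \<comment> \<open>The two errors are 1/16 * 5/4 * s and s / 4; their sum 21/64 * s is below s /
      3.\<close>
    ultimately have cone: "norm (?P (u \<zeta>) - ?P z - s *\<^sub>R e) \<le> s / 3"
      using u1'[OF \<zeta>(1)] Qn[OF \<zeta>(1)] s(1) by linarith
    have eqn: "(u \<zeta> - ?P (u \<zeta>)) - (z - ?P z) = (u \<zeta> - z - \<zeta>) - ?P (u \<zeta> - z - \<zeta>)"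
      by (simp add: linear_diff[OF lP] P\<zeta>)
    have "norm ((u \<zeta> - ?P (u \<zeta>)) - (z - ?P z)) \<le> norm (u \<zeta> - z - \<zeta>)"
      unfolding eqn by (rule proj_compl_norm[OF L])
    also have "\<dots> \<le> (?\<delta> + r) * (5/4 * s)"
      by (rule order_trans[OF u1[OF \<zeta>(1)] mult_left_mono[OF Qn[OF \<zeta>(1)]]]) (use \<delta>0 r(1) in simp)
    also have "\<dots> = (5/4 * ?\<delta> + 5/4 * r) * s" by (simp add: algebra_simps)
    also have "\<dots> \<le> (5/4 * ?\<delta> + \<rho>) * s" by (intro mult_right_mono) (use r s(1) \<rho> in auto)
    finally show ?thesis using eqfix cone uN[OF \<zeta>(1)] ub[OF \<zeta>(1)] by blast
  qed
  then show ?thesis using s0 by blast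
qed

text \<open>This transitivity replaces Gronwall's inequality: no integral curves are needed.\<close>

lemma exp_increment_trans:
  fixes a b c :: "'a::real_normed_vector"
  assumes "norm (b - a) \<le> norm a * (exp x - 1)" "norm (c - b) \<le> norm b * (exp y - 1)" "b \<noteq> 0"
  shows "norm (c - a) \<le> norm a * (exp (x + y) - 1)"
proof -
  have nb: "norm b \<le> norm a * exp x"
    using assms(1) norm_triangle_ineq[of a "b - a"] by (simp add: algebra_simps)
  have "0 \<le> norm b * (exp y - 1)" by (rule order_trans[OF norm_ge_zero assms(2)])
  then have y: "0 \<le> exp y - 1" using assms(3) by (simp add: zero_le_mult_iff)
  have "norm (c - a) \<le> norm (b - a) + norm (c - b)"
    using norm_triangle_ineq[of "b - a" "c - b"] by simp
  also have "\<dots> \<le> norm a * (exp x - 1) + norm a * exp x * (exp y - 1)"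
    using assms(1) order_trans[OF assms(2) mult_right_mono[OF nb y]] by linarith
  also have "\<dots> = norm a * (exp (x + y) - 1)" by (simp add: exp_add algebra_simps)
  finally show ?thesis .
qed

text \<open>Steps accumulate until \<open>\<sigma>\<close> has moved by \<open>T\<close> or the point has left \<open>N\<close> for its frontier
  \<open>A - N\<close>.  The sign \<open>\<iota>\<close> tells whether the radius \<open>norm (P z)\<close> grows or shrinks on the way; the radius
  has to be monotone because the rate is controlled only as a function of it.\<close>

lemma stratum_phase:
  fixes L N A :: "'a::euclidean_space set" and \<sigma> :: "'a \<Rightarrow> 'a" and R :: "real \<Rightarrow> real" and D :: "'a \<Rightarrow> real"
  defines "P \<equiv> closest_point L"
  assumes L: "subspace L" and NA: "N \<subseteq> A"
    and A: "\<And>s z. (\<And>i::nat. s i \<in> A) \<Longrightarrow> s \<longlonglongrightarrow> z \<Longrightarrow> z \<in> ball 0 \<eta> \<Longrightarrow> P z \<noteq> z \<Longrightarrow> z \<in> A"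
    and A0: "\<And>z. z \<in> A \<Longrightarrow> z \<in> ball 0 \<eta> \<Longrightarrow> P z \<noteq> z"
    and step: "\<And>z \<rho>. z \<in> N \<Longrightarrow> z \<in> ball 0 \<eta> \<Longrightarrow> \<rho> > 0 \<Longrightarrow> \<exists>s0>0. \<forall>s. 0 < s \<and> s < s0 \<longrightarrow>
      (\<exists>z'\<in>N \<inter> ball 0 \<eta>. \<sigma> z' = \<sigma> z + s *\<^sub>R e \<and> norm (P z' - P z - s *\<^sub>R e) \<le> s / 3 \<and>
      norm ((z' - P z') - (z - P z)) \<le> (5/4 * D z + \<rho>) * s)"
    and D: "\<And>z. z \<in> N \<Longrightarrow> 0 \<le> D z"
    and R: "continuous_on UNIV R" "mono R"
    and rate: "\<And>z. z \<in> N \<Longrightarrow> z \<in> ball 0 \<eta> \<Longrightarrow> \<exists>d>0. \<forall>t. \<bar>t - norm (P z)\<bar> < d \<longrightarrow>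
      (D z / norm (z - P z) + 1) * \<bar>t - norm (P z)\<bar> \<le> \<bar>R t - R (norm (P z))\<bar>"
    and \<sigma>: "continuous_on (ball 0 \<eta>) \<sigma>" and e: "norm e = 1"
    and \<iota>: "\<iota> = 1 \<or> \<iota> = (-1 :: real)"
    and radial: "\<And>z z' s s'. z \<in> ball 0 \<eta> \<Longrightarrow> z' \<in> ball 0 \<eta> \<Longrightarrow> 0 \<le> s \<Longrightarrow> s \<le> s' \<Longrightarrow> s' \<le> T \<Longrightarrow>
      \<sigma> z = \<sigma> z0 + s *\<^sub>R e \<Longrightarrow> \<sigma> z' = \<sigma> z0 + s' *\<^sub>R e \<Longrightarrow> norm (P z - P z0 - s *\<^sub>R e) \<le> s / 3 \<Longrightarrow>
      norm (P z' - P z - (s' - s) *\<^sub>R e) \<le> (s' - s) / 3 \<Longrightarrow>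
      (s' - s) / 6 \<le> \<iota> * (norm (P z') - norm (P z))"
    and z0: "z0 \<in> A" and T: "0 \<le> T"
    and small: "exp (8 * (R \<eta> - R 0)) < 2"
    and room: "norm z0 + 2 * T + norm (z0 - P z0) * (exp (8 * (R \<eta> - R 0)) - 1) < \<eta>"
  shows "\<exists>z. z \<in> A \<and> z \<in> ball 0 \<eta> \<and> (\<sigma> z = \<sigma> z0 + T *\<^sub>R e \<or> z \<notin> N) \<and>
    norm ((z - P z) - (z0 - P z0)) \<le> norm (z0 - P z0) * (exp (8 * (R \<eta> - R 0)) - 1) \<and>
    norm (z - z0) \<le> 2 * T + norm (z0 - P z0) * (exp (8 * (R \<eta> - R 0)) - 1)"
proof -
  define n where "n z = z - P z" for z
  \<comment> \<open>The factor is 8 = 6 * 4/3: during a step of length s the radius changes by at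
    least s / 6, while the normal part changes by at most 4/3 * (D z + norm (n z)) * s.\<close>
  define \<Lambda> where "\<Lambda> z = 8 * (\<iota> * R (norm (P z)))" for z
  define B where "B = norm (n z0) * (exp (8 * (R \<eta> - R 0)) - 1)"
  note lP = proj_linear[OF L, folded P_def]
  have Pn: "norm (P v) \<le> norm v" for v unfolding P_def by (rule proj_norm[OF L])
  have cP: "continuous_on UNIV P" unfolding P_def by (rule linear_continuous_on[OF proj_bounded_linear[OF L]])
  have \<eta>: "0 < \<eta>"
  proof -
    show ?thesis
    proof (rule ccontr)
      assume neg: "\<not> 0 < \<eta>"
      have "norm (z0 - P z0) \<le> norm z0" unfolding P_def by (rule proj_compl_norm[OF L])
      moreover have "- 1 \<le> exp (8 * (R \<eta> - R 0)) - 1" by simp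
      then have "norm (z0 - P z0) * (- 1) \<le> norm (z0 - P z0) * (exp (8 * (R \<eta> - R 0)) - 1)"
        by (rule mult_left_mono) simp
      ultimately show False using room T neg by linarith
    qed
  qed
  define valid where "valid x \<longleftrightarrow> 0 \<le> fst x \<and> fst x \<le> T \<and> snd x \<in> A \<and> snd x \<in> ball 0 \<eta> \<and> \<sigma> (snd x) = \<sigma> z0 + fst x *\<^sub>R e"
    for x :: "real \<times> 'a"
  define lee where "lee x y \<longleftrightarrow> fst x \<le> fst y \<and> norm (P (snd y) - P (snd x) - (fst y - fst x) *\<^sub>R e) \<le> (fst y - fst x) / 3 \<and>
      norm (n (snd y) - n (snd x)) \<le> norm (n (snd x)) * (exp (\<Lambda> (snd y) - \<Lambda> (snd x)) - 1)" for x y :: "real \<times> 'a"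
  \<comment> \<open>Validity of the intermediate pair provides the nonzero normal part required by
    \<open>exp_increment_trans\<close>. The alternative of equality makes \<open>le\<close>
    reflexive at invalid pairs as well.\<close>
  define le where "le x y \<longleftrightarrow> x = y \<or> valid x \<and> valid y \<and> lee x y" for x y
  have n0: "n (snd x) \<noteq> 0" if "valid x" for x
  proof -
    have "P (snd x) \<noteq> snd x" using A0 that unfolding valid_def by blast
    then show ?thesis unfolding n_def by (metis right_minus_eq)
  qed
  have lee_trans: "lee x w" if "lee x y" "lee y w" "valid y" for x y w
  proof -
    have "P (snd w) - P (snd x) - (fst w - fst x) *\<^sub>R e
      = (P (snd w) - P (snd y) - (fst w - fst y) *\<^sub>R e) + (P (snd y) - P (snd x) - (fst y - fst x) *\<^sub>R e)"
      by (simp add: algebra_simps)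
    then have "norm (P (snd w) - P (snd x) - (fst w - fst x) *\<^sub>R e) \<le>
      norm (P (snd w) - P (snd y) - (fst w - fst y) *\<^sub>R e) + norm (P (snd y) - P (snd x) - (fst y - fst x) *\<^sub>R e)"
      using norm_triangle_ineq by metis
    moreover have thirds: "(a::real) \<le> (w - x) / 3" if "a \<le> b + c" "b \<le> (w - y) / 3" "c \<le> (y - x) / 3" for a b c w x y
      using that by (simp add: field_simps)
    ultimately have "norm (P (snd w) - P (snd x) - (fst w - fst x) *\<^sub>R e) \<le> (fst w - fst x) / 3"
      using that unfolding lee_def by blast
    moreover have "norm (n (snd w) - n (snd x)) \<le> norm (n (snd x)) *
        (exp ((\<Lambda> (snd y) - \<Lambda> (snd x)) + (\<Lambda> (snd w) - \<Lambda> (snd y))) - 1)"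
      by (rule exp_increment_trans[of "n (snd y)"]) (use that n0[OF that(3)] in \<open>auto simp: lee_def\<close>)
    ultimately show ?thesis using that by (simp add: lee_def)
  qed
  \<comment> \<open>For either sign \<iota> the change of \<Lambda> is bounded by the total
    variation of the monotone R over the radii from 0 to \<eta>.\<close>
  have R_range: "\<Lambda> z' - \<Lambda> z \<le> 8 * (R \<eta> - R 0)" if "z \<in> ball 0 \<eta>" "z' \<in> ball 0 \<eta>" for z z'
  proof -
    have "R 0 \<le> R (norm (P z)) \<and> R (norm (P z)) \<le> R \<eta>" "R 0 \<le> R (norm (P z')) \<and> R (norm (P z')) \<le> R \<eta>"
      using that Pn[of z] Pn[of z'] by (auto intro!: monoD[OF R(2)])
    then show ?thesis using \<iota> by (auto simp: \<Lambda>_def)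
  qed
  have bounds: "norm (n (snd y) - n z0) \<le> B \<and> norm (snd y - z0) \<le> 2 * T + B" if "lee (0, z0) y" "valid y" "valid (0, z0)" for y
  proof -
    have 1: "norm (n (snd y) - n z0) \<le> norm (n z0) * (exp (\<Lambda> (snd y) - \<Lambda> z0) - 1)"
      using that(1) by (simp add: lee_def)
    also have "\<dots> \<le> B" unfolding B_def
      by (intro mult_left_mono diff_right_mono iffD2[OF exp_le_cancel_iff] R_range) (use that in \<open>auto simp: valid_def\<close>)
    finally have nB: "norm (n (snd y) - n z0) \<le> B" .
    have "norm (P (snd y) - P z0) \<le> 4/3 * fst y"
    proof -
      have "norm (P (snd y) - P z0) \<le> norm (P (snd y) - P z0 - fst y *\<^sub>R e) + norm (fst y *\<^sub>R e)"
        using norm_triangle_ineq[of "P (snd y) - P z0 - fst y *\<^sub>R e" "fst y *\<^sub>R e"] by simp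
      then show ?thesis using that e by (simp add: lee_def valid_def)
    qed
    moreover have "snd y - z0 = (P (snd y) - P z0) + (n (snd y) - n z0)" by (simp add: n_def)
    then have "norm (snd y - z0) \<le> norm (P (snd y) - P z0) + norm (n (snd y) - n z0)"
      using norm_triangle_ineq by metis
    ultimately show ?thesis using nB that(2) T by (auto simp: valid_def)
  qed
  have B0: "0 \<le> B"
    unfolding B_def using monoD[OF R(2), of 0 \<eta>] \<eta> by (intro mult_nonneg_nonneg) auto
  have v0: "valid (0, z0)"
    using z0 T room B0 by (auto simp: valid_def B_def n_def)
  obtain m where m: "le (0, z0) m" "\<And>y. le m y \<Longrightarrow> fst y = fst m"
  proof (rule preorder_maximal_progress[of le fst "(0, z0)" T])
    show "le x x" for x by (simp add: le_def)
    show "le x w" if "le x y" "le y w" for x y w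
      using that lee_trans unfolding le_def by blast
    show "fst x \<le> fst y" if "le x y" for x y using that by (auto simp: le_def lee_def)
    show "fst y \<le> T" if "le (0, z0) y" for y using that v0 by (auto simp: le_def valid_def)
    show "\<exists>u. \<forall>k. le (s k) u" if s: "s 0 = (0, z0)" "\<And>k. le (s k) (s (Suc k))" for s :: "nat \<Rightarrow> real \<times> 'a"
    proof -
      have letr: "le x w" if "le x y" "le y w" for x y w
        using that lee_trans unfolding le_def by blast
      have ij: "le (s i) (s j)" if "i \<le> j" for i j
        using that
      proof (induction j rule: dec_induct)
        case base then show ?case by (simp add: le_def)
      next
        case (step j) then show ?case using letr s(2) by blast
      qed
      have val: "valid (s i)" for i
        using ij[of 0 i] s(1) v0 by (auto simp: le_def)
      have lee_refl: "lee x x" for x by (simp add: lee_def)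
      have lij: "lee (s i) (s j)" if "i \<le> j" for i j
        using ij[OF that] lee_refl[of "s j"] unfolding le_def by (elim disjE conjE) simp_all
      define t where "t i = fst (s i)" for i
      define z where "z i = snd (s i)" for i
      have "incseq t" unfolding incseq_def t_def using lij by (auto simp: lee_def)
      moreover have "t i \<le> T" for i using val[of i] by (simp add: valid_def t_def)
      ultimately obtain t1 where t1: "t \<longlonglongrightarrow> t1" "\<And>i. t i \<le> t1" using incseq_convergent by metis
      define \<nu> where "\<nu> i = \<Lambda> (z i)" for i
      have zb: "z i \<in> ball 0 \<eta>" for i using val[of i] by (simp add: valid_def z_def)
      \<comment> \<open>The exponential bound dominates a norm and has a positive factor norm (n (z
        i)), so its exponent cannot be negative.\<close>
      have "incseq \<nu>" unfolding incseq_def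
      proof (intro allI impI)
        fix i j :: nat assume "i \<le> j"
        then have "norm (n (z j) - n (z i)) \<le> norm (n (z i)) * (exp (\<nu> j - \<nu> i) - 1)"
          using lij by (auto simp: lee_def z_def \<nu>_def)
        then have "0 \<le> norm (n (z i)) * (exp (\<nu> j - \<nu> i) - 1)" by (rule order_trans[OF norm_ge_zero])
        then have "0 \<le> exp (\<nu> j - \<nu> i) - 1" using n0[OF val[of i]] by (simp add: z_def zero_le_mult_iff)
        then show "\<nu> i \<le> \<nu> j" by simp
      qed
      moreover have "\<nu> i \<le> \<Lambda> z0 + 8 * (R \<eta> - R 0)" for i
        using R_range[of z0 "z i"] zb[of i] v0 by (simp add: \<nu>_def valid_def)
      ultimately obtain \<nu>1 where \<nu>1: "\<nu> \<longlonglongrightarrow> \<nu>1" "\<And>i. \<nu> i \<le> \<nu>1" using incseq_convergent by metis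
      define C where "C = norm (n z0) + B"
      have nC: "norm (n (z i)) \<le> C" for i
        using bounds[of "s i"] lij[of 0 i] s(1) val[of i] v0 norm_triangle_ineq[of "n (z i) - n z0" "n z0"]
        by (simp add: C_def z_def)
      have C0: "0 \<le> C" using B0 by (simp add: C_def)
      \<comment> \<open>Increments of z are dominated by those of the bounded increasing sequences t
        and \<nu>, so z is Cauchy and the chain acquires a limit point.\<close>
      have dz: "dist (z i) (z j) \<le> 4/3 * (t1 - t i) + C * (exp (\<nu>1 - \<nu> i) - 1)" if "i \<le> j" for i j
      proof -
        have l: "norm (P (z j) - P (z i) - (t j - t i) *\<^sub>R e) \<le> (t j - t i) / 3"
          "norm (n (z j) - n (z i)) \<le> norm (n (z i)) * (exp (\<nu> j - \<nu> i) - 1)" "t i \<le> t j"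
          using lij[OF that] by (auto simp: lee_def z_def \<nu>_def t_def)
        have "norm (P (z j) - P (z i)) \<le> norm (P (z j) - P (z i) - (t j - t i) *\<^sub>R e) + norm ((t j - t i) *\<^sub>R e)"
          using norm_triangle_ineq[of "P (z j) - P (z i) - (t j - t i) *\<^sub>R e" "(t j - t i) *\<^sub>R e"] by simp
        then have 1: "norm (P (z j) - P (z i)) \<le> 4/3 * (t1 - t i)" using l e t1(2)[of j] by simp
        have "norm (n (z i)) * (exp (\<nu> j - \<nu> i) - 1) \<le> C * (exp (\<nu>1 - \<nu> i) - 1)"
          by (rule mult_mono) (use nC C0 \<nu>1(2)[of j] \<open>incseq \<nu>\<close>[THEN incseqD, OF that] in auto)
        then have 2: "norm (n (z j) - n (z i)) \<le> C * (exp (\<nu>1 - \<nu> i) - 1)" using l by linarith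
        have "z j - z i = (P (z j) - P (z i)) + (n (z j) - n (z i))" by (simp add: n_def)
        then have "norm (z j - z i) \<le> norm (P (z j) - P (z i)) + norm (n (z j) - n (z i))"
          using norm_triangle_ineq by metis
        moreover have "dist (z i) (z j) = norm (z j - z i)" by (simp add: dist_norm norm_minus_commute)
        ultimately show ?thesis using 1 2 by linarith
      qed
      have lim0: "(\<lambda>i. 4/3 * (t1 - t i) + C * (exp (\<nu>1 - \<nu> i) - 1)) \<longlonglongrightarrow> 4/3 * (t1 - t1) + C * (exp (\<nu>1 - \<nu>1) - 1)"
        by (intro tendsto_intros t1 \<nu>1)
      have "Cauchy z"
      proof (rule metric_CauchyI)
        fix r :: real assume "0 < r"
        then have "\<forall>\<^sub>F i in sequentially. 4/3 * (t1 - t i) + C * (exp (\<nu>1 - \<nu> i) - 1) < r / 2"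
          using order_tendstoD(2)[OF lim0, of "r / 2"] by simp
        then obtain M where M: "4/3 * (t1 - t M) + C * (exp (\<nu>1 - \<nu> M) - 1) < r / 2"
          unfolding eventually_sequentially by blast
        have "dist (z i) (z j) < r" if "M \<le> i" "M \<le> j" for i j
          using dz[OF that(1)] dz[OF that(2)] M dist_triangle3[of "z i" "z j" "z M"] by linarith
        then show "\<exists>M. \<forall>m\<ge>M. \<forall>n\<ge>M. dist (z m) (z n) < r" by blast
      qed
      then obtain z1 where z1: "z \<longlonglongrightarrow> z1" using Cauchy_convergent convergent_def by blast
      have limP: "(\<lambda>i. P (z i)) \<longlonglongrightarrow> P z1"
        unfolding P_def by (rule bounded_linear.tendsto[OF proj_bounded_linear[OF L] z1])
      have limn: "(\<lambda>i. n (z i)) \<longlonglongrightarrow> n z1" unfolding n_def by (intro tendsto_intros z1 limP)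
      have limR: "(\<lambda>i. R (norm (P (z i)))) \<longlonglongrightarrow> R (norm (P z1))"
        by (rule isCont_tendsto_compose[OF _ tendsto_norm[OF limP]]) (use R(1) in \<open>simp add: continuous_on_eq_continuous_at\<close>)
      have lim\<Lambda>: "(\<lambda>i. \<Lambda> (z i)) \<longlonglongrightarrow> \<Lambda> z1" unfolding \<Lambda>_def by (intro tendsto_intros limR)
      have close: "norm (z1 - z0) \<le> 2 * T + B"
      proof (rule LIMSEQ_le_const2[OF tendsto_norm[OF tendsto_diff[OF z1 tendsto_const]]])
        show "\<exists>M. \<forall>i\<ge>M. norm (z i - z0) \<le> 2 * T + B"
          using bounds lij[of 0] s(1) val v0 by (auto simp: z_def)
      qed
      have z1b: "z1 \<in> ball 0 \<eta>"
        using close room norm_triangle_ineq[of "z1 - z0" z0] by (simp add: B_def n_def)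
      \<comment> \<open>By \<open>small\<close> the normal part changes by less than its initial
        length, so it does not vanish in the limit. Thus z1 lies off L, where A is closed.\<close>
      have "norm (n z1 - n z0) \<le> B"
      proof (rule LIMSEQ_le_const2[OF tendsto_norm[OF tendsto_diff[OF limn tendsto_const]]])
        show "\<exists>M. \<forall>i\<ge>M. norm (n (z i) - n z0) \<le> B"
          using bounds lij[of 0] s(1) val v0 by (auto simp: z_def)
      qed
      moreover have "B < norm (n z0)"
      proof -
        have "n z0 \<noteq> 0" using n0[OF v0] by simp
        then have "B < norm (n z0) * 1" unfolding B_def using small by (intro mult_strict_left_mono) auto
        then show ?thesis by simp
      qed
      ultimately have "n z1 \<noteq> 0" by auto
      then have "P z1 \<noteq> z1" by (simp add: n_def)
      then have z1A: "z1 \<in> A" using A[OF _ z1 z1b] val by (auto simp: valid_def z_def)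
      have "(\<lambda>i. \<sigma> (z i)) \<longlonglongrightarrow> \<sigma> z1"
        by (rule isCont_tendsto_compose[OF _ z1]) (use \<sigma> z1b in \<open>simp add: continuous_on_eq_continuous_at\<close>)
      moreover have "(\<lambda>i. \<sigma> (z i)) = (\<lambda>i. \<sigma> z0 + t i *\<^sub>R e)" using val by (auto simp: valid_def z_def t_def)
      moreover have "(\<lambda>i. \<sigma> z0 + t i *\<^sub>R e) \<longlonglongrightarrow> \<sigma> z0 + t1 *\<^sub>R e" by (intro tendsto_intros t1)
      ultimately have \<sigma>1: "\<sigma> z1 = \<sigma> z0 + t1 *\<^sub>R e" using LIMSEQ_unique by metis
      have t1T: "t1 \<le> T" by (rule LIMSEQ_le_const2[OF t1(1)]) (use val in \<open>auto simp: valid_def t_def\<close>)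
      have t10: "0 \<le> t1" using t1(2)[of 0] s(1) by (simp add: t_def)
      have v1: "valid (t1, z1)" using z1b z1A \<sigma>1 t1T t10 by (simp add: valid_def)
      have "lee (s i) (t1, z1)" for i
      proof -
        have "norm (P z1 - P (z i) - (t1 - t i) *\<^sub>R e) \<le> (t1 - t i) / 3"
        proof (rule LIMSEQ_le)
          show "(\<lambda>j. norm (P (z j) - P (z i) - (t j - t i) *\<^sub>R e)) \<longlonglongrightarrow> norm (P z1 - P (z i) - (t1 - t i) *\<^sub>R e)"
            by (intro tendsto_intros limP t1(1))
          show "(\<lambda>j. (t j - t i) / 3) \<longlonglongrightarrow> (t1 - t i) / 3"
            by (intro tendsto_intros t1(1)) simp
          show "\<exists>M. \<forall>j\<ge>M. norm (P (z j) - P (z i) - (t j - t i) *\<^sub>R e) \<le> (t j - t i) / 3"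
            using lij unfolding lee_def z_def t_def by blast
        qed
        moreover have "norm (n z1 - n (z i)) \<le> norm (n (z i)) * (exp (\<Lambda> z1 - \<Lambda> (z i)) - 1)"
        proof (rule LIMSEQ_le)
          show "(\<lambda>j. norm (n (z j) - n (z i))) \<longlonglongrightarrow> norm (n z1 - n (z i))"
            by (intro tendsto_intros limn)
          show "(\<lambda>j. norm (n (z i)) * (exp (\<Lambda> (z j) - \<Lambda> (z i)) - 1))
              \<longlonglongrightarrow> norm (n (z i)) * (exp (\<Lambda> z1 - \<Lambda> (z i)) - 1)"
            by (intro tendsto_intros lim\<Lambda>)
          show "\<exists>M. \<forall>j\<ge>M. norm (n (z j) - n (z i)) \<le> norm (n (z i)) * (exp (\<Lambda> (z j) - \<Lambda> (z i)) - 1)"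
            using lij unfolding lee_def z_def by blast
        qed
        ultimately show ?thesis using t1(2)[of i] by (simp add: lee_def z_def t_def)
      qed
      then have "\<forall>k. le (s k) (t1, z1)" using val v1 by (simp add: le_def)
      then show ?thesis by blast
    qed
  qed (rule that)
  have vm: "valid m" using m(1) v0 by (auto simp: le_def)
  have lm: "lee (0, z0) m" using m(1) by (auto simp: le_def lee_def)
  define s where "s = fst m"
  define z where "z = snd m"
  have z: "z \<in> A" "z \<in> ball 0 \<eta>" "\<sigma> z = \<sigma> z0 + s *\<^sub>R e" "0 \<le> s" "s \<le> T"
    using vm by (auto simp: valid_def s_def z_def)
  \<comment> \<open>A maximal pair that is still in N before parameter T could be advanced by one
    more step, contradicting maximality.\<close>
  have "s = T \<or> z \<notin> N"
  proof (rule ccontr)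
    assume "\<not> ?thesis"
    then have sT: "s < T" and zN: "z \<in> N" using z(5) by auto
    have nz: "norm (n z) > 0" using n0[OF vm] by (simp add: z_def)
    \<comment> \<open>The tolerance \<rho> is chosen as norm (n z): relative to norm (n z) it
      contributes 1 to the rate, which the + 1 in the slope of R covers.\<close>
    obtain s0 where s0: "s0 > 0" "\<And>s. 0 < s \<Longrightarrow> s < s0 \<Longrightarrow>
      (\<exists>z'\<in>N \<inter> ball 0 \<eta>. \<sigma> z' = \<sigma> z + s *\<^sub>R e \<and> norm (P z' - P z - s *\<^sub>R e) \<le> s / 3 \<and>
      norm ((z' - P z') - (z - P z)) \<le> (5/4 * D z + norm (n z)) * s)"
      using step[OF zN z(2) nz] by blast
    obtain d where d: "d > 0" "\<And>t. \<bar>t - norm (P z)\<bar> < d \<Longrightarrow>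
      (D z / norm (n z) + 1) * \<bar>t - norm (P z)\<bar> \<le> \<bar>R t - R (norm (P z))\<bar>"
      using rate[OF zN z(2)] unfolding n_def by blast
    define q where "q = min (min s0 (T - s)) d / 2"
    have q: "0 < q" "q < s0" "q \<le> T - s" "4/3 * q < d"
    proof -
      have "q \<le> d / 2" by (simp add: q_def)
      then show "4/3 * q < d" using d(1) by linarith
    qed (use s0(1) sT d(1) in \<open>auto simp: q_def\<close>)
    obtain z' where z': "z' \<in> N" "z' \<in> ball 0 \<eta>" "\<sigma> z' = \<sigma> z + q *\<^sub>R e" "norm (P z' - P z - q *\<^sub>R e) \<le> q / 3"
      "norm (n z' - n z) \<le> (5/4 * D z + norm (n z)) * q"
      using s0(2)[OF q(1,2)] unfolding n_def by blast
    have pz: "norm (P z - P z0 - s *\<^sub>R e) \<le> s / 3" using lm by (simp add: lee_def z_def s_def)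
    have \<sigma>z': "\<sigma> z' = \<sigma> z0 + (s + q) *\<^sub>R e" using z'(3) z(3) by (simp add: scaleR_add_left)
    have rad: "q / 6 \<le> \<iota> * (norm (P z') - norm (P z))"
      using radial[OF z(2) z'(2) z(4) _ _ z(3) \<sigma>z' pz] q z'(4) by simp
    have "\<bar>norm (P z') - norm (P z)\<bar> \<le> norm (P z' - P z)" by (rule norm_triangle_ineq3)
    also have "\<dots> \<le> norm (P z' - P z - q *\<^sub>R e) + norm (q *\<^sub>R e)"
      using norm_triangle_ineq[of "P z' - P z - q *\<^sub>R e" "q *\<^sub>R e"] by simp
    also have "\<dots> < d" using z'(4) q e by simp
    finally have rt: "(D z / norm (n z) + 1) * \<bar>norm (P z') - norm (P z)\<bar> \<le> \<bar>R (norm (P z')) - R (norm (P z))\<bar>"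
      by (rule d(2))
    have ab: "q / 6 \<le> \<bar>norm (P z') - norm (P z)\<bar>"
    proof -
      have "\<iota> * x \<le> \<bar>x\<bar>" for x using \<iota> abs_ge_self[of x] abs_ge_minus_self[of x] by (elim disjE) simp_all
      then show ?thesis by (rule order_trans[OF rad])
    qed
    have sg: "\<bar>R (norm (P z')) - R (norm (P z))\<bar> = \<iota> * (R (norm (P z')) - R (norm (P z)))"
      using rad \<iota> q(1) monoD[OF R(2), of "norm (P z)" "norm (P z')"] monoD[OF R(2), of "norm (P z')" "norm (P z)"] by auto
    have D1: "0 \<le> D z / norm (n z) + 1" using D[OF zN] by (simp add: add_nonneg_nonneg)
    have "(D z / norm (n z) + 1) * (q / 6) \<le> \<iota> * (R (norm (P z')) - R (norm (P z)))"
      using order_trans[OF mult_left_mono[OF ab D1] rt] unfolding sg .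
    have lam: "8 * ((D z / norm (n z) + 1) * (q / 6)) \<le> \<Lambda> z' - \<Lambda> z"
    proof -
      have "\<Lambda> z' - \<Lambda> z = 8 * (\<iota> * (R (norm (P z')) - R (norm (P z))))"
        by (simp add: \<Lambda>_def right_diff_distrib)
      then show ?thesis
        using \<open>(D z / norm (n z) + 1) * (q / 6) \<le> \<iota> * (R (norm (P z')) - R (norm (P z)))\<close> by linarith
    qed
    \<comment> \<open>Both coefficients 5/4 and 1 are enlarged to 4/3 to factor out the rate;
      afterwards x <= exp x - 1 brings the bound into its transitive form.\<close>
    have "norm (n z' - n z) \<le> (4/3 * D z + 4/3 * norm (n z)) * q"
      by (rule order_trans[OF z'(5) mult_right_mono]) (use D[OF zN] q(1) nz in linarith)+
    also have "\<dots> = norm (n z) * (8 * ((D z / norm (n z) + 1) * (q / 6)))" using nz by (simp add: field_simps)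
    also have "\<dots> \<le> norm (n z) * (\<Lambda> z' - \<Lambda> z)" by (rule mult_left_mono[OF lam]) simp
    also have "\<dots> \<le> norm (n z) * (exp (\<Lambda> z' - \<Lambda> z) - 1)"
    proof (rule mult_left_mono)
      show "\<Lambda> z' - \<Lambda> z \<le> exp (\<Lambda> z' - \<Lambda> z) - 1"
        using exp_ge_add_one_self[of "\<Lambda> z' - \<Lambda> z"] by linarith
    qed simp
    finally have "lee m (s + q, z')"
      using z'(4) q(1) by (simp add: lee_def s_def z_def)
    moreover have "valid (s + q, z')" using z' q z \<sigma>z' NA by (auto simp: valid_def)
    ultimately have "le m (s + q, z')" using vm by (simp add: le_def)
    then show False using m(2) q(1) by (fastforce simp: s_def)
  qed
  then have "\<sigma> z = \<sigma> z0 + T *\<^sub>R e \<or> z \<notin> N" using z(3) by auto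
  then show ?thesis using z(1,2) bounds[OF lm vm v0] unfolding z_def[symmetric] B_def n_def by blast
qed

section \<open>Transport inside one stratum\<close>

text \<open>As p lies in the cone about e, its inner product with e is at least norm p / 2. The
  increment of p therefore has inner product at least (1/2 - 1/3) * (s' - s) * norm p with p, and
  Cauchy-Schwarz turns this into growth of the norm. For p = 0 also s = 0.\<close>

lemma norm_increase_in_cone:
  fixes p p' e :: "'a::real_inner"
  assumes e: "norm e = 1" and s: "0 \<le> s" "s \<le> s'"
    and p: "norm (p - s *\<^sub>R e) \<le> s / 3" and p': "norm (p' - p - (s' - s) *\<^sub>R e) \<le> (s' - s) / 3"
  shows "(s' - s) / 6 \<le> norm p' - norm p"
proof (cases "p = 0")
  case True
  then have "s = 0" using p e s by simp
  then show ?thesis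
    using True p' e s norm_triangle_ineq2[of "s' *\<^sub>R e" "s' *\<^sub>R e - p'"] by (simp add: norm_minus_commute)
next
  case False
  define a where "a = p - s *\<^sub>R e"
  define b where "b = p' - p - (s' - s) *\<^sub>R e"
  have ee: "e \<bullet> e = 1" using e by (simp add: dot_square_norm)
  have "\<bar>e \<bullet> a\<bar> \<le> s / 3" using Cauchy_Schwarz_ineq2[of e a] p e by (simp add: a_def)
  moreover have "e \<bullet> p = s + e \<bullet> a" by (simp add: a_def inner_diff_right ee)
  ultimately have ep: "2/3 * s \<le> e \<bullet> p" by linarith
  have "norm p \<le> norm a + norm (s *\<^sub>R e)" unfolding a_def using norm_triangle_ineq[of "p - s *\<^sub>R e" "s *\<^sub>R e"] by simp
  then have "norm p \<le> 4/3 * s" using p e s by (simp add: a_def)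
  then have ep2: "norm p / 2 \<le> e \<bullet> p" using ep by linarith
  have "b \<bullet> p \<ge> - ((s' - s) / 3 * norm p)"
    using Cauchy_Schwarz_ineq2[of b p] mult_right_mono[OF p' norm_ge_zero[of p]] by (simp add: b_def)
  moreover have "p' \<bullet> p = p \<bullet> p + (s' - s) * (e \<bullet> p) + b \<bullet> p"
    by (simp add: b_def inner_diff_left)
  moreover have "(s' - s) * (norm p / 2) \<le> (s' - s) * (e \<bullet> p)" using ep2 s by (intro mult_left_mono) auto
  ultimately have "norm p * norm p + (s' - s) / 6 * norm p \<le> p' \<bullet> p"
    by (simp add: dot_square_norm power2_eq_square algebra_simps)
  also have "\<dots> \<le> norm p' * norm p" by (rule norm_cauchy_schwarz)
  finally have "((s' - s) / 6 + norm p) * norm p \<le> norm p' * norm p" by (simp add: algebra_simps)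
  then have "(s' - s) / 6 + norm p \<le> norm p'" using False by simp
  then show ?thesis by linarith
qed

lemma isCont_filterlim_nhds: "isCont f x \<Longrightarrow> filterlim f (nhds (f x)) (nhds x)"
  unfolding isCont_def tendsto_at_iff_tendsto_nhds .

context centered_chart begin

text \<open>\<open>base_map\<close> is the closest point retraction read in the chart; on the fibres of the orthogonal
  projection onto \<open>L\<close> it is not constant.\<close>

definition base_map :: "'a \<Rightarrow> 'a" where "base_map z = h (closest_point M (g z))"
definition base_deriv :: "'a \<Rightarrow> 'a" where
  "base_deriv v = h' x0 (closest_point (tangent_space M x0) (g' 0 v))"
text \<open>The derivative at 0 of the normal vector \<open>g z - closest_point M (g z)\<close> as a
  function of the chart point z; it vanishes on L.\<close>

definition normal_deriv :: "'a \<Rightarrow> 'a" where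
  "normal_deriv v = g' 0 v - closest_point (tangent_space M x0) (g' 0 v)"

lemma closest_point_x0 [simp]: "closest_point M x0 = x0"
  by (rule closest_point_self[OF x0_M])

lemma base_map_0 [simp]: "base_map 0 = 0" by (simp add: base_map_def)

lemma strict_derivative_base_map: "strict_derivative base_map base_deriv 0"
  unfolding base_map_def[abs_def] base_deriv_def[abs_def]
  by (rule strict_derivative_compose[OF strict_derivative_compose[OF strict_g[OF zero_V] strict_derivative_closest_point]])
    (simp add: strict_h[OF x0_U])

lemma base_deriv_id: "v \<in> L \<Longrightarrow> base_deriv v = v"
  unfolding base_deriv_def using h'_g'[OF x0_U, of v] closest_point_self[of "g' 0 v" "tangent_space M x0"]
  by (simp add: tangent_space_x0)

lemma isCont_closest_point_x0: "isCont (closest_point M) x0"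
  by (rule strict_derivative_isCont[OF strict_derivative_closest_point])

lemma closest_point_chart_near:
  "\<forall>\<^sub>F y in nhds x0. closest_point M y \<in> M \<and> closest_point M y \<in> U"
proof -
  obtain d where d: "d > 0" "\<And>y. y \<in> ball x0 d \<Longrightarrow> closest_point M y \<in> M"
    by (rule closest_point_near, rule that)
  have "\<forall>\<^sub>F y in nhds x0. y \<in> ball x0 d" by (rule eventually_nhds_in_open) (use d in auto)
  moreover have "\<forall>\<^sub>F y in nhds x0. closest_point M y \<in> U"
  proof -
    show ?thesis
      by (rule topological_tendstoD[OF isCont_filterlim_nhds[OF isCont_closest_point_x0] open_U]) (simp add: x0_U)
  qed
  ultimately show ?thesis by eventually_elim (use d in blast)
qed

lemma g_nhds: "filterlim g (nhds x0) (nhds 0)"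
  by (rule isCont_filterlim_nhds[OF isCont_g[OF zero_V]])

lemma base_map_mem: "\<forall>\<^sub>F z in nhds 0. base_map z \<in> L"
proof -
  have "\<forall>\<^sub>F z in nhds 0. closest_point M (g z) \<in> M \<and> closest_point M (g z) \<in> U"
    using closest_point_chart_near g_nhds by (rule eventually_compose_filterlim)
  then show ?thesis unfolding base_map_def by eventually_elim (use flat_iff in blast)
qed

text \<open>On the orthogonal complement of L, \<open>normal_deriv\<close> is injective:
  \<open>h' x0\<close> carries its value at \<nu> to \<nu> - l for some l in L, which is at least as
  long as \<nu>. This converts bounds on the normal part in the chart into bounds on true normal
  vectors.\<close>

lemma normal_deriv_lower_bound:
  obtains C where "C > 0" "\<And>v. norm (v - closest_point L v) \<le> C * norm (normal_deriv (v - closest_point L v))"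
proof -
  obtain H where H: "H > 0" "\<And>v. norm (h' x0 v) \<le> norm v * H"
    using bounded_linear.pos_bounded[OF blinfun.bounded_linear_right[of "h' x0"]] by blast
  have "norm (v - closest_point L v) \<le> H * norm (normal_deriv (v - closest_point L v))" for v
  proof -
    define \<nu> where "\<nu> = v - closest_point L v"
    have "closest_point (tangent_space M x0) (g' 0 \<nu>) \<in> g' 0 ` L"
      using proj_mem[OF subspace_tangent_x0] unfolding tangent_space_x0 .
    then obtain l where l: "l \<in> L" "closest_point (tangent_space M x0) (g' 0 \<nu>) = g' 0 l" by blast
    have "h' x0 (normal_deriv \<nu>) = \<nu> - l"
      using h'_g'[OF x0_U, of \<nu>] h'_g'[OF x0_U, of l] by (simp add: normal_deriv_def l blinfun.diff_right)
    then have 1: "norm (\<nu> - l) \<le> norm (normal_deriv \<nu>) * H" using H(2)[of "normal_deriv \<nu>"] by simp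
    have "\<nu> = (v - closest_point L v) - closest_point L (v - closest_point L v)"
      by (simp add: \<nu>_def linear_diff[OF proj_linear[OF subspace_L]] proj_id[OF subspace_L proj_mem[OF subspace_L]])
    then have "norm \<nu> \<le> norm (\<nu> - l)"
      using proj_dist[OF subspace_L l(1), of \<nu>] by (simp add: \<nu>_def)
    then show ?thesis using 1 unfolding \<nu>_def[symmetric] by (simp add: mult.commute)
  qed
  then show ?thesis using that H(1) by blast
qed

text \<open>The normal vector vanishes at the image of \<open>closest_point L z\<close>, a point of
  M. Strict differentiability is therefore applied to z and this point instead of z and 0, which
  makes the error relative to the distance from L.\<close>

lemma normal_vector_approx:
  assumes "c > 0"
  shows "\<forall>\<^sub>F z in nhds 0. norm ((g z - closest_point M (g z)) - normal_deriv (z - closest_point L z))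
     \<le> c * norm (z - closest_point L z)"
proof -
  let ?F = "\<lambda>z. g z - closest_point M (g z)"
  have F: "strict_derivative ?F normal_deriv 0"
    unfolding normal_deriv_def[abs_def]
    by (rule strict_derivative_diff[OF strict_g[OF zero_V]
        strict_derivative_compose[OF strict_g[OF zero_V] strict_derivative_closest_point]])
  obtain d where d: "d > 0" "\<And>y z. y \<in> ball 0 d \<Longrightarrow> z \<in> ball 0 d \<Longrightarrow>
      norm (?F y - ?F z - normal_deriv (y - z)) \<le> c * norm (y - z)"
    by (rule strict_derivativeD[OF F assms], rule that)
  obtain dV where dV: "dV > 0" "ball 0 dV \<subseteq> V" using open_V zero_V openE by blast
  have "\<forall>\<^sub>F z in nhds 0. z \<in> ball 0 (min d dV)" by (rule eventually_nhds_in_open) (use d dV in auto)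
  then show ?thesis
  proof eventually_elim
    case (elim z)
    have Pz: "closest_point L z \<in> ball 0 (min d dV)" using proj_norm[OF subspace_L, of z] elim by simp
    then have "closest_point L z \<in> V" using dV by auto
    then have "g (closest_point L z) \<in> M" using flat_g_iff proj_mem[OF subspace_L] by blast
    then have "?F (closest_point L z) = 0" by (simp add: closest_point_self)
    then show ?case using d(2)[of z "closest_point L z"] elim Pz by simp
  qed
qed

text \<open>Condition (a) compares tangent spaces at two different points. A vector u of L is lifted
  to the tangent space of M at the closest point, projected onto the tangent space of Y at y and
  pushed forward by the derivative at y; continuity of \<open>h'\<close> at x0 controls the change
  of base point.\<close>

lemma delta_image_small:
  assumes Y: "C2_submanifold Y" and disj: "x0 \<notin> Y" and a: "condition_a_at Y M x0" and c: "c > 0"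
  obtains d where "d > 0"
    "\<And>z. z \<in> h ` (U \<inter> Y) \<Longrightarrow> norm z < d \<Longrightarrow> delta L (tangent_space (h ` (U \<inter> Y)) z) \<le> c"
proof -
  let ?N = "h ` (U \<inter> Y)" and ?p = "closest_point M"
  define G where "G = norm (g' 0) + 1"
  define H where "H = norm (h' x0) + 1"
  have GH: "G > 0" "H > 0" by (auto simp: G_def H_def add_nonneg_pos)
  \<comment> \<open>The change of derivative costs 2 * c1 * G, that is two thirds of c, and the
    projection costs H * c2 * G, the remaining third.\<close>
  define c1 where "c1 = c / (3 * G)"
  define c2 where "c2 = c / (3 * H * G)"
  have c12: "c1 > 0" "c2 > 0" using c GH by (auto simp: c1_def c2_def)
  have hx: "filterlim h' (nhds (h' x0)) (nhds x0)" by (rule isCont_filterlim_nhds[OF isCont_h'[OF x0_U]])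
  have hc: "filterlim h (nhds 0) (nhds x0)" using isCont_filterlim_nhds[OF isCont_h[OF x0_U]] unfolding h_x0 .
  have gc: "filterlim g' (nhds (g' 0)) (nhds 0)" by (rule isCont_filterlim_nhds[OF isCont_g'[OF zero_V]])
  have pc: "filterlim ?p (nhds x0) (nhds x0)"
    using isCont_filterlim_nhds[OF isCont_closest_point_x0] unfolding closest_point_x0 .
  have e1: "\<forall>\<^sub>F y in nhds x0. dist (h' y) (h' x0) < min c1 1"
    by (rule tendstoD[OF hx]) (use c12 in simp)
  have e2: "\<forall>\<^sub>F y in nhds x0. dist (h' (?p y)) (h' x0) < min c1 1" by (rule eventually_compose_filterlim[OF e1 pc])
  have e3: "\<forall>\<^sub>F y in nhds x0. dist (g' (h (?p y))) (g' 0) < 1"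
    by (rule tendstoD[OF filterlim_compose[OF gc filterlim_compose[OF hc pc]]]) simp
  have "\<forall>\<^sub>F y in at x0 within Y. delta (tangent_space M (?p y)) (tangent_space Y y) < c2"
    using order_tendstoD(2)[OF a[unfolded condition_a_at_def] c12(2)] .
  then have e4: "\<forall>\<^sub>F y in nhds x0. y \<noteq> x0 \<longrightarrow> y \<in> Y \<longrightarrow> delta (tangent_space M (?p y)) (tangent_space Y y) < c2"
    by (simp add: eventually_at_filter)
  have "\<forall>\<^sub>F y in nhds x0. y \<in> U" by (rule eventually_nhds_in_open[OF open_U x0_U])
  then have "\<forall>\<^sub>F y in nhds x0. y \<in> Y \<longrightarrow> y \<noteq> x0 \<longrightarrow> delta L (tangent_space ?N (h y)) \<le> c"
    using e1 e2 e3 e4 closest_point_chart_near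
  proof eventually_elim
    case (elim y)
    show ?case
    proof (intro impI)
      assume yY: "y \<in> Y" and ne: "y \<noteq> x0"
      let ?x = "?p y"
      have dl: "delta (tangent_space M ?x) (tangent_space Y y) < c2" using elim(5) yY ne by blast
      have xU: "?x \<in> U \<inter> M" using elim(6) by blast
      have TY: "subspace (tangent_space Y y)" by (rule subspace_tangent_space[OF Y yY])
      have Tx: "tangent_space M ?x = {v. h' ?x v \<in> L}" by (rule tangent_space_eq[OF xU])
      have TX: "subspace (tangent_space M ?x)"
        unfolding Tx using linear_subspace_vimage[OF bounded_linear.linear[OF blinfun.bounded_linear_right] subspace_L]
        by (simp add: vimage_def)
      have TN: "subspace (tangent_space ?N (h y))" using image_subspace_tangent[OF Y] elim(1) yY by blast
      show "delta L (tangent_space ?N (h y)) \<le> c"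
      proof (rule delta_le)
        fix u assume u: "u \<in> L" "norm u = 1"
        define w where "w = g' (h ?x) u"
        define q where "q = closest_point (tangent_space Y y) w"
        have hw: "h' ?x w = u" unfolding w_def by (rule h'_g') (use xU in blast)
        have wT: "w \<in> tangent_space M ?x" unfolding Tx using hw u(1) by simp
        have "norm (g' (h ?x)) \<le> G"
          using elim(4) norm_triangle_ineq2[of "g' (h ?x)" "g' 0"] by (simp add: dist_norm G_def)
        then have wG: "norm w \<le> G"
          using norm_blinfun[of "g' (h ?x)" u] u(2) by (simp add: w_def)
        have hH: "norm (h' y) \<le> H"
          using elim(2) norm_triangle_ineq2[of "h' y" "h' x0"] by (simp add: dist_norm H_def)
        have "norm (w - q) \<le> delta (tangent_space M ?x) (tangent_space Y y) * norm w"
          using infdist_le_delta[OF TX TY wT] unfolding infdist_proj[OF TY] q_def .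
        also have "\<dots> \<le> c2 * G" using dl wG c12 by (intro mult_mono) auto
        finally have wq: "norm (w - q) \<le> c2 * G" .
        have qN: "h' y q \<in> tangent_space ?N (h y)"
          unfolding tangent_space_image[OF elim(1)] q_def by (intro imageI proj_mem[OF TY])
        have "u - h' y q = (h' ?x - h' y) w + h' y (w - q)"
          by (simp add: blinfun.diff_left blinfun.diff_right hw)
        then have "norm (u - h' y q) \<le> norm ((h' ?x - h' y) w) + norm (h' y (w - q))"
          using norm_triangle_ineq by metis
        also have "\<dots> \<le> norm (h' ?x - h' y) * norm w + norm (h' y) * norm (w - q)"
          by (intro add_mono norm_blinfun)
        also have "\<dots> \<le> (2 * c1) * G + H * (c2 * G)"
        proof (intro add_mono mult_mono wG hH wq)
          have "norm (h' ?x - h' y) \<le> dist (h' ?x) (h' x0) + dist (h' y) (h' x0)"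
            using dist_triangle2[of "h' ?x" "h' y" "h' x0"] by (simp add: dist_norm)
          then show "norm (h' ?x - h' y) \<le> 2 * c1" using elim(2,3) by simp
        qed (use GH c12 in auto)
        also have "\<dots> = c" using GH by (simp add: c1_def c2_def field_simps)
        finally have "norm (u - h' y q) \<le> c" .
        then show "infdist u (tangent_space ?N (h y)) \<le> c"
          using infdist_le[OF qN, of u] by (simp add: dist_norm)
      qed (use c in simp)
    qed
  qed
  then have "\<forall>\<^sub>F z in nhds 0. g z \<in> Y \<longrightarrow> g z \<noteq> x0 \<longrightarrow> delta L (tangent_space ?N (h (g z))) \<le> c"
    using g_nhds by (rule eventually_compose_filterlim)
  moreover have "\<forall>\<^sub>F z in nhds 0. z \<in> V" by (rule eventually_nhds_in_open[OF open_V zero_V])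
  ultimately have "\<forall>\<^sub>F z in nhds 0. z \<noteq> 0 \<longrightarrow> z \<in> ?N \<longrightarrow> delta L (tangent_space ?N z) \<le> c"
  proof eventually_elim
    case (elim z)
    show ?case
    proof (intro impI)
      assume "z \<noteq> 0" "z \<in> ?N"
      then obtain y where y: "y \<in> U" "y \<in> Y" "z = h y" by blast
      then have "g z = y" by (simp add: gh)
      moreover have "y \<noteq> x0" using \<open>z \<noteq> 0\<close> y(3) by auto
      ultimately show "delta L (tangent_space ?N z) \<le> c" using elim(1) y by simp
    qed
  qed
  then obtain d where d: "d > 0" "\<And>z. dist z 0 < d \<Longrightarrow> z \<noteq> 0 \<Longrightarrow> z \<in> ?N \<Longrightarrow> delta L (tangent_space ?N z) \<le> c"
    unfolding eventually_nhds_metric by blast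
  show ?thesis
  proof (rule that[OF d(1)])
    fix z assume z: "z \<in> ?N" "norm z < d"
    obtain y where y: "y \<in> U" "y \<in> Y" "z = h y" using z(1) by blast
    have "y \<noteq> x0" using y(2) disj by blast
    then have "z \<noteq> 0" using gh[OF y(1)] y(3) by auto
    then show "delta L (tangent_space ?N z) \<le> c" using d(2) z by simp
  qed
qed

end

context centered_chart begin

context
  fixes Y :: "'a set" and R :: "real \<Rightarrow> real" and \<eta> K :: real
  assumes Y: "C2_submanifold Y" and disj: "Y \<inter> M = {}" and V: "ball 0 \<eta> \<subseteq> V" and K: "1 \<le> K"
    and \<delta>: "\<And>z. z \<in> h ` (U \<inter> Y) \<Longrightarrow> z \<in> ball 0 \<eta> \<Longrightarrow> K * delta L (tangent_space (h ` (U \<inter> Y)) z) \<le> 1/32"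
    and R: "continuous_on UNIV R" "mono R"
    and rate: "\<And>z. z \<in> h ` (U \<inter> Y) \<Longrightarrow> z \<in> ball 0 \<eta> \<Longrightarrow>
      \<exists>d>0. \<forall>t. \<bar>t - norm (closest_point L z)\<bar> < d \<longrightarrow>
      (delta L (tangent_space (h ` (U \<inter> Y)) z) / norm (z - closest_point L z) + 1) * \<bar>t - norm (closest_point L z)\<bar>
        \<le> \<bar>R t - R (norm (closest_point L z))\<bar>"
    and small: "exp (8 * (R \<eta> - R 0)) < 2"
begin

text \<open>Instance of \<open>stratum_phase\<close> in which A consists of the points of closure Y
  off M, a set closed away from L. The map \<sigma> stays general because it is the orthogonal
  projection for the inward motion and \<open>base_map\<close> for the outward one.\<close>

lemma chart_phase:
  assumes S0: "bounded_linear S0" "\<And>v. v \<in> L \<Longrightarrow> S0 v = v" "\<And>v. norm (S0 v) \<le> K * norm v"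
    and \<sigma>: "\<And>u v. u \<in> ball 0 \<eta> \<Longrightarrow> v \<in> ball 0 \<eta> \<Longrightarrow> norm (\<sigma> u - \<sigma> v - S0 (u - v)) \<le> 1/32 * norm (u - v)"
    and \<sigma>L: "\<And>u. u \<in> ball 0 \<eta> \<Longrightarrow> \<sigma> u \<in> L"
    and e: "e \<in> L" "norm e = 1" and \<iota>: "\<iota> = 1 \<or> \<iota> = (-1 :: real)"
    and radial: "\<And>z z' s s'. z \<in> ball 0 \<eta> \<Longrightarrow> z' \<in> ball 0 \<eta> \<Longrightarrow> 0 \<le> s \<Longrightarrow> s \<le> s' \<Longrightarrow> s' \<le> T \<Longrightarrow>
      \<sigma> z = \<sigma> z0 + s *\<^sub>R e \<Longrightarrow> \<sigma> z' = \<sigma> z0 + s' *\<^sub>R e \<Longrightarrow>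
      norm (closest_point L z - closest_point L z0 - s *\<^sub>R e) \<le> s / 3 \<Longrightarrow>
      norm (closest_point L z' - closest_point L z - (s' - s) *\<^sub>R e) \<le> (s' - s) / 3 \<Longrightarrow>
      (s' - s) / 6 \<le> \<iota> * (norm (closest_point L z') - norm (closest_point L z))"
    and z0: "z0 \<in> V" "g z0 \<in> closure Y" "g z0 \<notin> M" and T: "0 \<le> T"
    and room: "norm z0 + 2 * T + norm (z0 - closest_point L z0) * (exp (8 * (R \<eta> - R 0)) - 1) < \<eta>"
  obtains z where "z \<in> ball 0 \<eta>" "g z \<in> closure Y" "g z \<notin> M" "\<sigma> z = \<sigma> z0 + T *\<^sub>R e \<or> g z \<notin> Y"
    "norm ((z - closest_point L z) - (z0 - closest_point L z0)) \<le> norm (z0 - closest_point L z0) * (exp (8 * (R \<eta> - R 0)) - 1)"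
    "norm (z - z0) \<le> 2 * T + norm (z0 - closest_point L z0) * (exp (8 * (R \<eta> - R 0)) - 1)"
proof -
  let ?N = "h ` (U \<inter> Y)"
  define A where "A = {z \<in> V. g z \<in> closure Y \<and> g z \<notin> M}"
  have proj_eq: "closest_point L z = z \<longleftrightarrow> z \<in> L" for z
    using closest_point_refl[OF closed_subspace[OF subspace_L]] subspace_0[OF subspace_L] by blast
  have c\<sigma>: "continuous_on (ball 0 \<eta>) \<sigma>"
    by (rule continuous_on_approx_linear[OF \<sigma> S0(3)]) (use K in auto)
  have NA: "?N \<subseteq> A"
  proof
    fix z assume "z \<in> ?N"
    then obtain y where y: "y \<in> U" "y \<in> Y" "z = h y" by blast
    then show "z \<in> A" unfolding A_def using h_mem gh disj closure_subset[of Y] by auto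
  qed
  have cl: "z \<in> A" if s: "\<And>i. s i \<in> A" "s \<longlonglongrightarrow> z" "z \<in> ball 0 \<eta>" "closest_point L z \<noteq> z" for s :: "nat \<Rightarrow> 'a" and z
  proof -
    have zV: "z \<in> V" using V s(3) by blast
    have "(\<lambda>i. g (s i)) \<longlonglongrightarrow> g z" by (rule isCont_tendsto_compose[OF isCont_g[OF zV] s(2)])
    then have "g z \<in> closure Y"
      by (rule closed_sequentially[OF closed_closure, rotated 1]) (use s(1) in \<open>auto simp: A_def\<close>)
    moreover have "z \<notin> L" using s(4) unfolding proj_eq .
    ultimately show ?thesis unfolding A_def using zV flat_g_iff by blast
  qed
  have A0: "closest_point L z \<noteq> z" if "z \<in> A" for z
    unfolding proj_eq using that flat_g_iff unfolding A_def by blast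
  have "\<exists>z. z \<in> A \<and> z \<in> ball 0 \<eta> \<and> (\<sigma> z = \<sigma> z0 + T *\<^sub>R e \<or> z \<notin> ?N) \<and>
    norm ((z - closest_point L z) - (z0 - closest_point L z0)) \<le> norm (z0 - closest_point L z0) * (exp (8 * (R \<eta> - R 0)) - 1) \<and>
    norm (z - z0) \<le> 2 * T + norm (z0 - closest_point L z0) * (exp (8 * (R \<eta> - R 0)) - 1)"
  proof (rule stratum_phase[where D = "\<lambda>z. delta L (tangent_space ?N z)" and \<iota> = \<iota> and N = ?N and A = A and L = L and \<eta> = \<eta> and R = R and \<sigma> = \<sigma>
        and e = e and T = T and ?z0.0 = z0])
    show "z \<in> A" if "\<And>i. s i \<in> A" "s \<longlonglongrightarrow> z" "z \<in> ball 0 \<eta>" "closest_point L z \<noteq> z" for s :: "nat \<Rightarrow> 'a" and z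
      by (rule cl[OF that])
    show "closest_point L z \<noteq> z" if "z \<in> A" for z by (rule A0[OF that])
    show "0 \<le> delta L (tangent_space ?N z)" if "z \<in> ?N" for z
      by (rule delta_nonneg[OF image_subspace_tangent[OF Y that]])
    show "\<exists>s0>0. \<forall>s. 0 < s \<and> s < s0 \<longrightarrow>
      (\<exists>z'\<in>?N \<inter> ball 0 \<eta>. \<sigma> z' = \<sigma> z + s *\<^sub>R e \<and>
      norm (closest_point L z' - closest_point L z - s *\<^sub>R e) \<le> s / 3 \<and>
      norm ((z' - closest_point L z') - (z - closest_point L z)) \<le> (5/4 * delta L (tangent_space ?N z) + \<rho>) * s)"
      if z: "z \<in> ?N" "z \<in> ball 0 \<eta>" "\<rho> > 0" for z \<rho>
    proof -
      obtain \<psi> d where \<psi>: "d > 0" "continuous_on (tangent_space ?N z \<inter> ball 0 d) \<psi>" "\<psi> 0 = z"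
        "\<And>w. w \<in> tangent_space ?N z \<Longrightarrow> norm w < d \<Longrightarrow> \<psi> w \<in> ?N" "(\<psi> has_derivative (\<lambda>w. w)) (at 0)"
        by (rule image_tangent_parametrization[OF Y z(1)], rule that)
      show ?thesis
        by (rule stratum_step[OF subspace_L image_subspace_tangent[OF Y z(1)] S0 K \<sigma> \<sigma>L z(2) \<delta>[OF z(1,2)] e \<psi> z(3)])
    qed
    show "z0 \<in> A" using z0 by (simp add: A_def)
  qed (fact subspace_L NA R rate c\<sigma> e(2) \<iota> radial T small room)+
  then obtain z where z: "z \<in> A" "z \<in> ball 0 \<eta>" "\<sigma> z = \<sigma> z0 + T *\<^sub>R e \<or> z \<notin> ?N"
    "norm ((z - closest_point L z) - (z0 - closest_point L z0)) \<le> norm (z0 - closest_point L z0) * (exp (8 * (R \<eta> - R 0)) - 1)"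
    "norm (z - z0) \<le> 2 * T + norm (z0 - closest_point L z0) * (exp (8 * (R \<eta> - R 0)) - 1)"
    by blast
  have "z \<notin> ?N \<Longrightarrow> g z \<notin> Y"
  proof
    assume "z \<notin> ?N" "g z \<in> Y"
    have "z \<in> V" using z(1) by (simp add: A_def)
    then have "h (g z) \<in> ?N" using \<open>g z \<in> Y\<close> g_mem by blast
    then show False using \<open>z \<notin> ?N\<close> hg[OF \<open>z \<in> V\<close>] by simp
  qed
  then show ?thesis using that[OF z(2)] z unfolding A_def by blast
qed

end

text \<open>Phase 1 moves the projection to \<open>L\<close> radially to 0 (to \<open>z1\<close>).  Phase 2 then moves \<open>base_map\<close> along
  a straight segment to \<open>h x\<close> (to \<open>z2\<close>); as the projection starts at 0, its norm increases.\<close>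

lemma stratum_transport:
  assumes Y: "C2_submanifold Y" and disj: "Y \<inter> M = {}" and a: "condition_a_at Y M x0"
    and r: "(\<integral>\<^sup>+t\<in>{0..\<epsilon>}. r_function (h ` (U \<inter> Y)) L \<eta> t \<partial>lborel) < \<infinity>" "\<eta> > 0" "\<epsilon> > 0"
    and \<kappa>: "\<kappa> > 0" and \<beta>: "\<beta> > 0"
  obtains d where "d > 0" "\<And>y x. y \<in> Y \<Longrightarrow> dist y x0 < d \<Longrightarrow> x \<in> M \<Longrightarrow> dist x x0 < d \<Longrightarrow>
    \<exists>y'. y' \<in> closure Y \<and> y' \<notin> M \<and> dist y' x0 < \<beta> \<and>
      norm ((y' - closest_point M y') - (y - closest_point M y)) \<le> \<kappa> * norm (y - closest_point M y) \<and>
      (closest_point M y' = x \<or> y' \<notin> Y)"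
proof -
  let ?N = "h ` (U \<inter> Y)" and ?P = "closest_point L" and ?p = "closest_point M"
  let ?n = "\<lambda>z. z - ?P z"
  obtain C where C: "C > 0" "\<And>v. norm (?n v) \<le> C * norm (normal_deriv (?n v))"
    by (rule normal_deriv_lower_bound, rule that)
  have blN: "bounded_linear normal_deriv"
    unfolding normal_deriv_def[abs_def]
    by (intro bounded_linear_sub bounded_linear_compose[OF proj_bounded_linear[OF subspace_tangent_x0]] blinfun.bounded_linear_right)
  obtain B where B: "B > 0" "\<And>v. norm (normal_deriv v) \<le> norm v * B"
    using bounded_linear.pos_bounded[OF blN] by blast
  have blS: "bounded_linear base_deriv" by (rule strict_derivative_linear[OF strict_derivative_base_map])
  obtain K0 where K0: "\<And>v. norm (base_deriv v) \<le> norm v * K0"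
    using bounded_linear.pos_bounded[OF blS] by blast
  define K where "K = max 1 K0"
  have K: "1 \<le> K" "norm (base_deriv v) \<le> K * norm v" for v
  proof -
    show "1 \<le> K" by (simp add: K_def)
    have "norm v * K0 \<le> norm v * K" by (intro mult_left_mono) (auto simp: K_def)
    then show "norm (base_deriv v) \<le> K * norm v" using K0[of v] by (simp add: mult.commute)
  qed
  \<comment> \<open>c bounds the relative linearization error of normal vectors and k the relative
    change of the chart normal in one phase. The final estimate needs 10 * (C * c) + 6 * (C * B * k)
    <= \<kappa>; moreover C * c <= 1/2 permits an absorption.\<close>
  define c where "c = min (1 / (2 * C)) (\<kappa> / (20 * C))"
  define k where "k = min (1/2) (\<kappa> / (12 * C * B))"
  have c: "c > 0" "C * c \<le> 1/2" "20 * (C * c) \<le> \<kappa>"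
  proof -
    show "c > 0" using C(1) \<kappa> by (simp add: c_def)
    have "c \<le> 1 / (2 * C)" "c \<le> \<kappa> / (20 * C)" by (simp_all add: c_def)
    then show "C * c \<le> 1/2" "20 * (C * c) \<le> \<kappa>" using C(1) by (simp_all add: field_simps)
  qed
  have k: "k > 0" "k \<le> 1/2" "12 * (C * B * k) \<le> \<kappa>"
  proof -
    show "k > 0" using C(1) B(1) \<kappa> by (simp add: k_def)
    show "k \<le> 1/2" by (simp add: k_def)
    have "k \<le> \<kappa> / (12 * C * B)" by (simp add: k_def)
    then show "12 * (C * B * k) \<le> \<kappa>" using C(1) B(1) by (simp add: field_simps)
  qed
  obtain R where R: "continuous_on UNIV R" "mono R"
    "\<And>t a. \<lbrakk>t \<in> {0..\<epsilon>}; 0 \<le> a; ennreal a \<le> r_function ?N L \<eta> t\<rbrakk>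
       \<Longrightarrow> \<exists>d>0. \<forall>s. \<bar>s - t\<bar> < d \<longrightarrow> (a + 1) * \<bar>s - t\<bar> \<le> \<bar>R s - R t\<bar>"
    by (rule integrable_rate_primitive[OF r_function_measurable[OF Y subspace_L] r(1)], rule that)
  obtain d1 where d1: "d1 > 0" "\<And>u v. u \<in> ball 0 d1 \<Longrightarrow> v \<in> ball 0 d1 \<Longrightarrow>
      norm (base_map u - base_map v - base_deriv (u - v)) \<le> 1/32 * norm (u - v)"
    by (rule strict_derivativeD[OF strict_derivative_base_map, of "1/32"], simp, rule that)
  have K32: "1 / (32 * K) > 0" using K(1) by simp
  have x0Y: "x0 \<notin> Y" using disj x0_M by blast
  obtain d2 where d2: "d2 > 0" "\<And>z. z \<in> ?N \<Longrightarrow> norm z < d2 \<Longrightarrow> delta L (tangent_space ?N z) \<le> 1 / (32 * K)"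
    by (rule delta_image_small[OF Y x0Y a K32], rule that)
  have "\<forall>\<^sub>F z in nhds 0. z \<in> V \<and> base_map z \<in> L \<and> dist (g z) x0 < \<beta> \<and>
      norm ((g z - ?p (g z)) - normal_deriv (?n z)) \<le> c * norm (?n z) \<and> ?p (g z) \<in> M \<and> ?p (g z) \<in> U"
    (is "\<forall>\<^sub>F z in _. ?near z")
    by (intro eventually_compose_filterlim[OF closest_point_chart_near g_nhds] eventually_conj eventually_nhds_in_open[OF open_V zero_V] base_map_mem
        tendstoD[OF g_nhds \<beta>] normal_vector_approx c(1))
  then obtain d3 where d3: "d3 > 0" "\<And>z. dist z 0 < d3 \<Longrightarrow> ?near z"
    unfolding eventually_nhds_metric by blast
  \<comment> \<open>Continuity of R at 0 expresses that the integral of the rate over a short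
    interval is small; this fixes the radius of the working ball.\<close>
  have "isCont (\<lambda>t. exp (8 * (R t - R 0))) 0"
    using R(1) by (intro continuous_intros) (simp add: continuous_on_eq_continuous_at)
  then have "\<forall>\<^sub>F t in nhds 0. exp (8 * (R t - R 0)) < 1 + k"
    using order_tendstoD(2)[OF isCont_filterlim_nhds, of 0 "\<lambda>t. exp (8 * (R t - R 0))" "1 + k"] k(1) by simp
  then obtain d4 where d4: "d4 > 0" "\<And>t. dist t 0 < d4 \<Longrightarrow> exp (8 * (R t - R 0)) < 1 + k"
    unfolding eventually_nhds_metric by blast
  define \<eta>1 where "\<eta>1 = min (min (min d1 d2) (min d3 (d4 / 2))) (min \<eta> \<epsilon>)"
  have \<eta>1: "\<eta>1 > 0" "\<eta>1 \<le> d1" "\<eta>1 \<le> d2" "\<eta>1 \<le> d3" "\<eta>1 < d4" "\<eta>1 \<le> \<eta>" "\<eta>1 \<le> \<epsilon>"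
    using d1(1) d2(1) d3(1) d4(1) r(2,3) by (auto simp: \<eta>1_def)
  define E where "E = exp (8 * (R \<eta>1 - R 0)) - 1"
  have E: "E \<le> k" "0 \<le> E"
    using d4(2)[of \<eta>1] \<eta>1(1,5) monoD[OF R(2), of 0 \<eta>1] by (auto simp: E_def)
  have near: "z \<in> V" "base_map z \<in> L" "dist (g z) x0 < \<beta>"
    "norm ((g z - ?p (g z)) - normal_deriv (?n z)) \<le> c * norm (?n z)"
    "?p (g z) \<in> U" if "z \<in> ball 0 \<eta>1" for z
    using d3(2)[of z] that \<eta>1(4) by (auto simp: dist_commute)
  have VV: "ball 0 \<eta>1 \<subseteq> V" using near(1) by blast
  have del: "K * delta L (tangent_space ?N z) \<le> 1/32" if "z \<in> ?N" "z \<in> ball 0 \<eta>1" for z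
  proof -
    have "delta L (tangent_space ?N z) \<le> 1 / (32 * K)" using d2(2)[OF that(1)] that(2) \<eta>1(3) by simp
    then show ?thesis using K(1) by (simp add: field_simps)
  qed
  have rate: "\<exists>d>0. \<forall>t. \<bar>t - norm (?P z)\<bar> < d \<longrightarrow>
      (delta L (tangent_space ?N z) / norm (?n z) + 1) * \<bar>t - norm (?P z)\<bar> \<le> \<bar>R t - R (norm (?P z))\<bar>"
    if z: "z \<in> ?N" "z \<in> ball 0 \<eta>1" for z
  proof (rule R(3))
    show "norm (?P z) \<in> {0..\<epsilon>}" using proj_norm[OF subspace_L, of z] z(2) \<eta>1(7) by simp
    show "0 \<le> delta L (tangent_space ?N z) / norm (?n z)"
      using delta_nonneg[OF image_subspace_tangent[OF Y z(1)]] by simp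
    show "ennreal (delta L (tangent_space ?N z) / norm (?n z)) \<le> r_function ?N L \<eta> (norm (?P z))"
      unfolding r_function_def by (rule SUP_upper) (use z \<eta>1(6) in auto)
  qed
  have small: "exp (8 * (R \<eta>1 - R 0)) < 2" using E k by (simp add: E_def)
  note phase = chart_phase[OF Y disj VV K(1) del R(1,2) rate small, folded E_def]
  \<comment> \<open>Room for both phases: starting below \<eta>2, phase 1 ends within 4 * \<eta>2,
    and phase 2 has length at most 5 * \<eta>2 + 4 * K * \<eta>2. It therefore needs 18 * \<eta>2 +
    8 * K * \<eta>2, which is less than \<eta>1.\<close>
  define \<eta>2 where "\<eta>2 = \<eta>1 / (8 * K + 20)"
  have \<eta>2: "\<eta>2 > 0" "(8 * K + 20) * \<eta>2 = \<eta>1" using \<eta>1(1) K(1) by (auto simp: \<eta>2_def)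
  have "\<forall>\<^sub>F y in nhds x0. y \<in> U \<and> dist (h y) 0 < \<eta>2"
  proof (intro eventually_conj eventually_nhds_in_open[OF open_U x0_U])
    show "\<forall>\<^sub>F y in nhds x0. dist (h y) 0 < \<eta>2"
      using tendstoD[OF isCont_filterlim_nhds[OF isCont_h[OF x0_U]] \<eta>2(1)] by simp
  qed
  then obtain d where d: "d > 0" "\<And>y. dist y x0 < d \<Longrightarrow> y \<in> U \<and> dist (h y) 0 < \<eta>2"
    unfolding eventually_nhds_metric by blast
  show ?thesis
  proof (rule that[OF d(1)])
    fix y x assume y: "y \<in> Y" "dist y x0 < d" and x: "x \<in> M" "dist x x0 < d"
    define z0 where "z0 = h y"
    define \<xi> where "\<xi> = h x"
    have yU: "y \<in> U" and z0n: "norm z0 < \<eta>2" using d(2)[OF y(2)] by (auto simp: z0_def)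
    have xU: "x \<in> U" and \<xi>n: "norm \<xi> < \<eta>2" using d(2)[OF x(2)] by (auto simp: \<xi>_def)
    have gz0: "g z0 = y" unfolding z0_def by (rule gh[OF yU])
    have \<xi>L: "\<xi> \<in> L" unfolding \<xi>_def using flat_iff[OF xU] x(1) by blast
    have K\<eta>: "\<eta>2 \<le> K * \<eta>2" using K(1) \<eta>2(1) by simp
    have \<eta>21: "20 * \<eta>2 + 8 * (K * \<eta>2) = \<eta>1" using \<eta>2(2) by (simp add: algebra_simps)
    have z0V: "z0 \<in> V" unfolding z0_def by (rule h_mem[OF yU])
    have n0: "norm (?n z0) \<le> norm z0" by (rule proj_compl_norm[OF subspace_L])
    have nE: "norm (?n z) * E \<le> norm (?n z)" for z using E k by (intro mult_left_le) auto
    have z0c: "g z0 \<in> closure Y" "g z0 \<notin> M" using gz0 y(1) disj closure_subset[of Y] by auto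
    have "\<exists>z1. z1 \<in> ball 0 \<eta>1 \<and> g z1 \<in> closure Y \<and> g z1 \<notin> M \<and> (?P z1 = 0 \<or> g z1 \<notin> Y) \<and>
      norm (?n z1 - ?n z0) \<le> norm (?n z0) * E \<and> norm (z1 - z0) \<le> 2 * norm z0 + norm (?n z0) * E"
    proof (cases "?P z0 = 0")
      case True
      have "norm z0 < \<eta>1" using z0n \<eta>21 K\<eta> \<eta>2(1) by linarith
      then show ?thesis using True z0c E by (intro exI[of _ z0]) auto
    next
      case False
      define q where "q = norm (?P z0)"
      define e where "e = - (1 / q) *\<^sub>R ?P z0"
      have q: "q > 0" "q \<le> norm z0" using False proj_norm[OF subspace_L, of z0] by (auto simp: q_def)
      have e: "e \<in> L" "norm e = 1" using q(1) by (auto simp: e_def q_def intro!: subspace_scale subspace_L proj_mem subspace_neg)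
      have Pe: "?P z0 = - q *\<^sub>R e" using q(1) by (simp add: e_def)
      \<comment> \<open>With \<sigma> equal to the projection itself, the position on the segment
        determines the radius, which decreases at rate 1; hence the sign -1 below.\<close>
      have nrm: "norm (?P z) = q - s" if "?P z = ?P z0 + s *\<^sub>R e" "s \<le> q" for z s
      proof -
        have "?P z = (s - q) *\<^sub>R e" unfolding that(1) Pe by (simp add: scaleR_diff_left)
        then show ?thesis using e(2) that(2) by simp
      qed
      obtain z1 where z1: "z1 \<in> ball 0 \<eta>1" "g z1 \<in> closure Y" "g z1 \<notin> M" "?P z1 = ?P z0 + q *\<^sub>R e \<or> g z1 \<notin> Y"
        "norm (?n z1 - ?n z0) \<le> norm (?n z0) * E" "norm (z1 - z0) \<le> 2 * q + norm (?n z0) * E"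
      proof (rule phase[where ?\<sigma> = ?P and ?S0.0 = ?P and ?e = e and ?\<iota> = "-1" and ?T = q and ?z0.0 = z0])
        show "norm (?P v) \<le> K * norm v" for v
          using proj_norm[OF subspace_L, of v] mult_right_mono[OF K(1) norm_ge_zero[of v]] by simp
        show "norm (?P u - ?P v - ?P (u - v)) \<le> 1/32 * norm (u - v)" for u v
          by (simp add: linear_diff[OF proj_linear[OF subspace_L]])
        show "(s' - s) / 6 \<le> - 1 * (norm (?P z') - norm (?P z))"
          if "s \<le> s'" "s' \<le> q" "?P z = ?P z0 + s *\<^sub>R e" "?P z' = ?P z0 + s' *\<^sub>R e" for z z' s s'
          using nrm[OF that(3)] nrm[OF that(4)] that(1,2) by simp
        show "norm z0 + 2 * q + norm (?n z0) * E < \<eta>1"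
          using q(2) z0n nE[of z0] n0 \<eta>21 K\<eta> \<eta>2(1) by linarith
      qed (use proj_bounded_linear[OF subspace_L] proj_id[OF subspace_L] proj_mem[OF subspace_L] e z0V z0c q in auto)
      have "?P z0 + q *\<^sub>R e = 0" unfolding Pe by simp
      then show ?thesis using z1 q(2) by (intro exI[of _ z1]) auto
    qed
    then obtain z1 where z1: "z1 \<in> ball 0 \<eta>1" "g z1 \<in> closure Y" "g z1 \<notin> M" "?P z1 = 0 \<or> g z1 \<notin> Y"
      "norm (?n z1 - ?n z0) \<le> norm (?n z0) * E" "norm (z1 - z0) \<le> 2 * norm z0 + norm (?n z0) * E"
      by blast
    have z1n: "norm z1 \<le> 4 * \<eta>2"
      using norm_triangle_ineq[of "z1 - z0" z0] z1(6) nE[of z0] n0 z0n by simp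
    have n1: "norm (?n z1) \<le> norm (?n z0) + norm (?n z0) * E" 
      using norm_triangle_ineq[of "?n z1 - ?n z0" "?n z0"] z1(5) by simp
    \<comment> \<open>If phase 1 has already hit the frontier of Y, its end point is returned
      unchanged: the rate is known on Y only.\<close>
    have "\<exists>z2. z2 \<in> ball 0 \<eta>1 \<and> g z2 \<in> closure Y \<and> g z2 \<notin> M \<and> (base_map z2 = \<xi> \<or> g z2 \<notin> Y) \<and>
      norm (?n z2 - ?n z1) \<le> norm (?n z1) * E"
    proof (cases "g z1 \<notin> Y \<or> base_map z1 = \<xi>")
      case True
      then show ?thesis using z1 E by (intro exI[of _ z1]) auto
    next
      case False
      have Pz1: "?P z1 = 0" using False z1(4) by blast
      define q where "q = norm (\<xi> - base_map z1)"
      define e where "e = (1 / q) *\<^sub>R (\<xi> - base_map z1)"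
      have "\<xi> \<noteq> base_map z1" using False by blast
      then have q: "q > 0" by (simp add: q_def)
      have e: "e \<in> L" "norm e = 1"
        using q near(2)[OF z1(1)] \<xi>L by (auto simp: e_def q_def intro!: subspace_scale subspace_L subspace_diff)
      have bz1: "norm (base_map z1) \<le> (K + 1) * (4 * \<eta>2)"
      proof -
        have "norm (base_map z1 - base_map 0 - base_deriv (z1 - 0)) \<le> 1/32 * norm (z1 - 0)"
          by (rule d1(2)) (use z1(1) \<eta>1(1,2) in auto)
        then have "norm (base_map z1 - base_deriv z1) \<le> 1/32 * norm z1" by simp
        then have "norm (base_map z1 - base_deriv z1) \<le> norm z1" using norm_ge_zero[of z1] by linarith
        then have "norm (base_map z1) \<le> K * norm z1 + norm z1"
          using norm_triangle_ineq[of "base_map z1 - base_deriv z1" "base_deriv z1"] K(2)[of z1] by simp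
        also have "\<dots> = (K + 1) * norm z1" by (simp add: distrib_right)
        also have "\<dots> \<le> (K + 1) * (4 * \<eta>2)" using z1n K(1) by (intro mult_left_mono) auto
        finally show ?thesis .
      qed
      have "q \<le> norm \<xi> + norm (base_map z1)" unfolding q_def by (rule norm_triangle_ineq4)
      then have qn: "q \<le> 5 * \<eta>2 + 4 * (K * \<eta>2)" using bz1 \<xi>n by (simp add: algebra_simps)
      obtain z2 where z2: "z2 \<in> ball 0 \<eta>1" "g z2 \<in> closure Y" "g z2 \<notin> M" "base_map z2 = base_map z1 + q *\<^sub>R e \<or> g z2 \<notin> Y"
        "norm (?n z2 - ?n z1) \<le> norm (?n z1) * E"
      proof (rule phase[where ?\<sigma> = base_map and ?S0.0 = base_deriv and ?e = e and ?\<iota> = 1 and ?T = q and ?z0.0 = z1])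
        show "norm (base_map u - base_map v - base_deriv (u - v)) \<le> 1/32 * norm (u - v)"
          if "u \<in> ball 0 \<eta>1" "v \<in> ball 0 \<eta>1" for u v
          by (rule d1(2)) (use that \<eta>1(2) in auto)
        show "(s' - s) / 6 \<le> 1 * (norm (?P z') - norm (?P z))"
          if "0 \<le> s" "s \<le> s'" "norm (?P z - ?P z1 - s *\<^sub>R e) \<le> s / 3"
            "norm (?P z' - ?P z - (s' - s) *\<^sub>R e) \<le> (s' - s) / 3" for z z' s s'
          using norm_increase_in_cone[OF e(2) that(1,2) _ that(4)] that(3) Pz1 by simp
        have "norm (?n z1) \<le> norm z1" by (rule proj_compl_norm[OF subspace_L])
        then have "norm z1 + 2 * q + norm (?n z1) * E \<le> 18 * \<eta>2 + 8 * (K * \<eta>2)"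
          using z1n qn nE[of z1] by linarith
        then show "norm z1 + 2 * q + norm (?n z1) * E < \<eta>1" using \<eta>21 \<eta>2(1) by linarith
      qed (use blS base_deriv_id K(2) near(2) e near(1)[OF z1(1)] z1(2,3) q in auto)
      have "base_map z1 + q *\<^sub>R e = \<xi>" using q by (simp add: e_def)
      then show ?thesis using z2 by (intro exI[of _ z2]) auto
    qed
    then obtain z2 where z2: "z2 \<in> ball 0 \<eta>1" "g z2 \<in> closure Y" "g z2 \<notin> M" "base_map z2 = \<xi> \<or> g z2 \<notin> Y"
      "norm (?n z2 - ?n z1) \<le> norm (?n z1) * E" by blast
    define N0 where "N0 = norm (?n z0)"
    have E1: "N0 * E \<le> k * N0" unfolding N0_def using E by (simp add: mult.commute mult_right_mono)
    have k1: "k * N0 \<le> 1/2 * N0" unfolding N0_def using k by (intro mult_right_mono) auto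
    have n1': "norm (?n z1) \<le> 2 * N0" using n1 E1 k1 norm_ge_zero[of "?n z0"] unfolding N0_def by linarith
    have "norm (?n z1) * E \<le> (2 * N0) * E" using n1' E by (intro mult_right_mono) auto
    then have "norm (?n z2 - ?n z1) \<le> 2 * (k * N0)" using z2(5) E1 by linarith
    moreover have "norm (?n z1 - ?n z0) \<le> k * N0" using z1(5) E1 by (simp add: N0_def)
    moreover have "norm (?n z2 - ?n z0) \<le> norm (?n z2 - ?n z1) + norm (?n z1 - ?n z0)"
      by (rule norm_diff_triangle_le[OF order_refl order_refl])
    ultimately have n20: "norm (?n z2 - ?n z0) \<le> 3 * (k * N0)" by linarith
    have n2: "norm (?n z2) \<le> 4 * N0"
    proof -
      have "norm (?n z2) \<le> norm (?n z2 - ?n z0) + N0"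
        unfolding N0_def using norm_triangle_ineq[of "?n z2 - ?n z0" "?n z0"] by simp
      then show ?thesis using n20 k1 norm_ge_zero[of "?n z0"] unfolding N0_def by linarith
    qed
    define F where "F z = g z - ?p (g z)" for z
    have "norm z0 < \<eta>1" using z0n \<eta>21 K\<eta> \<eta>2(1) by linarith
    then have z0b: "z0 \<in> ball 0 \<eta>1" by simp
    have F0: "norm (F z0 - normal_deriv (?n z0)) \<le> c * N0" unfolding F_def N0_def by (rule near(4)[OF z0b])
    have F2: "norm (F z2 - normal_deriv (?n z2)) \<le> c * (4 * N0)"
      unfolding F_def using near(4)[OF z2(1)] mult_left_mono[OF n2, of c] c(1) by linarith
    \<comment> \<open>Since C * c <= 1/2, the linearization error is absorbed on the left, and the
      chart normal is bounded by the true normal vector.\<close>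
    have lower: "N0 \<le> 2 * C * norm (F z0)"
    proof -
      have "norm (normal_deriv (?n z0)) \<le> norm (F z0) + norm (F z0 - normal_deriv (?n z0))"
        by (metis norm_triangle_sub norm_minus_commute)
      then have "N0 \<le> C * (norm (F z0) + c * N0)"
        using C(2)[of z0] F0 C(1) unfolding N0_def[symmetric]
        by (meson add_left_mono mult_left_mono order_trans less_imp_le)
      moreover have "C * c * N0 \<le> 1/2 * N0" using c(2) by (intro mult_right_mono) (auto simp: N0_def)
      ultimately show ?thesis by (simp add: algebra_simps)
    qed
    have eqF: "F z2 - F z0 = (F z2 - normal_deriv (?n z2)) - (F z0 - normal_deriv (?n z0)) + normal_deriv (?n z2 - ?n z0)"
      unfolding linear_diff[OF bounded_linear.linear[OF blN]] by simp
    have "norm (F z2 - F z0) \<le> norm (F z2 - normal_deriv (?n z2)) + norm (F z0 - normal_deriv (?n z0)) + norm (normal_deriv (?n z2 - ?n z0))"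
      unfolding eqF using norm_triangle_ineq[of "(F z2 - normal_deriv (?n z2)) - (F z0 - normal_deriv (?n z0))" "normal_deriv (?n z2 - ?n z0)"]
        norm_triangle_ineq4[of "F z2 - normal_deriv (?n z2)" "F z0 - normal_deriv (?n z0)"] by linarith
    moreover have "norm (normal_deriv (?n z2 - ?n z0)) \<le> 3 * (k * N0) * B"
      by (rule order_trans[OF B(2) mult_right_mono[OF n20]]) (use B(1) in simp)
    ultimately have "norm (F z2 - F z0) \<le> (5 * c + 3 * (B * k)) * N0"
      using F0 F2 by (simp add: algebra_simps)
    also have "\<dots> \<le> (5 * c + 3 * (B * k)) * (2 * C * norm (F z0))"
      using lower c(1) k(1) B(1) by (intro mult_left_mono) auto
    also have "\<dots> = (10 * (C * c) + 6 * (C * B * k)) * norm (F z0)" by (simp add: algebra_simps)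
    also have "\<dots> \<le> \<kappa> * norm (F z0)" using c(3) k(3) by (intro mult_right_mono) auto
    finally have F20: "norm (F z2 - F z0) \<le> \<kappa> * norm (F z0)" .
    have fin: "?p (g z2) = x \<or> g z2 \<notin> Y"
    proof (cases "g z2 \<in> Y")
      case True
      then have "h (?p (g z2)) = h x" using z2(4) by (simp add: base_map_def \<xi>_def)
      moreover have "?p (g z2) \<in> U" by (rule near(5)[OF z2(1)])
      ultimately show ?thesis using gh xU by metis
    qed simp
    show "\<exists>y'. y' \<in> closure Y \<and> y' \<notin> M \<and> dist y' x0 < \<beta> \<and>
      norm ((y' - ?p y') - (y - ?p y)) \<le> \<kappa> * norm (y - ?p y) \<and> (?p y' = x \<or> y' \<notin> Y)"
      using z2(2,3) near(3)[OF z2(1)] F20 fin unfolding F_def gz0 by blast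
  qed
qed

end

section \<open>Transport across the strata\<close>

lemma centered_chartI:
  assumes "flattening_chart M x L U h"
  obtains g h' g' where "centered_chart U (h ` U) h g h' g' M L" "g 0 = x"
proof -
  obtain g h' g' where c: "flat_chart U (h ` U) h g h' g' M L" "x \<in> U" "h x = 0"
    by (rule flattening_chart_diffeo[OF assms], rule that)
  interpret flat_chart U "h ` U" h g h' g' M L by (rule c)
  have "0 \<in> h ` U" using c(2,3) by (metis imageI)
  then have "centered_chart U (h ` U) h g h' g' M L" by unfold_locales
  moreover have "g 0 = x" using gh[OF c(2)] c(3) by simp
  ultimately show ?thesis by (rule that)
qed

lemma isCont_closest_point:
  assumes "C2_submanifold X" "x \<in> X"
  shows "isCont (closest_point X) x"
proof -
  obtain L U h where "flattening_chart X x L U h" using assms unfolding C2_submanifold_def by blast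
  then obtain g h' g' where c: "centered_chart U (h ` U) h g h' g' X L" "g 0 = x" by (rule centered_chartI)
  interpret centered_chart U "h ` U" h g h' g' X L by (rule c(1))
  show ?thesis using isCont_closest_point_x0 unfolding c(2) .
qed

lemma adjacent_transport:
  assumes X: "x0 \<in> X" and Y: "C2_submanifold Y" "Y \<inter> X = {}"
    and ar: "condition_a Y X" "condition_r_int Y X" and pos: "\<kappa> > 0" "\<beta> > 0"
  shows "\<exists>d>0. \<forall>y x. y \<in> Y \<longrightarrow> dist y x0 < d \<longrightarrow> x \<in> X \<longrightarrow> dist x x0 < d \<longrightarrow>
    (\<exists>y'. y' \<in> closure Y \<and> y' \<notin> X \<and> dist y' x0 < \<beta> \<and>
      norm ((y' - closest_point X y') - (y - closest_point X y)) \<le> \<kappa> * norm (y - closest_point X y) \<and>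
      (closest_point X y' = x \<or> y' \<notin> Y))"
proof -
  obtain L U h \<eta> \<epsilon> where r: "flattening_chart X x0 L U h" "\<eta> > 0" "\<epsilon> > 0"
    "(\<integral>\<^sup>+t\<in>{0..\<epsilon>}. r_function (h ` (U \<inter> Y)) L \<eta> t \<partial>lborel) < \<infinity>"
    using ar(2) X unfolding condition_r_int_def condition_r_int_at_def by blast
  obtain g h' g' where c: "centered_chart U (h ` U) h g h' g' X L" "g 0 = x0"
    using r(1) by (rule centered_chartI)
  interpret centered_chart U "h ` U" h g h' g' X L by (rule c(1))
  have a: "condition_a_at Y X (g 0)" using ar(1) X unfolding condition_a_def c(2) by blast
  show ?thesis
    by (rule stratum_transport[OF Y a r(4,2,3) pos]) (unfold c(2), blast)
qed

text \<open>Y is relatively open in its closure, so closure Y - Y lies in a closed set disjoint from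
  Y, which then contains closure Z.\<close>

lemma adjacent_antisym:
  assumes Y: "C2_submanifold Y" "Y \<noteq> {}" and "adjacent Y Z"
  shows "\<not> Y \<subseteq> closure Z"
proof
  assume YZ: "Y \<subseteq> closure Z"
  obtain G where G: "open G" "Y = G \<inter> closure Y" using C2_submanifold_locally_closed[OF Y(1)] .
  have "Z \<subseteq> closure Y - G" using assms(3) G(2) unfolding adjacent_def by blast
  moreover have "closed (closure Y - G)" using G(1) by (intro closed_Diff) auto
  ultimately have "closure Z \<subseteq> closure Y - G" by (rule closure_minimal)
  then show False using YZ G(2) Y(2) by blast
qed

text \<open>As \<kappa> <= 1, norm b <= 2 * norm a, so the two changes add up to at most (1 + 2) *
  \<kappa> * norm a.\<close>

lemma norm_perturb_trans:
  fixes a b c :: "'a::real_normed_vector"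
  assumes "norm (b - a) \<le> \<kappa> * norm a" "norm (c - b) \<le> \<kappa> * norm b" "0 \<le> \<kappa>" "\<kappa> \<le> 1"
  shows "norm (c - a) \<le> 3 * \<kappa> * norm a"
proof -
  have "norm b \<le> norm a + norm (b - a)" using norm_triangle_ineq[of a "b - a"] by simp
  also have "\<dots> \<le> norm a + 1 * norm a"
    using assms(1) mult_right_mono[OF assms(4) norm_ge_zero[of a]] by linarith
  finally have "\<kappa> * norm b \<le> \<kappa> * (2 * norm a)" using assms(3) by (intro mult_left_mono) auto
  moreover have "norm (c - a) \<le> norm (c - b) + norm (b - a)"
    by (rule norm_diff_triangle_le[OF order_refl order_refl])
  ultimately show ?thesis using assms(1,2) by linarith
qed

text \<open>Scaled by norm a, the difference of the directions is b - a plus a correction of length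
  at most norm (b - a). Since sgn 0 = 0, the case b = 0 with a nonzero remains, and there \<kappa>
  >= 1.\<close>

lemma norm_sgn_diff_le:
  fixes a b :: "'a::real_normed_vector"
  assumes "norm (b - a) \<le> \<kappa> * norm a" and \<kappa>: "0 \<le> \<kappa>"
  shows "norm (sgn b - sgn a) \<le> 2 * \<kappa>"
proof (cases "a = 0 \<or> b = 0")
  case True
  show ?thesis
  proof (cases "a = 0")
    case True
    then have "b = 0" using assms by simp
    then show ?thesis using True \<kappa> by simp
  next
    case False
    then have "b = 0" using True by blast
    then have "1 * norm a \<le> \<kappa> * norm a" using assms by simp
    then have "1 \<le> \<kappa>" using False by (simp only: mult_le_cancel_right) auto
    then show ?thesis using False \<open>b = 0\<close> by (simp add: norm_sgn)
  qed
next
  case False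
  then have na: "norm a > 0" and nb: "norm b > 0" by auto
  have "norm a *\<^sub>R (sgn b - sgn a) = (b - a) + (norm a - norm b) *\<^sub>R sgn b"
    using na nb by (simp add: sgn_div_norm algebra_simps)
  then have "norm a * norm (sgn b - sgn a) \<le> norm (b - a) + \<bar>norm a - norm b\<bar> * norm (sgn b)"
    using norm_triangle_ineq[of "b - a" "(norm a - norm b) *\<^sub>R sgn b"] na
    by (metis abs_norm_cancel norm_scaleR)
  also have "\<dots> \<le> norm (b - a) + norm (b - a)"
    using norm_triangle_ineq3[of a b] nb by (simp add: norm_sgn norm_minus_commute)
  also have "\<dots> \<le> norm a * (2 * \<kappa>)" using assms by (simp add: mult.commute)
  finally show ?thesis using na by simp
qed

context
  fixes S :: "'a::euclidean_space set" and \<X> :: "'a set set" and D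
  assumes closed: "closed S" and strat: "definable_stratification D S \<X>"
    and reg: "\<And>X Y. X \<in> \<X> \<Longrightarrow> Y \<in> \<X> \<Longrightarrow> adjacent Y X \<Longrightarrow> condition_a Y X \<and> condition_r_int Y X"
begin

lemma strata: "\<Union>\<X> = S" "X \<in> \<X> \<Longrightarrow> X \<noteq> {}" "X \<in> \<X> \<Longrightarrow> C2_submanifold X"
  and strata_disjoint: "X \<in> \<X> \<Longrightarrow> Y \<in> \<X> \<Longrightarrow> X \<noteq> Y \<Longrightarrow> X \<inter> Y = {}"
  and frontier_property: "X \<in> \<X> \<Longrightarrow> Y \<in> \<X> \<Longrightarrow> X \<inter> closure Y \<noteq> {} \<Longrightarrow> X \<subseteq> closure Y"
  and locally_finite: "\<exists>W. open W \<and> x \<in> W \<and> finite {X \<in> \<X>. X \<inter> W \<noteq> {}}"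
  using strat unfolding definable_stratification_def partition_on_def locally_finite_in_def
  by (auto simp: disjoint_def)

lemma adjacentI: "X \<in> \<X> \<Longrightarrow> Y \<in> \<X> \<Longrightarrow> X \<noteq> Y \<Longrightarrow> X \<inter> closure Y \<noteq> {} \<Longrightarrow> adjacent Y X"
  unfolding adjacent_def using frontier_property[of X Y] strata_disjoint[of X Y] by blast

text \<open>Charts for different strata are unrelated, so whenever a motion hits the frontier of its
  stratum \<open>Y\<close> it is started afresh in the stratum that was hit.  Adjacency is a strict order,
  whence the induction on the number of strata in the frontier of \<open>Y\<close>.\<close>

lemma transport:
  assumes X: "X \<in> \<X>" "x0 \<in> X" and pos: "\<kappa> > 0" "\<beta> > 0"
  obtains d where "d > 0" "\<And>y x. y \<in> S \<Longrightarrow> y \<notin> X \<Longrightarrow> dist y x0 < d \<Longrightarrow> x \<in> X \<Longrightarrow> dist x x0 < d \<Longrightarrow>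
    \<exists>y'. y' \<in> S \<and> y' \<notin> X \<and> dist y' x0 < \<beta> \<and> closest_point X y' = x \<and>
      norm ((y' - closest_point X y') - (y - closest_point X y)) \<le> \<kappa> * norm (y - closest_point X y)"
proof -
  let ?m = "\<lambda>y. y - closest_point X y"
  define \<Y> where "\<Y> = {Y \<in> \<X>. Y \<noteq> X \<and> x0 \<in> closure Y}"
  obtain W where W: "open W" "x0 \<in> W" "finite {Y \<in> \<X>. Y \<inter> W \<noteq> {}}" using locally_finite by blast
  have fin: "finite \<Y>"
    by (rule finite_subset[OF _ W(3)]) (use W(1,2) in \<open>auto simp: \<Y>_def closure_iff_nhds_not_empty\<close>)
  \<comment> \<open>F collects the closures, finitely many, of those strata meeting W that do not
    come near x0. Off F and inside W only X and the members of \<Y> occur.\<close>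
  define F where "F = (\<Union>Y\<in>{Y \<in> \<X>. Y \<inter> W \<noteq> {}} - insert X \<Y>. closure Y)"
  have "closed F" unfolding F_def using W(3) by (intro closed_UN) auto
  moreover have "x0 \<notin> F" using X unfolding F_def \<Y>_def by blast
  ultimately have "open (W - F)" "x0 \<in> W - F" using W by (auto intro: open_Diff)
  then obtain d0 where d0: "d0 > 0" "ball x0 d0 \<subseteq> W - F" using openE by blast
  have cover: "\<exists>Y\<in>\<Y>. y \<in> Y" if y: "y \<in> S" "y \<notin> X" "dist y x0 < d0" for y
  proof -
    obtain Y where Y: "Y \<in> \<X>" "y \<in> Y" using y(1) strata(1) by blast
    have yW: "y \<in> W" "y \<notin> F" using d0(2) y(3) by (auto simp: dist_commute)
    have "y \<in> closure Y" using Y(2) closure_subset by blast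
    then have "Y \<in> insert X \<Y>" using Y yW unfolding F_def by blast
    then show ?thesis using Y(2) y(2) by blast
  qed
  have adjX: "adjacent Y X" "Y \<in> \<X>" "Y \<inter> X = {}" if "Y \<in> \<Y>" for Y
    using that X adjacentI[of X Y] strata_disjoint[of Y X] by (auto simp: \<Y>_def)
  have uniform: "\<exists>d>0. \<forall>Z\<in>\<Z>. P Z d" if "finite \<Z>" "\<And>Z. Z \<in> \<Z> \<Longrightarrow> \<exists>d>0. P Z d"
    "\<And>Z d d'. P Z d \<Longrightarrow> d' \<le> d \<Longrightarrow> P Z d'" for \<Z> :: "'a set set" and P :: "'a set \<Rightarrow> real \<Rightarrow> bool"
    using that(1,2)
  proof (induction \<Z> rule: finite_induct)
    case empty
    show ?case by (intro exI[of _ 1]) simp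
  next
    case (insert Z \<Z>)
    obtain d1 where "d1 > 0" "\<forall>Z\<in>\<Z>. P Z d1" using insert by blast
    moreover obtain d2 where "d2 > 0" "P Z d2" using insert.prems by blast
    ultimately show ?case using that(3) by (intro exI[of _ "min d1 d2"]) auto
  qed
  define good where "good \<kappa> \<beta> Y d \<longleftrightarrow> (\<forall>y x. y \<in> Y \<longrightarrow> dist y x0 < d \<longrightarrow> x \<in> X \<longrightarrow> dist x x0 < d \<longrightarrow>
    (\<exists>y'. y' \<in> S \<and> y' \<notin> X \<and> dist y' x0 < \<beta> \<and> closest_point X y' = x \<and>
      norm (?m y' - ?m y) \<le> \<kappa> * norm (?m y)))" for \<kappa> \<beta> Y d
  have good_mono: "good \<kappa> \<beta> Y d'" if "good \<kappa> \<beta> Y d" "d' \<le> d" for \<kappa> \<beta> Y d d'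
    using that unfolding good_def by (meson order_less_le_trans)
  have main: "\<exists>d>0. good \<kappa> \<beta> Y d" if "Y \<in> \<Y>" "\<kappa> > 0" "\<beta> > 0" for Y \<kappa> \<beta>
    using that
  proof (induction "card {Z \<in> \<Y>. adjacent Y Z}" arbitrary: Y \<kappa> \<beta> rule: less_induct)
    case less
    \<comment> \<open>One motion in Y and one continuation from its frontier multiply the tolerance
      by 3.\<close>
    define \<kappa>1 where "\<kappa>1 = min 1 (\<kappa> / 3)"
    have \<kappa>1: "\<kappa>1 > 0" "\<kappa>1 \<le> 1" "3 * \<kappa>1 \<le> \<kappa>" using less.prems(2) by (auto simp: \<kappa>1_def)
    have exZ: "\<exists>d>0. good \<kappa>1 \<beta> Z d" if Z: "Z \<in> {Z \<in> \<Y>. adjacent Y Z}" for Z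
    proof (rule less.hyps)
      have YZ: "adjacent Y Z" "Z \<in> \<Y>" using Z by auto
      have "\<not> adjacent Z Z" using adjX(2)[OF YZ(2)] strata(2) unfolding adjacent_def by blast
      moreover have "adjacent Y A" if A: "A \<in> \<Y>" "adjacent Z A" for A
      proof -
        have "closure Z \<subseteq> closure Y" using YZ(1) unfolding adjacent_def by (intro closure_minimal) auto
        then have "A \<subseteq> closure Y" using A(2) unfolding adjacent_def by blast
        moreover have "A \<noteq> Y"
          using adjacent_antisym[OF strata(3) strata(2) YZ(1)] adjX(2)[OF less.prems(1)] A(2) unfolding adjacent_def by blast
        ultimately show ?thesis
          unfolding adjacent_def using strata_disjoint adjX(2)[OF A(1)] adjX(2)[OF less.prems(1)] by blast
      qed
      ultimately have "{A \<in> \<Y>. adjacent Z A} \<subset> {A \<in> \<Y>. adjacent Y A}" using YZ by blast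
      then show "card {A \<in> \<Y>. adjacent Z A} < card {A \<in> \<Y>. adjacent Y A}"
        using fin by (intro psubset_card_mono) auto
    qed (use Z \<kappa>1 less.prems in auto)
    have "\<exists>d>0. \<forall>Z\<in>{Z \<in> \<Y>. adjacent Y Z}. good \<kappa>1 \<beta> Z d"
    proof (rule uniform)
      show "finite {Z \<in> \<Y>. adjacent Y Z}" using fin by simp
    qed (rule exZ good_mono; assumption)+
    then obtain d1 where d1: "d1 > 0" "\<forall>Z\<in>{Z \<in> \<Y>. adjacent Y Z}. good \<kappa>1 \<beta> Z d1" by blast
    \<comment> \<open>The motion in Y must end where the strata of \<Y> cover S - X (d0) and where
      the induction hypothesis applies to the stratum that was hit (d1).\<close>
    define \<beta>1 where "\<beta>1 = min \<beta> (min d0 d1)"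
    have \<beta>1: "\<beta>1 > 0" "\<beta>1 \<le> \<beta>" "\<beta>1 \<le> d0" "\<beta>1 \<le> d1" using less.prems(3) d0(1) d1(1) by (auto simp: \<beta>1_def)
    note Y = adjX[OF less.prems(1)]
    have "condition_a Y X" "condition_r_int Y X" using reg[OF X(1) Y(2,1)] by auto
    from adjacent_transport[OF X(2) strata(3)[OF Y(2)] Y(3) this \<kappa>1(1) \<beta>1(1)]
    obtain d2 where d2: "d2 > 0" "\<And>y x. y \<in> Y \<Longrightarrow> dist y x0 < d2 \<Longrightarrow> x \<in> X \<Longrightarrow> dist x x0 < d2 \<Longrightarrow>
      \<exists>y'. y' \<in> closure Y \<and> y' \<notin> X \<and> dist y' x0 < \<beta>1 \<and> norm (?m y' - ?m y) \<le> \<kappa>1 * norm (?m y) \<and>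
      (closest_point X y' = x \<or> y' \<notin> Y)" by blast
    have "good \<kappa> \<beta> Y (min d1 d2)" unfolding good_def
    proof (intro allI impI)
      fix y x assume y: "y \<in> Y" "dist y x0 < min d1 d2" and x: "x \<in> X" "dist x x0 < min d1 d2"
      obtain y' where y': "y' \<in> closure Y" "y' \<notin> X" "dist y' x0 < \<beta>1" "norm (?m y' - ?m y) \<le> \<kappa>1 * norm (?m y)"
        "closest_point X y' = x \<or> y' \<notin> Y"
        using d2(2)[OF y(1) _ x(1)] y(2) x(2) by auto
      have "closure Y \<subseteq> S" using strata(1) Y(2) closed by (intro closure_minimal) auto
      then have y'S: "y' \<in> S" using y'(1) by blast
      show "\<exists>y'. y' \<in> S \<and> y' \<notin> X \<and> dist y' x0 < \<beta> \<and> closest_point X y' = x \<and> norm (?m y' - ?m y) \<le> \<kappa> * norm (?m y)"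
      proof (cases "closest_point X y' = x")
        case True
        have "\<kappa>1 * norm (?m y) \<le> \<kappa> * norm (?m y)" using \<kappa>1 by (intro mult_right_mono) auto
        then show ?thesis using True y' y'S \<beta>1(2) by (intro exI[of _ y']) auto
      next
        case False
        then have "y' \<notin> Y" using y'(5) by blast
        obtain Z where Z: "Z \<in> \<Y>" "y' \<in> Z" using cover[OF y'S y'(2)] y'(3) \<beta>1(3) by auto
        have "adjacent Y Z"
          using adjacentI[OF adjX(2)[OF Z(1)] Y(2)] Z(2) y'(1) \<open>y' \<notin> Y\<close> by blast
        then have "good \<kappa>1 \<beta> Z d1" using d1(2) Z(1) by blast
        moreover have "dist y' x0 < d1" "dist x x0 < d1" using y'(3) \<beta>1(4) x(2) by auto
        ultimately obtain y'' where y'': "y'' \<in> S" "y'' \<notin> X" "dist y'' x0 < \<beta>" "closest_point X y'' = x"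
          "norm (?m y'' - ?m y') \<le> \<kappa>1 * norm (?m y')"
          unfolding good_def using Z(2) x(1) by blast
        have "norm (?m y'' - ?m y) \<le> 3 * \<kappa>1 * norm (?m y)"
          by (rule norm_perturb_trans[OF y'(4) y''(5)]) (use \<kappa>1 in auto)
        also have "\<dots> \<le> \<kappa> * norm (?m y)" using \<kappa>1 by (intro mult_right_mono) auto
        finally show ?thesis using y'' by blast
      qed
    qed
    then show ?case using d1(1) d2(1) by (intro exI[of _ "min d1 d2"]) auto
  qed
  obtain d where d: "d > 0" "\<forall>Y\<in>\<Y>. good \<kappa> \<beta> Y d"
    using uniform[OF fin, of "good \<kappa> \<beta>"] main pos good_mono by blast
  show ?thesis
  proof (rule that[of "min d d0"])
    fix y x assume y: "y \<in> S" "y \<notin> X" "dist y x0 < min d d0" and x: "x \<in> X" "dist x x0 < min d d0"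
    obtain Y where "Y \<in> \<Y>" "y \<in> Y" using cover[OF y(1,2)] y(3) by auto
    then show "\<exists>y'. y' \<in> S \<and> y' \<notin> X \<and> dist y' x0 < \<beta> \<and> closest_point X y' = x \<and> norm (?m y' - ?m y) \<le> \<kappa> * norm (?m y)"
      using d(2) y(3) x unfolding good_def by auto
  qed (use d(1) d0(1) in auto)
qed

section \<open>Normal directions under transport: (npf) and (n)\<close>

lemma normal_cone_iff:
  "(x, u) \<in> normal_cone X S \<longleftrightarrow> x \<in> X \<and> norm u = 1 \<and>
     (\<exists>y :: nat \<Rightarrow> 'a. (\<forall>i. y i \<in> S - X) \<and> y \<longlonglongrightarrow> x \<and> (\<lambda>i. sgn (closest_point X (y i) - y i)) \<longlonglongrightarrow> u)"
    (is "_ \<longleftrightarrow> _ \<and> _ \<and> ?lim")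
proof -
  let ?G = "{(y, sgn (closest_point X y - y)) | y. y \<in> S - X}"
  have "(x, u) \<in> closure ?G \<longleftrightarrow> ?lim"
  proof
    assume "(x, u) \<in> closure ?G"
    then obtain q where q: "\<And>i::nat. q i \<in> ?G" "q \<longlonglongrightarrow> (x, u)" unfolding closure_sequential by blast
    have q1: "fst (q i) \<in> S - X" "snd (q i) = sgn (closest_point X (fst (q i)) - fst (q i))" for i
      using q(1)[of i] by auto
    have "(\<lambda>i. fst (q i)) \<longlonglongrightarrow> x" "(\<lambda>i. snd (q i)) \<longlonglongrightarrow> u"
      using tendsto_fst[OF q(2)] tendsto_snd[OF q(2)] by simp_all
    then show ?lim
      using q1 by (intro exI[of _ "\<lambda>i. fst (q i)"]) auto
  next
    assume ?lim
    then obtain y :: "nat \<Rightarrow> 'a" where y: "\<And>i. y i \<in> S - X" "y \<longlonglongrightarrow> x" "(\<lambda>i. sgn (closest_point X (y i) - y i)) \<longlonglongrightarrow> u"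
      by blast
    then show "(x, u) \<in> closure ?G"
      unfolding closure_sequential
      by (intro exI[of _ "\<lambda>i. (y i, sgn (closest_point X (y i) - y i))"] conjI allI tendsto_Pair) blast+
  qed
  then show ?thesis by (auto simp: normal_cone_def)
qed

text \<open>A sequence realizing u at x is transported to the single base point x'. Its normal
  vectors remain at most 1 + \<kappa> times as long as before, so the new points converge to x', and
  compactness of the sphere yields a limit direction near u.\<close>

lemma normal_cone_open:
  assumes X: "X \<in> \<X>" and xu: "(x, u) \<in> normal_cone X S" and \<kappa>: "\<kappa> > 0"
  obtains d where "d > 0" "\<And>x'. x' \<in> X \<Longrightarrow> dist x' x < d \<Longrightarrow> \<exists>u'. (x', u') \<in> normal_cone X S \<and> dist u' u \<le> 2 * \<kappa>"
proof -
  let ?m = "\<lambda>y. y - closest_point X y"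
  have x: "x \<in> X" using xu by (simp add: normal_cone_iff)
  obtain y where y: "\<And>i::nat. y i \<in> S - X" "y \<longlonglongrightarrow> x" "(\<lambda>i. sgn (closest_point X (y i) - y i)) \<longlonglongrightarrow> u"
    using xu unfolding normal_cone_iff by blast
  obtain d where d: "d > 0" "\<And>y x'. y \<in> S \<Longrightarrow> y \<notin> X \<Longrightarrow> dist y x < d \<Longrightarrow> x' \<in> X \<Longrightarrow> dist x' x < d \<Longrightarrow>
    \<exists>y'. y' \<in> S \<and> y' \<notin> X \<and> dist y' x < 1 \<and> closest_point X y' = x' \<and> norm (?m y' - ?m y) \<le> \<kappa> * norm (?m y)"
    by (rule transport[OF X x \<kappa> zero_less_one], rule that)
  show ?thesis
  proof (rule that[OF d(1)])
    fix x' assume x': "x' \<in> X" "dist x' x < d"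
    obtain i0 where i0: "\<And>i. i \<ge> i0 \<Longrightarrow> dist (y i) x < d"
      using tendstoD[OF y(2) d(1)] unfolding eventually_sequentially by blast
    define w where "w i = y (i + i0)" for i
    have w: "w i \<in> S - X" "dist (w i) x < d" for i using y(1) i0 by (auto simp: w_def)
    have wl: "w \<longlonglongrightarrow> x" unfolding w_def using y(2) by (rule LIMSEQ_ignore_initial_segment)
    have wu: "(\<lambda>i. sgn (closest_point X (w i) - w i)) \<longlonglongrightarrow> u"
      unfolding w_def using y(3) by (rule LIMSEQ_ignore_initial_segment)
    have "\<forall>i. \<exists>y'. y' \<in> S \<and> y' \<notin> X \<and> closest_point X y' = x' \<and> norm (?m y' - ?m (w i)) \<le> \<kappa> * norm (?m (w i))"
      using d(2)[OF _ _ w(2) x'] w(1) by blast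
    from choice[OF this] obtain v where v: "\<And>i. v i \<in> S" "\<And>i. v i \<notin> X" "\<And>i. closest_point X (v i) = x'"
      "\<And>i. norm (?m (v i) - ?m (w i)) \<le> \<kappa> * norm (?m (w i))" by blast
    have "(\<lambda>i. closest_point X (w i)) \<longlonglongrightarrow> closest_point X x"
      using isCont_closest_point[OF strata(3)[OF X] x] wl by (rule isCont_tendsto_compose)
    then have "(\<lambda>i. ?m (w i)) \<longlonglongrightarrow> x - x"
      unfolding closest_point_self[OF x] by (intro tendsto_diff wl)
    then have mw: "(\<lambda>i. norm (?m (w i))) \<longlonglongrightarrow> 0" using tendsto_norm by fastforce
    have "(\<lambda>i. ?m (v i)) \<longlonglongrightarrow> 0"
    proof (rule Lim_null_comparison)
      show "(\<lambda>i. (1 + \<kappa>) * norm (?m (w i))) \<longlonglongrightarrow> 0" using tendsto_mult_left[OF mw, of "1 + \<kappa>"] by simp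
      show "\<forall>\<^sub>F i in sequentially. norm (?m (v i)) \<le> (1 + \<kappa>) * norm (?m (w i))"
      proof (rule always_eventually, rule allI)
        fix i
        have "norm (?m (v i)) \<le> norm (?m (v i) - ?m (w i)) + norm (?m (w i))"
          using norm_triangle_ineq[of "?m (v i) - ?m (w i)" "?m (w i)"] by simp
        then show "norm (?m (v i)) \<le> (1 + \<kappa>) * norm (?m (w i))" using v(4)[of i] by (simp add: distrib_right)
      qed
    qed
    then have vl: "v \<longlonglongrightarrow> x'" unfolding v(3) by (rule LIM_zero_cancel)
    define s where "s i = sgn (closest_point X (v i) - v i)" for i
    have ns: "norm (s i) = 1" for i
    proof -
      have "x' \<noteq> v i" using x'(1) v(2) by blast
      then show ?thesis by (simp add: s_def v(3) norm_sgn)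
    qed
    have sd: "norm (s i - sgn (closest_point X (w i) - w i)) \<le> 2 * \<kappa>" for i
      unfolding s_def by (rule norm_sgn_diff_le[OF _ less_imp_le[OF \<kappa>]]) (use v(4)[of i] in \<open>simp add: norm_minus_commute algebra_simps\<close>)
    obtain u' r where r: "u' \<in> sphere 0 1" "strict_mono r" "(s \<circ> r) \<longlonglongrightarrow> u'"
      using compact_sphere[of "0::'a" 1] ns unfolding compact_def by (metis dist_0_norm mem_sphere)
    have "(x', u') \<in> normal_cone X S"
      unfolding normal_cone_iff
    proof (intro conjI exI[of _ "v \<circ> r"] allI)
      show "(v \<circ> r) \<longlonglongrightarrow> x'" by (rule LIMSEQ_subseq_LIMSEQ[OF vl r(2)])
      show "(\<lambda>i. sgn (closest_point X ((v \<circ> r) i) - (v \<circ> r) i)) \<longlonglongrightarrow> u'" using r(3) by (simp add: s_def o_def)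
    qed (use x'(1) r(1) v in auto)
    moreover have "norm (u' - u) \<le> 2 * \<kappa>"
    proof (rule LIMSEQ_le_const2)
      show "(\<lambda>i. norm ((s \<circ> r) i - ((\<lambda>i. sgn (closest_point X (w i) - w i)) \<circ> r) i)) \<longlonglongrightarrow> norm (u' - u)"
        by (intro tendsto_norm tendsto_diff r(3) LIMSEQ_subseq_LIMSEQ[OF wu r(2)])
      show "\<exists>N. \<forall>i\<ge>N. norm ((s \<circ> r) i - ((\<lambda>i. sgn (closest_point X (w i) - w i)) \<circ> r) i) \<le> 2 * \<kappa>"
        using sd by simp
    qed
    ultimately show "\<exists>u'. (x', u') \<in> normal_cone X S \<and> dist u' u \<le> 2 * \<kappa>" by (auto simp: dist_norm)
  qed
qed

lemma npf_along_stratum: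
  assumes X: "X \<in> \<X>"
  shows "condition_npf S X"
  unfolding condition_npf_def open_map_def
proof (intro allI impI)
  fix W assume "openin (top_of_set (normal_cone X S)) W"
  then obtain G where G: "open G" "W = normal_cone X S \<inter> G" unfolding openin_open by blast
  show "openin (top_of_set X) (fst ` W)"
    unfolding openin_contains_ball
  proof (intro conjI ballI)
    show "fst ` W \<subseteq> X" unfolding G(2) normal_cone_def by auto
    fix x assume "x \<in> fst ` W"
    then obtain u where u: "(x, u) \<in> W" by auto
    then obtain e where e: "e > 0" "ball (x, u) e \<subseteq> G" using G openE by blast
    have xu: "(x, u) \<in> normal_cone X S" using u G by blast
    have e8: "e / 8 > 0" using e(1) by simp
    obtain d where d: "d > 0" "\<And>x'. x' \<in> X \<Longrightarrow> dist x' x < d \<Longrightarrow> \<exists>u'. (x', u') \<in> normal_cone X S \<and> dist u' u \<le> 2 * (e / 8)"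
      by (rule normal_cone_open[OF X xu e8], rule that)
    have "ball x (min d (e / 2)) \<inter> X \<subseteq> fst ` W"
    proof
      fix x' assume x': "x' \<in> ball x (min d (e / 2)) \<inter> X"
      then obtain u' where u': "(x', u') \<in> normal_cone X S" "dist u' u \<le> 2 * (e / 8)"
        using d(2)[of x'] by (auto simp: dist_commute)
      have "dist (x, u) (x', u') \<le> dist x x' + dist u u'"
        unfolding dist_Pair_Pair by (rule sqrt_sum_squares_le_sum) simp_all
      also have "\<dots> < e" using x' u'(2) e(1) by (simp add: dist_commute)
      finally have "(x', u') \<in> W" using e(2) u'(1) G(2) by auto
      then show "x' \<in> fst ` W" by force
    qed
    then show "\<exists>e>0. ball x e \<inter> X \<subseteq> fst ` W" using d(1) e(1) by (intro exI[of _ "min d (e / 2)"]) auto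
  qed
qed

text \<open>A normal direction at x is realized in the fibre by a diagonal sequence of transports to
  x itself with tolerances 1 / (k + 1). The converse inclusion holds because points of X are their
  own closest points, so a fibre point other than x lies off X.\<close>

lemma n_along_stratum:
  assumes X: "X \<in> \<X>"
  shows "condition_n S X"
  unfolding condition_n_def
proof (intro ballI set_eqI iffI)
  fix x u assume x: "x \<in> X" and "u \<in> {u. (x, u) \<in> normal_cone X S}"
  then obtain y where y: "\<And>i::nat. y i \<in> S - X" "y \<longlonglongrightarrow> x" "(\<lambda>i. sgn (closest_point X (y i) - y i)) \<longlonglongrightarrow> u"
    unfolding normal_cone_iff by blast
  let ?m = "\<lambda>y. y - closest_point X y"
  have "\<forall>k. \<exists>v. v \<in> S \<and> v \<notin> X \<and> closest_point X v = x \<and> dist v x < inverse (real (Suc k)) \<and>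
      norm (sgn (x - v) - u) \<le> 3 * inverse (real (Suc k))" (is "\<forall>k. ?claim k")
  proof
    fix k
    define \<kappa> where "\<kappa> = inverse (real (Suc k))"
    have \<kappa>: "\<kappa> > 0" by (simp add: \<kappa>_def)
    obtain d where d: "d > 0" "\<And>y x'. y \<in> S \<Longrightarrow> y \<notin> X \<Longrightarrow> dist y x < d \<Longrightarrow> x' \<in> X \<Longrightarrow> dist x' x < d \<Longrightarrow>
      \<exists>y'. y' \<in> S \<and> y' \<notin> X \<and> dist y' x < \<kappa> \<and> closest_point X y' = x' \<and> norm (?m y' - ?m y) \<le> \<kappa> * norm (?m y)"
      by (rule transport[OF X x \<kappa> \<kappa>], rule that)
    obtain i where i: "dist (y i) x < d" "dist (sgn (closest_point X (y i) - y i)) u < \<kappa>"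
      using eventually_conj[OF tendstoD[OF y(2) d(1)] tendstoD[OF y(3) \<kappa>]] unfolding eventually_sequentially by blast
    obtain v where v: "v \<in> S" "v \<notin> X" "dist v x < \<kappa>" "closest_point X v = x" "norm (?m v - ?m (y i)) \<le> \<kappa> * norm (?m (y i))"
      using d(2)[OF _ _ i(1) x] y(1)[of i] d(1) by auto
    have "norm (sgn (closest_point X v - v) - sgn (closest_point X (y i) - y i)) \<le> 2 * \<kappa>"
      by (rule norm_sgn_diff_le[OF _ less_imp_le[OF \<kappa>]]) (use v(5) in \<open>simp add: norm_minus_commute algebra_simps\<close>)
    then have "norm (sgn (x - v) - u) \<le> 3 * \<kappa>"
      using i(2) norm_triangle_ineq[of "sgn (x - v) - sgn (closest_point X (y i) - y i)" "sgn (closest_point X (y i) - y i) - u"]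
      by (simp add: v(4) dist_norm)
    then show "?claim k"
      using v unfolding \<kappa>_def by blast
  qed
  from choice[OF this] obtain v where v: "\<And>k. v k \<in> S" "\<And>k. v k \<notin> X" "\<And>k. closest_point X (v k) = x"
    "\<And>k. dist (v k) x < inverse (real (Suc k))" "\<And>k. norm (sgn (x - v k) - u) \<le> 3 * inverse (real (Suc k))" by blast
  have "v \<longlonglongrightarrow> x"
    by (rule metric_tendsto_imp_tendsto[OF LIMSEQ_inverse_real_of_nat])
      (use v(4) in \<open>auto intro!: always_eventually less_imp_le\<close>)
  moreover have "(\<lambda>k. sgn (x - v k) - u) \<longlonglongrightarrow> 0"
  proof (rule Lim_null_comparison)
    show "(\<lambda>k. 3 * inverse (real (Suc k))) \<longlonglongrightarrow> 0"
      using tendsto_mult_left[OF LIMSEQ_inverse_real_of_nat, of 3] by simp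
  qed (use v(5) in \<open>simp add: always_eventually\<close>)
  then have "(\<lambda>k. sgn (x - v k)) \<longlonglongrightarrow> u" by (rule LIM_zero_cancel)
  ultimately show "u \<in> tangent_cone {y \<in> S. closest_point X y = x} x"
    unfolding tangent_cone_def using v(1-3) x by (intro CollectI exI[of _ v]) blast
next
  fix x u assume x: "x \<in> X" and "u \<in> tangent_cone {y \<in> S. closest_point X y = x} x"
  then obtain y where y: "\<And>i::nat. y i \<in> {y \<in> S. closest_point X y = x} - {x}" "y \<longlonglongrightarrow> x" "(\<lambda>i. sgn (x - y i)) \<longlonglongrightarrow> u"
    unfolding tangent_cone_def by blast
  have "y i \<in> S - X" for i using y(1)[of i] closest_point_self[of "y i" X] by auto
  moreover have "norm u = 1"
  proof (rule LIMSEQ_unique[OF tendsto_norm[OF y(3)]])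
    have "norm (sgn (x - y i)) = 1" for i using y(1)[of i] by (auto simp: norm_sgn)
    then show "(\<lambda>i. norm (sgn (x - y i))) \<longlonglongrightarrow> 1" by simp
  qed
  moreover have "(\<lambda>i. sgn (closest_point X (y i) - y i)) = (\<lambda>i. sgn (x - y i))" using y(1) by auto
  ultimately show "u \<in> {u. (x, u) \<in> normal_cone X S}"
    unfolding mem_Collect_eq normal_cone_iff using x y(2,3) by (intro conjI exI[of _ y]) auto
qed

end

theorem theorem3p8:
  fixes D :: "nat \<Rightarrow> real list set set"
    and S :: "(real ^ 'n) set" and \<X> :: "(real ^ 'n) set set"
  assumes "o_minimal_expansion_of_reals D"
    and "closed S" and "definable D S"
    and "definable_stratification D S \<X>"
    and "\<And>X Y. X \<in> \<X> \<Longrightarrow> Y \<in> \<X> \<Longrightarrow> adjacent Y X \<Longrightarrow> condition_a Y X \<and> condition_r_int Y X"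
  shows "\<forall>X\<in>\<X>. condition_npf S X \<and> condition_n S X"
proof -
  note a = assms(2,4,5)
  show ?thesis using npf_along_stratum[OF a] n_along_stratum[OF a] by blast
qed

end
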